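(* Let $f:\Sigma^*\to\mathbb{N}_0$ be a $\#\mathsf{L}$ function. Let $g:\Sigma^*\times\mathbb{N}_0\to\Sigma^*$ be an $\mathsf{FL}$ function. Let $p:\Sigma^*\to\mathbb{N}_0$ be an $\mathsf{FL}_{\ge 0}$ function whose output value $p(x)$ is at most polynomial in the size $|x|$ of the input. Then the function $$F:\Sigma^*\to\mathbb{N}_0,\qquad x\mapsto\prod_{i=1}^{p(x)} f(g(x,i))$$ is in $\#\mathsf{L}$.
   Context: $\Sigma=\{0,1\}$, and integers are encoded in binary. $\#\mathsf{L}$ is the class of functions $f:\Sigma^*\to\mathbb{N}_0$ such that $f(x)$ is the number of accepting computation paths on input $x$ of a fixed nondeterministic Turing machine with read-only input tape that uses $O(\log|x|)$ work space and halts on every computation path. Equivalently: there are a polynomial $q$ and a deterministic $O(\log|x|)$-space Turing machine $M$ with an additional read-once, left-to-right witness tape such that $f(x)=\#\{w\in\Sigma^{q(|x|)}\mid M(x,w)=\mathsf{yes}\}$. $\mathsf{FL}$ is the class of functions computable by a deterministic log-space Turing machine with read-only input tape and a write-only output tape (whose length is not counted as space). $\mathsf{FL}_{\ge0}$ is the class of $\mathsf{FL}$ functions with values in $\mathbb{N}_0$. *)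

theory Defs
  imports Complex_Main "HOL-Library.Landau_Symbols" "HOL-Computational_Algebra.Polynomial"
begin

text \<open>
  Turing machines with a read-only two-way input tape, finitely many work tapes that are
  infinite to the right, and a write-only output tape.  A step may be nondeterministic.
  The type parameter is the finite input alphabet; \<open>\<Sigma>\<close> is \<^typ>\<open>bool\<close>.
\<close>

datatype dir = Lft | Stay | Rgt

text \<open>The input is delimited by two end markers, which the input head cannot pass.\<close>

datatype 'a cell = LeftEnd | Cell 'a | RightEnd

text \<open>One line of the transition table.  At most one bit is appended to the output tape.\<close>

datatype action =
  Action (target: nat) (input_move: dir) (work: "(nat \<times> dir) list") (emit: "bool option")

text \<open>
  States are the numbers below \<open>num_states\<close>, with start state \<open>0\<close>; work symbols are the
  numbers below \<open>num_symbols\<close>, with blank \<open>0\<close>.  The machine halts when \<open>delta\<close> offers no action.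
\<close>

record 'a tm =
  num_tapes :: nat
  num_states :: nat
  num_symbols :: nat
  accepting :: "nat set"
  delta :: "nat \<Rightarrow> 'a cell \<Rightarrow> nat list \<Rightarrow> action set"

definition wf_tm :: "'a tm \<Rightarrow> bool" where
  "wf_tm M \<longleftrightarrow> 0 < num_states M \<and> 0 < num_symbols M \<and>
     (\<forall>q < num_states M. \<forall>c ss. length ss = num_tapes M \<and> set ss \<subseteq> {..<num_symbols M} \<longrightarrow>
        (\<forall>a \<in> delta M q c ss. target a < num_states M \<and> length (work a) = num_tapes M \<and>
           fst ` set (work a) \<subseteq> {..<num_symbols M}))"

definition deterministic :: "'a tm \<Rightarrow> bool" where
  "deterministic M \<longleftrightarrow> (\<forall>q c ss. \<forall>a \<in> delta M q c ss. \<forall>b \<in> delta M q c ss. a = b)"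

definition no_output :: "'a tm \<Rightarrow> bool" where
  "no_output M \<longleftrightarrow> (\<forall>q c ss. \<forall>a \<in> delta M q c ss. emit a = None)"

text \<open>
  A work tape is given by its contents and its head position.  The output written so far is
  not part of the configuration; it is read off from the path, see \<open>output_word\<close> below.
\<close>

datatype config =
  Config (state: nat) (input_pos: nat) (tapes: "((nat \<Rightarrow> nat) \<times> nat) list")

definition initial :: "'a tm \<Rightarrow> config" where
  "initial M = Config 0 0 (replicate (num_tapes M) (\<lambda>_. 0, 0))"

definition input_cell :: "'a list \<Rightarrow> nat \<Rightarrow> 'a cell" where
  "input_cell x i =
     (if i = 0 then LeftEnd else if i \<le> length x then Cell (x ! (i - 1)) else RightEnd)"

text \<open>A left move from position \<open>0\<close> leaves the head in place (truncated subtraction).\<close>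

fun move :: "dir \<Rightarrow> nat \<Rightarrow> nat" where
  "move Lft i = i - 1"
| "move Stay i = i"
| "move Rgt i = i + 1"

fun update_tape :: "nat \<times> dir \<Rightarrow> (nat \<Rightarrow> nat) \<times> nat \<Rightarrow> (nat \<Rightarrow> nat) \<times> nat" where
  "update_tape (s, d) (t, h) = (t(h := s), move d h)"

definition actions :: "'a tm \<Rightarrow> 'a list \<Rightarrow> config \<Rightarrow> action set" where
  "actions M x c =
     delta M (state c) (input_cell x (input_pos c)) (map (\<lambda>(t, h). t h) (tapes c))"

definition perform :: "'a list \<Rightarrow> action \<Rightarrow> config \<Rightarrow> config" where
  "perform x a c = Config (target a)
     (min (move (input_move a) (input_pos c)) (length x + 1))
     (map2 update_tape (work a) (tapes c))"

text \<open>
  A computation path is the list of actions taken from the initial configuration, i.e. a branch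
  starting at the root of the computation tree.
\<close>

fun path_from :: "'a tm \<Rightarrow> 'a list \<Rightarrow> config \<Rightarrow> action list \<Rightarrow> bool" where
  "path_from M x c [] \<longleftrightarrow> True"
| "path_from M x c (a # as) \<longleftrightarrow> a \<in> actions M x c \<and> path_from M x (perform x a c) as"

definition path :: "'a tm \<Rightarrow> 'a list \<Rightarrow> action list \<Rightarrow> bool" where
  "path M x as \<longleftrightarrow> path_from M x (initial M) as"

definition final :: "'a tm \<Rightarrow> 'a list \<Rightarrow> action list \<Rightarrow> config" where
  "final M x as = fold (perform x) as (initial M)"

definition halting_path :: "'a tm \<Rightarrow> 'a list \<Rightarrow> action list \<Rightarrow> bool" where
  "halting_path M x as \<longleftrightarrow> path M x as \<and> actions M x (final M x as) = {}"

definition accepting_paths :: "'a tm \<Rightarrow> 'a list \<Rightarrow> action list set" where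
  "accepting_paths M x = {as. halting_path M x as \<and> state (final M x as) \<in> accepting M}"

definition output_word :: "action list \<Rightarrow> bool list" where
  "output_word as = List.map_filter emit as"

definition halts_on_every_path :: "'a tm \<Rightarrow> 'a list \<Rightarrow> bool" where
  "halts_on_every_path M x \<longleftrightarrow> \<not> (\<exists>as :: nat \<Rightarrow> action. \<forall>n. path M x (map as [0..<n]))"

text \<open>
  Only work tapes count as space: on inputs from \<open>X\<close>, no work head ever leaves the first
  \<open>s |x|\<close> cells of its tape, where \<open>s\<close> is \<open>O(log n)\<close>.
\<close>

definition log_space_on :: "'a list set \<Rightarrow> 'a tm \<Rightarrow> bool" where
  "log_space_on X M \<longleftrightarrow>
     (\<exists>s :: nat \<Rightarrow> nat. (\<lambda>n. real (s n)) \<in> O(\<lambda>n. ln (real n)) \<and>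
        (\<forall>x \<in> X. \<forall>as. path M x as \<longrightarrow> (\<forall>(t, h) \<in> set (tapes (final M x as)). h < s (length x))))"

definition sharpL :: "(bool list \<Rightarrow> nat) set" where
  "sharpL = {f. \<exists>M. wf_tm M \<and> no_output M \<and> log_space_on UNIV M \<and>
     (\<forall>x. halts_on_every_path M x \<and> f x = card (accepting_paths M x))}"

text \<open>
  Log-space computable functions into \<open>\<Sigma>\<^sup>*\<close> whose arguments are presented on the input tape via
  the encoding \<open>enc\<close>.  Whether the halting state is accepting is irrelevant here.
\<close>

definition FL :: "('i \<Rightarrow> 'a :: finite list) \<Rightarrow> ('i \<Rightarrow> bool list) set" where
  "FL enc = {g. \<exists>M. wf_tm M \<and> deterministic M \<and> log_space_on (range enc) M \<and>
     (\<forall>u. \<exists>as. halting_path M (enc u) as \<and> output_word as = g u)}"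

text \<open>Binary notation, most significant bit first, without leading zeros (and \<open>0\<close> for zero).\<close>

fun binary :: "nat \<Rightarrow> bool list" where
  "binary n = (if n < 2 then [n = 1] else binary (n div 2) @ [odd n])"

declare binary.simps [simp del]

text \<open>Pairs are written over the alphabet \<open>\<Sigma>\<close> extended by the separator \<^const>\<open>None\<close>.\<close>

definition encode_pair :: "bool list \<times> nat \<Rightarrow> bool option list" where
  "encode_pair = (\<lambda>(x, i). map Some x @ None # map Some (binary i))"

definition FL_nonneg :: "(bool list \<Rightarrow> nat) set" where
  "FL_nonneg = {p. (\<lambda>x. binary (p x)) \<in> FL (\<lambda>x. x)}"

end

theory Submission
  imports Defs
begin

text \<open>
  A log-space machine is as good as a program over finitely many counters that stay polynomially
  bounded: counters are kept in binary on work tapes, and conversely a work tape of logarithmic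
  length is two stacks, each a number in base \<open>S\<close>, around the scanned symbol.  In the counter
  language, \<open>p (x)\<close> is computed into a counter first.  Then, for \<open>i = 1, 2, \<dots>\<close>, the machine for \<open>f\<close>
  is run on the virtual input \<open>g (x, i)\<close>: only its head position is stored, and a cell is
  recomputed by running the machine for \<open>g\<close> from scratch whenever it is read.  That inner
  computation is deterministic, so each round multiplies the number of surviving computation paths
  by \<open>f (g (x, i))\<close>; a rejecting run aborts.  Its length, and hence that of \<open>g (x, i)\<close>, is polynomial
  because a halting deterministic computation repeats no configuration.
\<close>

section \<open>Counting computation paths\<close>

text \<open>Exact counting is the obstacle: accepting paths are action sequences, so a simulated
  choice has to become exactly one branch per action, and everything deterministic must leave the
  number of branches unchanged. The counting language separates the two. \<open>run\<close> carries
  the number of surviving computations through a stack of continuations, and a command with a single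
  outcome is described by \<open>exec\<close>, which is transparent for that number. A product
  appears because every accepting leaf of one factor continues with the same count \<open>N\<close>.
  The space bounds of the given machines are arbitrary functions, perhaps hard to compute, so the
  program never evaluates them. They enter only through the bound \<open>b\<close> on the counters:
  bit strings grow on demand, and unvisited blank cells are zero digits of a stack. The machine for
  \<open>g\<close> is known to use logarithmic space only on encoded pairs, so its virtual input has
  to be the exact encoding of \<open>(x, i)\<close>. Termination needs no ranking function, since
  derivations of \<open>counts\<close> and \<open>run\<close> are well-founded.\<close>

inductive counts :: "'a tm \<Rightarrow> 'a list \<Rightarrow> (config \<Rightarrow> bool) \<Rightarrow> config \<Rightarrow> nat \<Rightarrow> bool"
  for M x B where
  counts_halt: "counts M x B c (if state c \<in> accepting M then 1 else 0)"
    if "B c" "actions M x c = {}"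
| counts_step: "counts M x B c (\<Sum>a\<in>actions M x c. k a)"
    if "B c" "actions M x c \<noteq> {}" "finite (actions M x c)"
       "\<And>a. a \<in> actions M x c \<Longrightarrow> counts M x B (perform x a c) (k a)"

lemma counts_deterministic_step:
  assumes "actions M x c = {a}" "B c" "counts M x B (perform x a c) k"
  shows "counts M x B c k"
  using counts_step[of B c M x "\<lambda>_. k"] assms by simp

definition accepting_from :: "'a tm \<Rightarrow> 'a list \<Rightarrow> config \<Rightarrow> action list set" where
  "accepting_from M x c = {as. path_from M x c as \<and> actions M x (fold (perform x) as c) = {} \<and>
     state (fold (perform x) as c) \<in> accepting M}"

lemma accepting_from_halted:
  assumes "actions M x c = {}"
  shows "accepting_from M x c = (if state c \<in> accepting M then {[]} else {})"
proof -
  have "path_from M x c as \<longleftrightarrow> as = []" for as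
    using assms by (cases as) auto
  then show ?thesis
    using assms by (auto simp: accepting_from_def)
qed

lemma accepting_from_step:
  assumes "actions M x c \<noteq> {}"
  shows "accepting_from M x c = (\<Union>a\<in>actions M x c. (#) a ` accepting_from M x (perform x a c))"
    (is "?L = ?R")
proof -
  have "as \<in> ?L \<longleftrightarrow> as \<in> ?R" for as
    using assms by (cases as) (auto simp: accepting_from_def)
  then show ?thesis by blast
qed

text \<open>Prefixing an action is injective, and paths with different first actions are different,
  so cardinalities add up along the computation tree.\<close>

lemma counts_card_accepting_from:
  assumes "counts M x B c k"
  shows "finite (accepting_from M x c) \<and> card (accepting_from M x c) = k"
  using assms
proof induction
  case (counts_halt c)
  then show ?case by (simp add: accepting_from_halted)
next
  case (counts_step c k)
  let ?A = "\<lambda>a. (#) a ` accepting_from M x (perform x a c)"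
  have fin: "finite (?A a)" and card: "card (?A a) = k a" if "a \<in> actions M x c" for a
    using counts_step that by (simp_all add: card_image)
  have "card (\<Union>a\<in>actions M x c. ?A a) = (\<Sum>a\<in>actions M x c. card (?A a))"
    using counts_step fin by (intro card_UN_disjoint) auto
  then show ?case
    using counts_step fin card by (simp add: accepting_from_step)
qed

lemma counts_invariant:
  assumes "counts M x B c k" "path_from M x c as"
  shows "B (fold (perform x) as c)"
  using assms
proof (induction arbitrary: as)
  case (counts_halt c)
  then show ?case by (cases as) auto
next
  case (counts_step c k)
  then show ?case by (cases as) auto
qed

text \<open>Every action leads to a premise of the rule, so an infinite path would be an infinite
  descent through the derivation.\<close>

lemma counts_no_infinite_path:
  assumes "counts M x B c k"
  shows "\<exists>n. \<not> path_from M x c (map as [0..<n])"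
  using assms
proof (induction arbitrary: as)
  case (counts_halt c)
  then show ?case by (intro exI[of _ 1]) auto
next
  case (counts_step c k)
  show ?case
  proof (cases "as 0 \<in> actions M x c")
    case True
    then obtain n where "\<not> path_from M x (perform x (as 0) c) (map (\<lambda>i. as (Suc i)) [0..<n])"
      using counts_step.IH by blast
    then have "\<not> path_from M x c (map as [0..<Suc n])"
      by (simp add: map_upt_Suc del: upt_Suc)
    then show ?thesis by blast
  next
    case False
    then show ?thesis by (intro exI[of _ 1]) auto
  qed
qed

lemma accepting_from_initial: "accepting_from M x (initial M) = accepting_paths M x"
  by (simp add: accepting_from_def accepting_paths_def halting_path_def path_def final_def
      conj_assoc)

lemma counts_initialD:
  assumes "counts M x B (initial M) k"
  shows "halts_on_every_path M x" "card (accepting_paths M x) = k"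
    "\<And>as. path M x as \<Longrightarrow> B (final M x as)"
proof -
  show "halts_on_every_path M x"
    using counts_no_infinite_path[OF assms] by (auto simp: halts_on_every_path_def path_def)
  show "card (accepting_paths M x) = k"
    using counts_card_accepting_from[OF assms] by (simp add: accepting_from_initial)
  show "B (final M x as)" if "path M x as" for as
    using counts_invariant[OF assms] that by (simp add: path_def final_def)
qed

section \<open>Well-formed configurations and the existence of a count\<close>

definition wf_config :: "'a tm \<Rightarrow> config \<Rightarrow> bool" where
  "wf_config M c \<longleftrightarrow> state c < num_states M \<and> length (tapes c) = num_tapes M \<and>
     (\<forall>(t, h) \<in> set (tapes c). \<forall>i. t i < num_symbols M)"

lemma wf_config_initial: "wf_tm M \<Longrightarrow> wf_config M (initial M)"
  by (auto simp: wf_config_def initial_def wf_tm_def)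

lemma wf_config_symbols:
  assumes "wf_config M c"
  shows "set (map (\<lambda>(t, h). t h) (tapes c)) \<subseteq> {..<num_symbols M}"
proof -
  have "t h < num_symbols M" if "(t, h) \<in> set (tapes c)" for t h
    using assms that unfolding wf_config_def by blast
  then show ?thesis by auto
qed

lemma wf_tm_actionD:
  assumes "wf_tm M" "wf_config M c" "a \<in> actions M x c"
  shows "target a < num_states M" "length (work a) = num_tapes M"
    "\<And>j. j < num_tapes M \<Longrightarrow> fst (work a ! j) < num_symbols M"
proof -
  have "target a < num_states M \<and> length (work a) = num_tapes M \<and>
      fst ` set (work a) \<subseteq> {..<num_symbols M}"
  proof -
    have "length (map (\<lambda>(t, h). t h) (tapes c)) = num_tapes M" "state c < num_states M"
      using assms(2) by (simp_all add: wf_config_def)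
    with wf_config_symbols[OF assms(2)] assms(1,3) show ?thesis
      unfolding wf_tm_def actions_def by blast
  qed
  then show "target a < num_states M" "length (work a) = num_tapes M"
    "\<And>j. j < num_tapes M \<Longrightarrow> fst (work a ! j) < num_symbols M"
    by (auto simp: image_subset_iff)
qed

lemma wf_config_perform:
  assumes "wf_tm M" "wf_config M c" "a \<in> actions M x c"
  shows "wf_config M (perform x a c)"
proof -
  have "\<forall>i. t i < num_symbols M" if th: "(t, h) \<in> set (map2 update_tape (work a) (tapes c))" for t h
  proof -
    obtain j where j: "j < length (work a)" "j < length (tapes c)"
      "(t, h) = update_tape (work a ! j) (tapes c ! j)"
      using th by (auto simp: in_set_conv_nth)
    obtain s d t' h' where sd: "work a ! j = (s, d)" "tapes c ! j = (t', h')"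
      by fastforce
    have "s < num_symbols M"
      using wf_tm_actionD[OF assms] j sd by fastforce
    moreover have "\<forall>i. t' i < num_symbols M"
      using assms(2) j sd unfolding wf_config_def by (metis (no_types, lifting) case_prodD nth_mem)
    ultimately show ?thesis using j sd by auto
  qed
  then have "\<forall>(t, h) \<in> set (map2 update_tape (work a) (tapes c)). \<forall>i. t i < num_symbols M"
    by blast
  then show ?thesis
    using assms(2) wf_tm_actionD[OF assms] by (simp add: wf_config_def perform_def del: set_map)
qed

text \<open>\<open>delta\<close> may return any set of actions; finiteness comes from
  well-formedness, which confines target, move, written symbols and emitted bit to finite
  ranges.\<close>

lemma finite_actions:
  assumes "wf_tm M" "wf_config M c"
  shows "finite (actions M x c)"
proof -
  let ?D = "UNIV :: dir set"
  have D: "?D = {Lft, Stay, Rgt}" using dir.exhaust by blast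
  then have fD: "finite ?D" by (metis finite.emptyI finite.insertI)
  let ?W = "{ws :: (nat \<times> dir) list. set ws \<subseteq> {..<num_symbols M} \<times> ?D \<and> length ws = num_tapes M}"
  have fW: "finite ?W"
    by (rule finite_lists_length_eq) (use fD in simp)
  have "actions M x c \<subseteq> (\<lambda>(q, d, ws, e). Action q d ws e) `
      ({..<num_states M} \<times> ?D \<times> ?W \<times> (UNIV :: bool option set))"
  proof
    fix a assume a: "a \<in> actions M x c"
    note D = wf_tm_actionD[OF assms a]
    have "set (work a) \<subseteq> {..<num_symbols M} \<times> ?D"
      using D by (fastforce simp: in_set_conv_nth)
    then have "(target a, input_move a, work a, emit a) \<in>
        {..<num_states M} \<times> ?D \<times> ?W \<times> (UNIV :: bool option set)"
      using D by simp
    moreover have "a = (\<lambda>(q, d, ws, e). Action q d ws e) (target a, input_move a, work a, emit a)"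
      by simp
    ultimately show "a \<in> (\<lambda>(q, d, ws, e). Action q d ws e) `
      ({..<num_states M} \<times> ?D \<times> ?W \<times> (UNIV :: bool option set))" by blast
  qed
  then show ?thesis
    by (rule finite_subset) (intro finite_imageI finite_cartesian_product, use fD fW in simp_all)
qed

lemma path_from_append:
  "path_from M x c (as @ bs) \<longleftrightarrow> path_from M x c as \<and> path_from M x (fold (perform x) as c) bs"
  by (induction as arbitrary: c) auto

lemma path_snoc: "path M x (as @ [a]) \<longleftrightarrow> path M x as \<and> a \<in> actions M x (final M x as)"
  by (simp add: path_def final_def path_from_append)

lemma final_snoc: "final M x (as @ [a]) = perform x a (final M x as)"
  by (simp add: final_def)

lemma wf_config_final:
  assumes "wf_tm M" "path M x as"
  shows "wf_config M (final M x as)"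
  using assms(2)
proof (induction as rule: rev_induct)
  case Nil
  then show ?case using assms by (simp add: final_def wf_config_initial)
next
  case (snoc a as)
  then show ?case using assms by (simp add: path_snoc final_snoc wf_config_perform)
qed

text \<open>A Konig-style argument: by finite branching, a reachable configuration without a count
  has a successor without a count. Dependent choice then yields an infinite path, which contradicts
  halting.\<close>

lemma counts_complete:
  assumes wf: "wf_tm M" and halts: "halts_on_every_path M x"
    and B: "\<And>as. path M x as \<Longrightarrow> B (final M x as)"
  shows "counts M x (\<lambda>c. wf_config M c \<and> B c) (initial M) (card (accepting_paths M x))"
proof -
  let ?C = "counts M x (\<lambda>c. wf_config M c \<and> B c)"
  let ?bad = "\<lambda>as. path M x as \<and> (\<nexists>k. ?C (final M x as) k)"
  have ext: "\<exists>a. ?bad (as @ [a])" if bad: "?bad as" for as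
  proof (rule ccontr)
    assume good: "\<nexists>a. ?bad (as @ [a])"
    have inv: "wf_config M (final M x as) \<and> B (final M x as)"
      using bad wf B by (simp add: wf_config_final)
    have "\<forall>a \<in> actions M x (final M x as). \<exists>k. ?C (perform x a (final M x as)) k"
      using good bad by (simp add: path_snoc final_snoc)
    then obtain k where k: "\<And>a. a \<in> actions M x (final M x as) \<Longrightarrow> ?C (perform x a (final M x as)) (k a)"
      by metis
    have "\<exists>k. ?C (final M x as) k"
    proof (cases "actions M x (final M x as) = {}")
      case True
      then show ?thesis using inv by (blast intro: counts_halt)
    next
      case False
      have "?C (final M x as) (\<Sum>a\<in>actions M x (final M x as). k a)"
        by (rule counts_step) (use False inv finite_actions[OF wf] k in auto)
      then show ?thesis ..
    qed
    with bad show False by blast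
  qed
  have "\<exists>k. ?C (initial M) k"
  proof (rule ccontr)
    assume "\<nexists>k. ?C (initial M) k"
    then have bad0: "?bad []" by (simp add: path_def final_def)
    have "\<forall>as. \<exists>a. ?bad as \<longrightarrow> ?bad (as @ [a])"
      using ext by blast
    then obtain nxt where nxt: "\<And>as. ?bad as \<Longrightarrow> ?bad (as @ [nxt as])"
      using choice[of "\<lambda>as a. ?bad as \<longrightarrow> ?bad (as @ [a])"] by blast
    \<comment> \<open>The prefixes arise by iteration and are then recognised as the initial
      segments of one sequence \<open>as\<close>, the form in which
      \<open>halts_on_every_path\<close> speaks of infinite paths.\<close>
    define pre where "pre n = ((\<lambda>as. as @ [nxt as]) ^^ n) []" for n
    define as where "as n = nxt (pre n)" for n
    have bad: "?bad (pre n)" for n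
    proof (induction n)
      case 0
      have "pre 0 = []" by (simp add: pre_def)
      show ?case unfolding \<open>pre 0 = []\<close> by (rule bad0)
    next
      case (Suc n)
      have eq: "pre (Suc n) = pre n @ [nxt (pre n)]" by (simp add: pre_def)
      show ?case unfolding eq by (rule nxt[OF Suc])
    qed
    have "pre n = map as [0..<n]" for n
      by (induction n) (simp_all add: pre_def as_def)
    then have "\<forall>n. path M x (map as [0..<n])" using bad by metis
    then show False using halts by (auto simp: halts_on_every_path_def)
  qed
  then show ?thesis using counts_initialD(2) by metis
qed

section \<open>A counting language\<close>

text \<open>
  \<open>Head\<close> is the input head and \<open>Tmp\<close> a scratch counter that is zero between macros.  The indices of
  the registers \<open>St\<close> to \<open>RS\<close> name a simulated machine and one of its tapes.
\<close>

datatype reg =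
  Head | Tmp | Var nat | St nat | Go nat | Pos nat nat | Cur nat nat | LS nat nat | RS nat nat

datatype cmd =
    Skip
  | Inc reg
  | Dec reg
  | Seq cmd cmd (infixr \<open>;;\<close> 60)
  | IfZ reg cmd cmd
  | While reg cmd
  | IfCell "bool cell" cmd cmd
  | Choose cmd cmd
  | Fail

type_synonym store = "reg \<Rightarrow> nat"

text \<open>\<open>Head\<close> is the real input head, confined by the end markers. The machine
  would clip a move beyond the right marker, so \<open>run\<close> admits no such increment.\<close>

definition capacity :: "bool list \<Rightarrow> nat \<Rightarrow> reg \<Rightarrow> nat" where
  "capacity x b r = (if r = Head then length x + 1 else b)"

text \<open>
  A list of commands is a stack of continuations.  In \<open>run x b Q cs \<sigma> N\<close>, all computations of \<open>cs\<close>
  terminate, exactly \<open>N\<close> of them without meeting \<open>Fail\<close>, those end in stores satisfying \<open>Q\<close>, and no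
  counter exceeds \<open>b\<close> on the way.
\<close>

inductive run :: "bool list \<Rightarrow> nat \<Rightarrow> (store \<Rightarrow> bool) \<Rightarrow> cmd list \<Rightarrow> store \<Rightarrow> nat \<Rightarrow> bool"
  for x b Q where
  run_Nil: "Q \<sigma> \<Longrightarrow> run x b Q [] \<sigma> 1"
| run_Skip: "run x b Q cs \<sigma> N \<Longrightarrow> run x b Q (Skip # cs) \<sigma> N"
| run_Inc: "\<sigma> r < capacity x b r \<Longrightarrow> run x b Q cs (\<sigma>(r := \<sigma> r + 1)) N \<Longrightarrow> run x b Q (Inc r # cs) \<sigma> N"
| run_Dec: "0 < \<sigma> r \<Longrightarrow> run x b Q cs (\<sigma>(r := \<sigma> r - 1)) N \<Longrightarrow> run x b Q (Dec r # cs) \<sigma> N"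
| run_Seq: "run x b Q (c # d # cs) \<sigma> N \<Longrightarrow> run x b Q ((c ;; d) # cs) \<sigma> N"
| run_IfZ: "run x b Q ((if \<sigma> r = 0 then c else d) # cs) \<sigma> N \<Longrightarrow> run x b Q (IfZ r c d # cs) \<sigma> N"
| run_While0: "\<sigma> r = 0 \<Longrightarrow> run x b Q cs \<sigma> N \<Longrightarrow> run x b Q (While r c # cs) \<sigma> N"
| run_While: "\<sigma> r \<noteq> 0 \<Longrightarrow> run x b Q (c # While r c # cs) \<sigma> N \<Longrightarrow> run x b Q (While r c # cs) \<sigma> N"
| run_IfCell: "run x b Q ((if input_cell x (\<sigma> Head) = e then c else d) # cs) \<sigma> N \<Longrightarrow>
    run x b Q (IfCell e c d # cs) \<sigma> N"
| run_Choose: "run x b Q (c # cs) \<sigma> N \<Longrightarrow> run x b Q (d # cs) \<sigma> N' \<Longrightarrow>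
    run x b Q (Choose c d # cs) \<sigma> (N + N')"
| run_Fail: "run x b Q (Fail # cs) \<sigma> 0"

section \<open>Compilation to Turing machines\<close>

text \<open>
  The bits start at cell \<open>1\<close>, the least significant one first; the blank cell \<open>0\<close> serves as left
  end marker.
\<close>

definition bit_tape :: "bool list \<Rightarrow> nat \<Rightarrow> nat" where
  "bit_tape bs i = (if i = 0 \<or> length bs < i then 0 else if bs ! (i - 1) then 2 else 1)"

section \<open>Binary counters as lists of bits and as tape contents\<close>

abbreviation bval :: "bool list \<Rightarrow> nat" where
  "bval \<equiv> horner_sum of_bool 2"

fun binc :: "bool list \<Rightarrow> bool list" where
  "binc [] = [True]"
| "binc (False # bs) = True # bs"
| "binc (True # bs) = False # binc bs"

fun bdec :: "bool list \<Rightarrow> bool list" where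
  "bdec [] = []"
| "bdec (True # bs) = False # bs"
| "bdec (False # bs) = True # bdec bs"

lemma bval_binc: "bval (binc bs) = bval bs + 1"
  by (induction bs rule: binc.induct) auto

lemma bval_bdec: "0 < bval bs \<Longrightarrow> bval (bdec bs) = bval bs - 1"
  by (induction bs rule: bdec.induct) (auto simp: algebra_simps)

lemma length_bdec [simp]: "length (bdec bs) = length bs"
  by (induction bs rule: bdec.induct) auto

text \<open>\<open>bdec\<close> may leave leading zeros, so the length is not determined by the
  value and has to be tracked. A list grows only when all its bits are set, and then the new value
  is a power of two.\<close>

lemma length_binc:
  "length (binc bs) = length bs \<or> length (binc bs) = length bs + 1 \<and> bval bs + 1 = 2 ^ length bs"
  by (induction bs rule: binc.induct) auto

lemma length_binc_le:
  assumes "length bs \<le> L" "bval bs < b" "b < 2 ^ L"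
  shows "length (binc bs) \<le> L"
proof (rule ccontr)
  assume "\<not> length (binc bs) \<le> L"
  then have "bval bs + 1 = 2 ^ L" using length_binc[of bs] assms(1) by auto
  then show False using assms by simp
qed

lemma bit_tape_0 [simp]: "bit_tape bs 0 = 0"
  by (simp add: bit_tape_def)

lemma bit_tape_nonzero: "0 < i \<Longrightarrow> i \<le> length bs \<Longrightarrow> 0 < bit_tape bs i"
  by (simp add: bit_tape_def)

lemma bit_tape_end [simp]: "bit_tape bs (Suc (length bs)) = 0"
  by (simp add: bit_tape_def)

lemma bit_tape_append [simp]:
  "bit_tape (bs @ b # cs) (Suc (length bs)) = (if b then 2 else 1)"
  by (simp add: bit_tape_def)

lemma bit_tape_snoc [simp]: "(bit_tape bs)(Suc (length bs) := 2) = bit_tape (bs @ [True])"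
  by (auto simp: bit_tape_def fun_eq_iff nth_append)

lemma bit_tape_update [simp]:
  "(bit_tape (bs @ b # cs))(Suc (length bs) := 2) = bit_tape (bs @ True # cs)"
  "(bit_tape (bs @ b # cs))(Suc (length bs) := Suc 0) = bit_tape (bs @ False # cs)"
  by (auto simp: bit_tape_def fun_eq_iff nth_append nth_Cons')

text \<open>A counter operation is one sweep over a tape: \<open>Carry\<close> and
  \<open>Borrow\<close> run right from the least significant bit, \<open>Test\<close> looks for a
  set bit, and \<open>Back\<close> returns to the blank cell \<open>0\<close>. The command lists are
  the continuations.\<close>

datatype ctl =
    At "cmd list"
  | Carry reg "cmd list"
  | Borrow reg "cmd list"
  | Back reg "cmd list"
  | Test reg "cmd list" "cmd list"

text \<open>The least index makes the numbering unambiguous although a list may repeat an entry: the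
  start state will be put in front of an enumeration that already contains it, and thereby gets the
  number \<open>0\<close>.\<close>

definition idx :: "'b list \<Rightarrow> 'b \<Rightarrow> nat" where
  "idx xs y = (LEAST i. i < length xs \<and> xs ! i = y)"

lemma idx:
  assumes "y \<in> set xs"
  shows "idx xs y < length xs" "xs ! idx xs y = y"
proof -
  have "\<exists>i. i < length xs \<and> xs ! i = y"
    using assms by (auto simp: in_set_conv_nth)
  from LeastI_ex[OF this] show "idx xs y < length xs" "xs ! idx xs y = y"
    by (simp_all add: idx_def)
qed

lemma idx_Cons_same [simp]: "idx (y # ys) y = 0"
  unfolding idx_def by (rule Least_eq_0) simp

lemma idx_inj: "y \<in> set xs \<Longrightarrow> z \<in> set xs \<Longrightarrow> idx xs y = idx xs z \<longleftrightarrow> y = z"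
  using idx by metis

definition idle :: "nat \<Rightarrow> dir \<Rightarrow> nat list \<Rightarrow> action" where
  "idle q d ss = Action q d (map (\<lambda>s. (s, Stay)) ss) None"

definition edit :: "nat \<Rightarrow> nat \<Rightarrow> nat \<Rightarrow> dir \<Rightarrow> nat list \<Rightarrow> action" where
  "edit q i s d ss = Action q Stay ((map (\<lambda>s. (s, Stay)) ss)[i := (s, d)]) None"

text \<open>
  The two branches of a choice must be different actions even if the commands coincide, hence
  the \<^const>\<open>Skip\<close>.
\<close>

fun next_actions :: "(ctl \<Rightarrow> nat) \<Rightarrow> (reg \<Rightarrow> nat) \<Rightarrow> ctl \<Rightarrow> bool cell \<Rightarrow> nat list \<Rightarrow> action set" where
  "next_actions e ix (At []) c ss = {}"
| "next_actions e ix (At (Skip # cs)) c ss = {idle (e (At cs)) Stay ss}"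
| "next_actions e ix (At (Inc r # cs)) c ss =
     {if r = Head then idle (e (At cs)) Rgt ss else edit (e (Carry r cs)) (ix r) (ss ! ix r) Rgt ss}"
| "next_actions e ix (At (Dec r # cs)) c ss =
     {if r = Head then idle (e (At cs)) Lft ss else edit (e (Borrow r cs)) (ix r) (ss ! ix r) Rgt ss}"
| "next_actions e ix (At ((a ;; b) # cs)) c ss = {idle (e (At (a # b # cs))) Stay ss}"
| "next_actions e ix (At (IfZ r a b # cs)) c ss =
     {if r = Head then idle (e (At ((if c = LeftEnd then a else b) # cs))) Stay ss
      else edit (e (Test r (a # cs) (b # cs))) (ix r) (ss ! ix r) Rgt ss}"
| "next_actions e ix (At (While r a # cs)) c ss =
     {if r = Head then idle (e (At (if c = LeftEnd then cs else a # While r a # cs))) Stay ss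
      else edit (e (Test r cs (a # While r a # cs))) (ix r) (ss ! ix r) Rgt ss}"
| "next_actions e ix (At (IfCell d a b # cs)) c ss = {idle (e (At ((if c = d then a else b) # cs))) Stay ss}"
| "next_actions e ix (At (Choose a b # cs)) c ss =
     {idle (e (At (a # cs))) Stay ss, idle (e (At (Skip # b # cs))) Stay ss}"
| "next_actions e ix (At (Fail # cs)) c ss = {}"
| "next_actions e ix (Carry r cs) c ss =
     {if ss ! ix r = 2 then edit (e (Carry r cs)) (ix r) 1 Rgt ss
      else edit (e (Back r cs)) (ix r) 2 Lft ss}"
| "next_actions e ix (Borrow r cs) c ss =
     {if ss ! ix r = 2 then edit (e (Back r cs)) (ix r) 1 Lft ss
      else edit (e (Borrow r cs)) (ix r) 2 Rgt ss}"
| "next_actions e ix (Back r cs) c ss =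
     {if ss ! ix r = 0 then idle (e (At cs)) Stay ss
      else edit (e (Back r cs)) (ix r) (ss ! ix r) Lft ss}"
| "next_actions e ix (Test r cs ds) c ss =
     {if ss ! ix r = 0 then edit (e (Back r cs)) (ix r) 0 Lft ss
      else if ss ! ix r = 1 then edit (e (Test r cs ds)) (ix r) 1 Rgt ss
      else edit (e (Back r ds)) (ix r) 2 Lft ss}"

text \<open>The machine halts both at \<open>At []\<close> and at a pending \<open>Fail\<close>.
  Only the former is accepting, which is how failing computations drop out of the count. The three
  symbols are the blank and the codes \<open>1\<close> and \<open>2\<close> of the bits.\<close>

definition tm_of :: "reg list \<Rightarrow> ctl list \<Rightarrow> bool tm" where
  "tm_of rs qs = \<lparr>num_tapes = length rs, num_states = length qs, num_symbols = 3,
     accepting = {idx qs (At [])},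
     delta = (\<lambda>q c ss. if q < length qs then next_actions (idx qs) (idx rs) (qs ! q) c ss else {})\<rparr>"

section \<open>Finitely many continuations, hence finitely many states\<close>

fun succs :: "cmd list \<Rightarrow> cmd list set" where
  "succs (Skip # cs) = {cs}"
| "succs (Inc r # cs) = {cs}"
| "succs (Dec r # cs) = {cs}"
| "succs ((a ;; b) # cs) = {a # b # cs}"
| "succs (IfZ r a b # cs) = {a # cs, b # cs}"
| "succs (While r a # cs) = {cs, a # While r a # cs}"
| "succs (IfCell d a b # cs) = {a # cs, b # cs}"
| "succs (Choose a b # cs) = {a # cs, b # cs, Skip # b # cs}"
| "succs _ = {}"

fun head_regs :: "cmd list \<Rightarrow> reg set" where
  "head_regs (Inc r # cs) = {r}"
| "head_regs (Dec r # cs) = {r}"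
| "head_regs (IfZ r a b # cs) = {r}"
| "head_regs (While r a # cs) = {r}"
| "head_regs _ = {}"

text \<open>A loop body is always entered with the same loop pushed behind it, so the stack does not
  grow with the iterations: the continuation of a subcommand depends only on its place in the
  program text.\<close>

fun stacks :: "cmd \<Rightarrow> cmd list \<Rightarrow> cmd list set" where
  "stacks (a ;; b) cs = insert ((a ;; b) # cs) (stacks a (b # cs) \<union> stacks b cs)"
| "stacks (IfZ r a b) cs = insert (IfZ r a b # cs) (stacks a cs \<union> stacks b cs)"
| "stacks (While r a) cs = insert (While r a # cs) (stacks a (While r a # cs))"
| "stacks (IfCell d a b) cs = insert (IfCell d a b # cs) (stacks a cs \<union> stacks b cs)"
| "stacks (Choose a b) cs =
     insert (Choose a b # cs) (insert (Skip # b # cs) (stacks a cs \<union> stacks b cs))"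
| "stacks c cs = {c # cs}"

lemma finite_stacks: "finite (stacks c cs)"
  by (induction c cs rule: stacks.induct) auto

lemma Cons_in_stacks: "c # cs \<in> stacks c cs"
  by (cases c) auto

lemma succs_stacks: "ds \<in> stacks c cs \<Longrightarrow> succs ds \<subseteq> insert cs (stacks c cs)"
proof (induction c cs arbitrary: ds rule: stacks.induct)
  case (1 a b cs)
  then show ?case using Cons_in_stacks[of a "b # cs"] Cons_in_stacks[of b cs] by fastforce
next
  case (2 r a b cs)
  then show ?case using Cons_in_stacks[of a cs] Cons_in_stacks[of b cs] by fastforce
next
  case (3 r a cs)
  then show ?case using Cons_in_stacks[of a "While r a # cs"] by fastforce
next
  case (4 d a b cs)
  then show ?case using Cons_in_stacks[of a cs] Cons_in_stacks[of b cs] by fastforce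
next
  case (5 a b cs)
  then show ?case using Cons_in_stacks[of a cs] Cons_in_stacks[of b cs] by fastforce
qed auto

text \<open>A generous superset of the reachable states; what counts is that it is finite and closed
  under the transition table.\<close>

definition controls :: "reg set \<Rightarrow> cmd list set \<Rightarrow> ctl set" where
  "controls R K = At ` K \<union> (\<Union>r\<in>R. Carry r ` K \<union> Borrow r ` K \<union> Back r ` K \<union>
     (\<lambda>(cs, ds). Test r cs ds) ` (K \<times> K))"

lemma finite_controls: "finite R \<Longrightarrow> finite K \<Longrightarrow> finite (controls R K)"
  by (simp add: controls_def)

lemma controls_simps [simp]:
  "At cs \<in> controls R K \<longleftrightarrow> cs \<in> K"
  "Carry r cs \<in> controls R K \<longleftrightarrow> r \<in> R \<and> cs \<in> K"
  "Borrow r cs \<in> controls R K \<longleftrightarrow> r \<in> R \<and> cs \<in> K"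
  "Back r cs \<in> controls R K \<longleftrightarrow> r \<in> R \<and> cs \<in> K"
  "Test r cs ds \<in> controls R K \<longleftrightarrow> r \<in> R \<and> cs \<in> K \<and> ds \<in> K"
  by (auto simp: controls_def)

locale compiled =
  fixes K :: "cmd list set" and rs :: "reg list" and qs :: "ctl list"
  assumes Nil_K: "[] \<in> K"
    and succs_K: "cs \<in> K \<Longrightarrow> succs cs \<subseteq> K"
    and head_regs_K: "cs \<in> K \<Longrightarrow> head_regs cs \<subseteq> insert Head (set rs)"
    and distinct_rs: "distinct rs" and Head_rs: "Head \<notin> set rs"
    and set_qs: "set qs = controls (set rs) K"
begin

abbreviation "M \<equiv> tm_of rs qs"
abbreviation "e \<equiv> idx qs"
abbreviation "ix \<equiv> idx rs"

text \<open>The closure of \<open>K\<close> under \<open>succs\<close> and of the registers under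
  \<open>head_regs\<close> serves this purpose: no transition leaves the list of control
  states.\<close>

lemma next_actions_target:
  assumes "q \<in> set qs" "a \<in> next_actions e ix q c ss"
  shows "target a < length qs"
proof -
  have "\<exists>q' \<in> set qs. target a = e q'"
    using assms succs_K head_regs_K unfolding set_qs
    by (cases "(e, ix, q, c, ss)" rule: next_actions.cases)
      (fastforce simp: idle_def edit_def split: if_splits)+
  then show ?thesis using idx(1) by metis
qed

lemma next_actions_work:
  assumes "a \<in> next_actions e ix q c ss"
  shows "length (work a) = length ss \<and> emit a = None \<and>
    (set ss \<subseteq> {..<3} \<longrightarrow> fst ` set (work a) \<subseteq> {..<3})"
proof -
  have edit: "fst ` set ((map (\<lambda>s. (s, Stay)) ss)[i := (s, d)]) \<subseteq> {..<3}"
    if "set ss \<subseteq> {..<3}" "i < length ss \<longrightarrow> s < 3" for i s and d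
  proof -
    have "set ((map (\<lambda>s. (s, Stay)) ss)[i := (s, d)]) \<subseteq> {..<3} \<times> UNIV"
    proof (cases "i < length ss")
      case True
      show ?thesis
        by (rule order.trans[OF set_update_subset_insert]) (use that True in auto)
    qed (use that in \<open>auto simp: list_update_beyond\<close>)
    then show ?thesis by auto
  qed
  have nth: "ss ! i < 3" if "set ss \<subseteq> {..<3}" "i < length ss" for i
    using that nth_mem by blast
  show ?thesis
  proof -
    let ?P = "\<lambda>a. length (work a) = length ss \<and> emit a = None \<and>
      (set ss \<subseteq> {..<3} \<longrightarrow> fst ` set (work a) \<subseteq> {..<3})"
    have "?P (idle q d ss)" for q d
      by (auto simp: idle_def)
    moreover have "?P (edit q i s d ss)" if "s = ss ! i \<or> s < 3" for q i s d
      using edit[of i s d] nth[of i] that by (auto simp: edit_def)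
    ultimately show "?P a"
      using assms by (cases "(e, ix, q, c, ss)" rule: next_actions.cases)
        (simp_all split: if_splits, auto)
  qed
qed

lemma wf_tm_of: "qs \<noteq> [] \<Longrightarrow> wf_tm M"
  using next_actions_target next_actions_work unfolding wf_tm_def tm_of_def
  by (auto simp del: subset_iff) (use nth_mem in blast)

lemma no_output_tm_of: "no_output M"
  using next_actions_work by (auto simp: no_output_def tm_of_def)

end

section \<open>Correctness of the compiled machine\<close>

definition head_bound :: "nat \<Rightarrow> config \<Rightarrow> bool" where
  "head_bound s c \<longleftrightarrow> (\<forall>(t, h) \<in> set (tapes c). h < s)"

lemma update_tape_eq: "update_tape (s, d) th = ((fst th)(snd th := s), move d (snd th))"
  by (cases th) simp

lemma map2_update_tape_stay:
  "map2 update_tape (map (\<lambda>s. (s, Stay)) (map (\<lambda>(t, h). t h) ts)) ts = ts"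
  by (rule nth_equalityI) (auto simp: case_prod_beta update_tape_eq)

lemma map2_update_tape_edit:
  assumes "i < length ts"
  shows "map2 update_tape ((map (\<lambda>s. (s, Stay)) (map (\<lambda>(t, h). t h) ts))[i := (s, d)]) ts =
    ts[i := update_tape (s, d) (ts ! i)]"
  using assms by (intro nth_equalityI) (auto simp: case_prod_beta nth_list_update update_tape_eq)

context compiled
begin

context
  fixes x :: "bool list" and L :: nat
begin

text \<open>There is one cell for the left end marker, there are \<open>L\<close> cells for bits,
  and one more for the blank behind them, which a sweep has to reach in order to notice the end:
  positions stay below \<open>L + 2\<close>.\<close>

abbreviation "cnt \<equiv> counts M x (head_bound (Suc (Suc L)))"

lemma actions_tm_of:
  assumes "q \<in> set qs"
  shows "actions M x (Config (e q) p ts) =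
    next_actions e ix q (input_cell x p) (map (\<lambda>(t, h). t h) ts)"
  using idx[OF assms] by (simp add: actions_def tm_of_def)

lemma cnt_idle:
  assumes "q \<in> set qs" "head_bound (Suc (Suc L)) (Config (e q) p ts)"
    and "next_actions e ix q (input_cell x p) (map (\<lambda>(t, h). t h) ts) =
      {idle q' d (map (\<lambda>(t, h). t h) ts)}"
    and "cnt (Config q' (min (move d p) (length x + 1)) ts) k"
  shows "cnt (Config (e q) p ts) k"
proof (rule counts_deterministic_step)
  let ?a = "idle q' d (map (\<lambda>(t, h). t h) ts)"
  show "actions M x (Config (e q) p ts) = {?a}"
    unfolding actions_tm_of[OF assms(1)] by (rule assms(3))
  have "perform x ?a (Config (e q) p ts) = Config q' (min (move d p) (length x + 1)) ts"
    unfolding perform_def idle_def config.sel action.sel map2_update_tape_stay ..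
  then show "cnt (perform x ?a (Config (e q) p ts)) k"
    using assms(4) by (simp only:)
qed (rule assms(2))

lemma cnt_edit:
  assumes "q \<in> set qs" "head_bound (Suc (Suc L)) (Config (e q) p (ts[i := (t, h)]))"
    and "p \<le> length x + 1" "i < length ts"
    and "next_actions e ix q (input_cell x p) (map (\<lambda>(t, h). t h) (ts[i := (t, h)])) =
      {edit q' i s d (map (\<lambda>(t, h). t h) (ts[i := (t, h)]))}"
    and "cnt (Config q' p (ts[i := (t(h := s), move d h)])) k"
  shows "cnt (Config (e q) p (ts[i := (t, h)])) k"
proof (rule counts_deterministic_step)
  let ?ts = "ts[i := (t, h)]"
  let ?a = "edit q' i s d (map (\<lambda>(t, h). t h) ?ts)"
  show "actions M x (Config (e q) p ?ts) = {?a}"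
    unfolding actions_tm_of[OF assms(1)] by (rule assms(5))
  have i: "i < length ?ts" using assms(4) by simp
  have "perform x ?a (Config (e q) p ?ts) = Config q' p (ts[i := (t(h := s), move d h)])"
    unfolding perform_def edit_def config.sel action.sel map2_update_tape_edit[OF i]
    using assms(3,4) by simp
  then show "cnt (perform x ?a (Config (e q) p ?ts)) k"
    using assms(6) by (simp only:)
qed (rule assms(2))

context
  fixes r :: reg and ts :: "((nat \<Rightarrow> nat) \<times> nat) list" and p :: nat
  assumes r: "r \<in> set rs" and len: "length ts = length rs" and p: "p \<le> length x + 1"
    and heads: "\<forall>(t, h) \<in> set ts. h < Suc (Suc L)"
begin

lemma ix_ts [simp]: "ix r < length ts"
  using idx(1)[OF r] len by simp

lemma head_bound_update: "h < Suc (Suc L) \<Longrightarrow> head_bound (Suc (Suc L)) (Config q p (ts[ix r := (t, h)]))"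
  using heads set_update_subset_insert[of ts "ix r" "(t, h)"] by (auto simp: head_bound_def)

lemma map_read_update [simp]:
  "map (\<lambda>(t, h). t h) (ts[ix r := (t, h)]) ! ix r = t h"
  by simp

lemmas cnt_edit_r = cnt_edit[OF _ head_bound_update p ix_ts]

lemma cnt_enter:
  assumes "q \<in> set qs" "\<And>c ss. next_actions e ix q c ss = {edit q' (ix r) (ss ! ix r) Rgt ss}"
    and "cnt (Config q' p (ts[ix r := (bit_tape bs, Suc 0)])) k"
  shows "cnt (Config (e q) p (ts[ix r := (bit_tape bs, 0)])) k"
  by (rule cnt_edit_r[where q' = q' and d = Rgt and s = 0])
    (use assms in \<open>auto simp: fun_upd_idem simp del: map_map\<close>)

text \<open>Bits are coded by nonzero symbols, so the sweep to the left cannot stop before cell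
  \<open>0\<close>.\<close>

lemma cnt_Back:
  assumes "cs \<in> K" "cnt (Config (e (At cs)) p (ts[ix r := (t, 0)])) k"
    and "h < Suc (Suc L)" "t 0 = 0" "\<And>i. 0 < i \<Longrightarrow> i \<le> h \<Longrightarrow> 0 < t i"
  shows "cnt (Config (e (Back r cs)) p (ts[ix r := (t, h)])) k"
  using assms(3-)
proof (induction h)
  case 0
  show ?case
    by (rule cnt_idle[where q' = "e (At cs)" and d = Stay, OF _ head_bound_update])
      (use assms r 0 p in \<open>auto simp: set_qs head_bound_update min_absorb1 simp del: map_map\<close>)
next
  case (Suc h)
  have "0 < t (Suc h)" by (rule Suc.prems(3)) simp_all
  moreover have "cnt (Config (e (Back r cs)) p (ts[ix r := (t, h)])) k"
    using Suc by simp
  ultimately show ?case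
    by - (rule cnt_edit_r[where q' = "e (Back r cs)" and d = Lft and s = "t (Suc h)"],
      use assms(1) r Suc.prems(1) in \<open>auto simp: set_qs simp del: map_map\<close>)
qed

text \<open>\<open>pre\<close> collects the bits already passed, so that the induction follows the
  recursion of \<open>binc\<close> while the head moves right. \<open>cnt_Borrow\<close> and
  \<open>cnt_Test\<close> have the same form.\<close>

lemma cnt_Carry:
  assumes "cs \<in> K" "cnt (Config (e (At cs)) p (ts[ix r := (bit_tape (pre @ binc bs), 0)])) k"
    and "length (pre @ binc bs) \<le> L"
  shows "cnt (Config (e (Carry r cs)) p (ts[ix r := (bit_tape (pre @ bs), Suc (length pre))])) k"
  using assms(2-)
proof (induction bs arbitrary: pre rule: binc.induct)
  case 1
  show ?case
    by (rule cnt_edit_r[where q' = "e (Back r cs)" and d = Lft and s = 2], goal_cases)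
      (use assms(1) r 1 in \<open>auto simp: set_qs bit_tape_nonzero intro!: cnt_Back simp del: map_map\<close>)
next
  case (2 bs)
  show ?case
    by (rule cnt_edit_r[where q' = "e (Back r cs)" and d = Lft and s = 2], goal_cases)
      (use assms(1) r 2 in \<open>auto simp: set_qs bit_tape_nonzero intro!: cnt_Back simp del: map_map\<close>)
next
  case (3 bs)
  show ?case
    by (rule cnt_edit_r[where q' = "e (Carry r cs)" and d = Rgt and s = 1], goal_cases)
      (use assms(1) r 3(1)[of "pre @ [False]"] 3(2-) in \<open>auto simp: set_qs simp del: map_map\<close>)
qed

lemma cnt_Borrow:
  assumes "cs \<in> K" "cnt (Config (e (At cs)) p (ts[ix r := (bit_tape (pre @ bdec bs), 0)])) k"
    and "length (pre @ bs) \<le> L" "0 < bval bs"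
  shows "cnt (Config (e (Borrow r cs)) p (ts[ix r := (bit_tape (pre @ bs), Suc (length pre))])) k"
  using assms(2-)
proof (induction bs arbitrary: pre rule: bdec.induct)
  case (2 bs)
  show ?case
    by (rule cnt_edit_r[where q' = "e (Back r cs)" and d = Lft and s = 1], goal_cases)
      (use assms(1) r 2 in \<open>auto simp: set_qs bit_tape_nonzero intro!: cnt_Back simp del: map_map\<close>)
next
  case (3 bs)
  show ?case
    by (rule cnt_edit_r[where q' = "e (Borrow r cs)" and d = Rgt and s = 2], goal_cases)
      (use assms(1) r 3(1)[of "pre @ [True]"] 3(2-) in \<open>auto simp: set_qs simp del: map_map\<close>)
qed simp

lemma cnt_Test:
  assumes "cs \<in> K" "ds \<in> K"
    and "cnt (Config (e (At (if bval bs = 0 then cs else ds))) p (ts[ix r := (bit_tape (pre @ bs), 0)])) k"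
    and "length (pre @ bs) \<le> L"
  shows "cnt (Config (e (Test r cs ds)) p (ts[ix r := (bit_tape (pre @ bs), Suc (length pre))])) k"
  using assms(3-)
proof (induction bs arbitrary: pre)
  case Nil
  show ?case
    by (rule cnt_edit_r[where q' = "e (Back r cs)" and d = Lft and s = 0], goal_cases)
      (use assms(1,2) r Nil in \<open>auto simp: set_qs bit_tape_nonzero fun_upd_idem intro!: cnt_Back simp del: map_map\<close>)
next
  case (Cons b bs)
  show ?case
  proof (cases b)
    case True
    show ?thesis
      by (rule cnt_edit_r[where q' = "e (Back r ds)" and d = Lft and s = 2], goal_cases)
        (use assms(1,2) r Cons True in \<open>auto simp: set_qs bit_tape_nonzero intro!: cnt_Back simp del: map_map\<close>)
  next
    case False
    show ?thesis
      by (rule cnt_edit_r[where q' = "e (Test r cs ds)" and d = Rgt and s = 1], goal_cases)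
        (use assms(1,2) r Cons(1)[of "pre @ [False]"] Cons(2-) False in \<open>auto simp: set_qs simp del: map_map\<close>)
  qed
qed

end

text \<open>All counters are kept on tapes whose heads rest on the end marker between commands.\<close>

abbreviation tapes_of :: "bool list list \<Rightarrow> ((nat \<Rightarrow> nat) \<times> nat) list" where
  "tapes_of \<equiv> map (\<lambda>bs. (bit_tape bs, 0))"

definition represents :: "store \<Rightarrow> bool list list \<Rightarrow> bool" where
  "represents \<sigma> bss \<longleftrightarrow> length bss = length rs \<and>
     (\<forall>i < length rs. bval (bss ! i) = \<sigma> (rs ! i) \<and> length (bss ! i) \<le> L)"

lemma represents_Head: "represents \<sigma> bss \<Longrightarrow> represents (\<sigma>(Head := n)) bss"
  using Head_rs by (auto simp: represents_def in_set_conv_nth)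

lemma represents_update:
  assumes "represents \<sigma> bss" "r \<in> set rs" "bval bs = n" "length bs \<le> L"
  shows "represents (\<sigma>(r := n)) (bss[ix r := bs])"
proof -
  have "rs ! i = r \<longleftrightarrow> i = ix r" if "i < length rs" for i
    using idx[OF assms(2)] that distinct_rs nth_eq_iff_index_eq by metis
  then show ?thesis
    using assms idx[OF assms(2)] by (auto simp: represents_def nth_list_update)
qed

lemma representsD:
  assumes "represents \<sigma> bss" "r \<in> set rs"
  shows "bval (bss ! ix r) = \<sigma> r" "length (bss ! ix r) \<le> L" "ix r < length bss"
  using assms idx[OF assms(2)] by (auto simp: represents_def)

lemma head_bound_tapes_of: "head_bound (Suc (Suc L)) (Config q p (tapes_of bss))"
  by (auto simp: head_bound_def)

lemma tapes_of_update:
  "i < length bss \<Longrightarrow> tapes_of bss = (tapes_of bss)[i := (bit_tape (bss ! i), 0)]"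
  by (rule sym) (simp add: list_update_same_conv)

lemma cnt_tapes_of_idle:
  assumes "q \<in> set qs"
    and "next_actions e ix q (input_cell x p) (map (\<lambda>(t, h). t h) (tapes_of bss)) =
      {idle (e q') d (map (\<lambda>(t, h). t h) (tapes_of bss))}"
    and "cnt (Config (e q') (min (move d p) (length x + 1)) (tapes_of bss)) k"
  shows "cnt (Config (e q) p (tapes_of bss)) k"
  using cnt_idle[OF assms(1) head_bound_tapes_of assms(2,3)] .

lemma cnt_tapes_of_enter:
  assumes "represents \<sigma> bss" "r \<in> set rs" "p \<le> length x + 1" "q \<in> set qs"
    and "\<And>c ss. next_actions e ix q c ss = {edit (e q') (ix r) (ss ! ix r) Rgt ss}"
    and "cnt (Config (e q') p ((tapes_of bss)[ix r := (bit_tape (bss ! ix r), Suc 0)])) k"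
  shows "cnt (Config (e q) p (tapes_of bss)) k"
proof -
  have "cnt (Config (e q) p ((tapes_of bss)[ix r := (bit_tape (bss ! ix r), 0)])) k"
    by (rule cnt_enter[where q' = "e q'"]) (use assms in \<open>auto simp: represents_def\<close>)
  then show ?thesis
    by (subst tapes_of_update[OF representsD(3)[OF assms(1,2)]])
qed

lemma cnt_tapes_of_test:
  assumes "represents \<sigma> bss" "r \<in> set rs" "p \<le> length x + 1" "cs \<in> K" "ds \<in> K" "q \<in> set qs"
    and "\<And>c ss. next_actions e ix q c ss = {edit (e (Test r cs ds)) (ix r) (ss ! ix r) Rgt ss}"
    and "cnt (Config (e (At (if \<sigma> r = 0 then cs else ds))) p (tapes_of bss)) k"
  shows "cnt (Config (e q) p (tapes_of bss)) k"
proof (rule cnt_tapes_of_enter[OF assms(1-3,6,7)])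
  note R = representsD[OF assms(1,2)]
  have "cnt (Config (e (At (if bval (bss ! ix r) = 0 then cs else ds))) p
      ((tapes_of bss)[ix r := (bit_tape ([] @ bss ! ix r), 0)])) k"
    using assms(8) R(1) by (simp flip: tapes_of_update[OF R(3)])
  then show "cnt (Config (e (Test r cs ds)) p
      ((tapes_of bss)[ix r := (bit_tape (bss ! ix r), Suc 0)])) k"
    using cnt_Test[of r "tapes_of bss" p cs ds "bss ! ix r" "[]" k] assms R
    by (auto simp: represents_def)
qed

text \<open>The derivation of \<open>run\<close> is replayed as one of \<open>counts\<close>, each
  command becoming a sweep. The hypothesis \<open>b < 2 ^ L\<close> turns the bound on values into a
  bound on lengths, so that incrementing never needs more than \<open>L\<close> bits.\<close>

lemma cnt_run:
  assumes "run x b Q cs \<sigma> N" "b < 2 ^ L" "cs \<in> K" "\<sigma> Head \<le> length x + 1" "represents \<sigma> bss"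
  shows "cnt (Config (e (At cs)) (\<sigma> Head) (tapes_of bss)) N"
  using assms(1,3-)
proof (induction arbitrary: bss)
  case (run_Nil \<sigma>)
  have q: "At [] \<in> set qs" using run_Nil by (simp add: set_qs)
  have "actions M x (Config (e (At [])) (\<sigma> Head) (tapes_of bss)) = {}"
    by (simp add: actions_tm_of[OF q])
  from counts_halt[where B = "head_bound (Suc (Suc L))", OF head_bound_tapes_of this] show ?case
    by (simp add: tm_of_def)
next
  case (run_Skip cs \<sigma> N)
  then show ?case
    using succs_K[of "Skip # cs"]
    by - (rule cnt_tapes_of_idle[where q' = "At cs" and d = Stay]; auto simp: set_qs min_absorb1)
next
  case (run_Inc \<sigma> r cs N)
  have K: "cs \<in> K" using succs_K[OF run_Inc.prems(1)] by simp
  show ?case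
  proof (cases "r = Head")
    case True
    have "cnt (Config (e (At cs)) ((\<sigma>(r := \<sigma> r + 1)) Head) (tapes_of bss)) N"
      using run_Inc.IH[OF K, of bss] run_Inc.hyps True
        represents_Head[OF run_Inc.prems(3), of "\<sigma> Head + 1"]
      by (simp add: capacity_def fun_upd_def)
    then show ?thesis
      using run_Inc.prems run_Inc.hyps True
      by - (rule cnt_tapes_of_idle[where q' = "At cs" and d = Rgt]; auto simp: set_qs min_absorb1 capacity_def)
  next
    case False
    have r: "r \<in> set rs" using head_regs_K[OF run_Inc.prems(1)] False by simp
    note R = representsD[OF run_Inc.prems(3) r]
    have len: "length (binc (bss ! ix r)) \<le> L"
      by (rule length_binc_le[where b = b])
        (use R run_Inc.hyps False assms(2) in \<open>auto simp: capacity_def\<close>)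
    have "represents (\<sigma>(r := \<sigma> r + 1)) (bss[ix r := binc (bss ! ix r)])"
      using represents_update[OF run_Inc.prems(3) r bval_binc len] R(1) by simp
    then have "cnt (Config (e (At cs)) (\<sigma> Head) (tapes_of (bss[ix r := binc (bss ! ix r)]))) N"
      using run_Inc.IH[OF K] run_Inc.prems(2) False by (simp add: fun_upd_def)
    then have "cnt (Config (e (Carry r cs)) (\<sigma> Head)
        ((tapes_of bss)[ix r := (bit_tape (bss ! ix r), Suc 0)])) N"
      using cnt_Carry[of r "tapes_of bss" "\<sigma> Head" cs "[]" "bss ! ix r" N] K len r run_Inc.prems
      by (auto simp: represents_def map_update)
    then show ?thesis
      using run_Inc.prems False
      by - (rule cnt_tapes_of_enter[where q' = "Carry r cs" and r = r and \<sigma> = \<sigma>]; auto simp: set_qs r)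
  qed
next
  case (run_Dec \<sigma> r cs N)
  have K: "cs \<in> K" using succs_K[OF run_Dec.prems(1)] by simp
  show ?case
  proof (cases "r = Head")
    case True
    have "cnt (Config (e (At cs)) ((\<sigma>(r := \<sigma> r - 1)) Head) (tapes_of bss)) N"
      using run_Dec.IH[OF K, of bss] run_Dec.prems(2) True
        represents_Head[OF run_Dec.prems(3), of "\<sigma> Head - 1"]
      by (simp add: fun_upd_def)
    then show ?thesis
      using run_Dec.prems run_Dec.hyps True
      by - (rule cnt_tapes_of_idle[where q' = "At cs" and d = Lft]; auto simp: set_qs min_absorb1)
  next
    case False
    have r: "r \<in> set rs" using head_regs_K[OF run_Dec.prems(1)] False by simp
    note R = representsD[OF run_Dec.prems(3) r]
    have "represents (\<sigma>(r := \<sigma> r - 1)) (bss[ix r := bdec (bss ! ix r)])"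
      using represents_update[OF run_Dec.prems(3) r, of "bdec (bss ! ix r)" "\<sigma> r - 1"]
        bval_bdec[of "bss ! ix r"] R run_Dec.hyps by simp
    then have "cnt (Config (e (At cs)) (\<sigma> Head) (tapes_of (bss[ix r := bdec (bss ! ix r)]))) N"
      using run_Dec.IH[OF K] run_Dec.prems(2) False by (simp add: fun_upd_def)
    then have "cnt (Config (e (Borrow r cs)) (\<sigma> Head)
        ((tapes_of bss)[ix r := (bit_tape (bss ! ix r), Suc 0)])) N"
      using cnt_Borrow[of r "tapes_of bss" "\<sigma> Head" cs "[]" "bss ! ix r" N] K R r run_Dec
      by (auto simp: represents_def map_update)
    then show ?thesis
      using run_Dec.prems False
      by - (rule cnt_tapes_of_enter[where q' = "Borrow r cs" and r = r and \<sigma> = \<sigma>]; auto simp: set_qs r)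
  qed
next
  case (run_Seq c d cs \<sigma> N)
  then show ?case
    using succs_K[of "(c ;; d) # cs"]
    by - (rule cnt_tapes_of_idle[where q' = "At (c # d # cs)" and d = Stay]; auto simp: set_qs min_absorb1)
next
  case (run_IfZ \<sigma> r c d cs N)
  have K: "c # cs \<in> K" "d # cs \<in> K" using succs_K[OF run_IfZ.prems(1)] by auto
  have IH: "cnt (Config (e (At ((if \<sigma> r = 0 then c else d) # cs))) (\<sigma> Head) (tapes_of bss)) N"
    by (rule run_IfZ.IH) (use run_IfZ.prems K in auto)
  show ?case
  proof (cases "r = Head")
    case True
    \<comment> \<open>The input head has position zero exactly if it scans the left end marker, so
      \<open>Head\<close> is tested without a tape.\<close>
    then show ?thesis
      using run_IfZ.prems IH
      by - (rule cnt_tapes_of_idle[where q' = "At ((if \<sigma> r = 0 then c else d) # cs)" and d = Stay]; auto simp: set_qs min_absorb1 input_cell_def)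
  next
    case False
    then have r: "r \<in> set rs" using head_regs_K[OF run_IfZ.prems(1)] by simp
    have "cnt (Config (e (At (if \<sigma> r = 0 then c # cs else d # cs))) (\<sigma> Head) (tapes_of bss)) N"
      using IH by (simp split: if_splits)
    then show ?thesis
      by (rule cnt_tapes_of_test[OF run_IfZ.prems(3) r run_IfZ.prems(2) K, rotated 2])
        (use run_IfZ.prems False in \<open>auto simp: set_qs\<close>)
  qed
next
  case (run_While0 \<sigma> r cs N c)
  have K: "cs \<in> K" "c # While r c # cs \<in> K" using succs_K[OF run_While0.prems(1)] by auto
  have IH: "cnt (Config (e (At cs)) (\<sigma> Head) (tapes_of bss)) N"
    by (rule run_While0.IH) (use run_While0.prems K in auto)
  show ?case
  proof (cases "r = Head")
    case True
    then show ?thesis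
      using run_While0.prems run_While0.hyps IH
      by - (rule cnt_tapes_of_idle[where q' = "At cs" and d = Stay]; auto simp: set_qs min_absorb1 input_cell_def)
  next
    case False
    then have r: "r \<in> set rs" using head_regs_K[OF run_While0.prems(1)] by simp
    have "cnt (Config (e (At (if \<sigma> r = 0 then cs else c # While r c # cs))) (\<sigma> Head) (tapes_of bss)) N"
      using IH run_While0.hyps by simp
    then show ?thesis
      by (rule cnt_tapes_of_test[OF run_While0.prems(3) r run_While0.prems(2) K, rotated 2])
        (use run_While0.prems False in \<open>auto simp: set_qs\<close>)
  qed
next
  case (run_While \<sigma> r c cs N)
  have K: "cs \<in> K" "c # While r c # cs \<in> K" using succs_K[OF run_While.prems(1)] by auto
  have IH: "cnt (Config (e (At (c # While r c # cs))) (\<sigma> Head) (tapes_of bss)) N"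
    by (rule run_While.IH) (use run_While.prems K in auto)
  show ?case
  proof (cases "r = Head")
    case True
    then show ?thesis
      using run_While.prems run_While.hyps IH
      by - (rule cnt_tapes_of_idle[where q' = "At (c # While r c # cs)" and d = Stay]; auto simp: set_qs min_absorb1 input_cell_def)
  next
    case False
    then have r: "r \<in> set rs" using head_regs_K[OF run_While.prems(1)] by simp
    have "cnt (Config (e (At (if \<sigma> r = 0 then cs else c # While r c # cs))) (\<sigma> Head) (tapes_of bss)) N"
      using IH run_While.hyps by simp
    then show ?thesis
      by (rule cnt_tapes_of_test[OF run_While.prems(3) r run_While.prems(2) K, rotated 2])
        (use run_While.prems False in \<open>auto simp: set_qs\<close>)
  qed
next
  case (run_IfCell \<sigma> d c c' cs N)
  then show ?case
    using succs_K[of "IfCell d c c' # cs"]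
    by - (rule cnt_tapes_of_idle[where
          q' = "At ((if input_cell x (\<sigma> Head) = d then c else c') # cs)" and d = Stay]; auto simp: set_qs min_absorb1)
next
  case (run_Choose c cs \<sigma> N d N')
  let ?c = "Config (e (At (Choose c d # cs))) (\<sigma> Head) (tapes_of bss)"
  let ?ss = "map (\<lambda>(t, h). t h) (tapes_of bss)"
  let ?a1 = "idle (e (At (c # cs))) Stay ?ss" and ?a2 = "idle (e (At (Skip # d # cs))) Stay ?ss"
  have K: "c # cs \<in> K" "d # cs \<in> K" "Skip # d # cs \<in> K"
    using succs_K[OF run_Choose.prems(1)] by auto
  have c: "cnt (Config (e (At (c # cs))) (\<sigma> Head) (tapes_of bss)) N"
    by (rule run_Choose.IH) (use run_Choose.prems K in auto)
  have "cnt (Config (e (At (d # cs))) (\<sigma> Head) (tapes_of bss)) N'"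
    by (rule run_Choose.IH) (use run_Choose.prems K in auto)
  then have d: "cnt (Config (e (At (Skip # d # cs))) (\<sigma> Head) (tapes_of bss)) N'"
    using K run_Choose.prems
    by - (rule cnt_tapes_of_idle[where q' = "At (d # cs)" and d = Stay]; auto simp: set_qs min_absorb1)
  \<comment> \<open>The two lists differ in length, hence the two targets are different states and
    the sum below really has two terms.\<close>
  have "c # cs \<noteq> Skip # d # cs" by simp
  then have ne: "?a1 \<noteq> ?a2"
    using K by (simp add: idle_def idx_inj set_qs del: map_map)
  have acts: "actions M x ?c = {?a1, ?a2}"
    using run_Choose.prems(1) by (subst actions_tm_of) (auto simp: set_qs simp del: map_map)
  have perf: "perform x (idle q Stay ?ss) ?c = Config q (\<sigma> Head) (tapes_of bss)" for q
    using run_Choose.prems(2)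
    unfolding perform_def idle_def config.sel action.sel map2_update_tape_stay by simp
  have "cnt ?c (\<Sum>a\<in>actions M x ?c. if a = ?a1 then N else N')"
    by (rule counts_step)
      (use acts c d ne head_bound_tapes_of in \<open>auto simp: perf simp del: map_map\<close>)
  then show ?case
    using ne unfolding acts by simp
next
  case (run_Fail cs \<sigma>)
  have q: "At (Fail # cs) \<in> set qs" using run_Fail by (simp add: set_qs)
  have Nil: "At [] \<in> set qs" using Nil_K by (simp add: set_qs)
  have "actions M x (Config (e (At (Fail # cs))) (\<sigma> Head) (tapes_of bss)) = {}"
    by (simp add: actions_tm_of[OF q])
  from counts_halt[where B = "head_bound (Suc (Suc L))", OF head_bound_tapes_of this] show ?case
    by (simp add: tm_of_def idx_inj[OF q Nil])
qed

end

end


text \<open>The continuations and registers of a fixed program form finite sets, so a single machine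
  serves all inputs; only the bounds \<open>b\<close> and \<open>L\<close> vary with the input
  length.\<close>

theorem cmd_in_sharpL:
  assumes run: "\<And>x. run x (b (length x)) Q [c] (\<lambda>_. 0) (f x)"
    and b: "\<And>n. b n < 2 ^ L n"
    and L: "(\<lambda>n. real (L n)) \<in> O(\<lambda>n. ln (real n))"
  shows "f \<in> sharpL"
proof -
  define K where "K = insert [] (stacks c [])"
  have finK: "finite K" by (simp add: K_def finite_stacks)
  have fin: "finite (\<Union> (head_regs ` K) - {Head})"
  proof -
    have "finite (head_regs cs)" for cs
      by (cases cs rule: head_regs.cases) auto
    then show ?thesis using finK by blast
  qed
  from finite_distinct_list[OF fin]
  obtain rs where rs: "set rs = \<Union> (head_regs ` K) - {Head}" "distinct rs"
    by (elim exE conjE)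
  from finite_list[OF finite_controls[OF finite_set[of rs] finK]]
  obtain qs' where qs': "set qs' = controls (set rs) K" ..
  define qs where "qs = At [c] # qs'"
  have cK: "[c] \<in> K" using Cons_in_stacks by (simp add: K_def)
  interpret compiled K rs qs
  proof
    show "succs cs \<subseteq> K" if "cs \<in> K" for cs
      using that succs_stacks[of cs c "[]"] by (auto simp: K_def)
    show "head_regs cs \<subseteq> insert Head (set rs)" if "cs \<in> K" for cs
      using that by (auto simp: rs)
  qed (use rs qs' cK in \<open>auto simp: K_def qs_def\<close>)
  have cnt: "counts M x (head_bound (Suc (Suc (L (length x))))) (initial M) (f x)" for x
  proof -
    have "represents (L (length x)) (\<lambda>_. 0) (replicate (length rs) [])"
      by (simp add: represents_def)
    moreover have "initial M = Config (e (At [c])) 0 (tapes_of (replicate (length rs) []))"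
      by (simp add: initial_def tm_of_def qs_def map_replicate bit_tape_def fun_eq_iff)
    ultimately show ?thesis
      using cnt_run[where bss = "replicate (length rs) []", OF run b cK] by simp
  qed
  have "(\<lambda>n. real (Suc (Suc (L n)))) \<in> O(\<lambda>n. ln (real n))"
  proof -
    \<comment> \<open>From 3 on, \<open>ln n\<close> is at least 1, so the two additional cells are
      absorbed by the logarithm.\<close>
    have "(\<lambda>n. 2 :: real) \<in> O(\<lambda>n :: nat. ln (real n))"
    proof (rule bigoI[where c = 2])
      have "1 \<le> ln (real n)" if "3 \<le> n" for n
        using that exp_le by (subst ln_ge_iff) auto
      then show "\<forall>\<^sub>F n in at_top. norm (2 :: real) \<le> 2 * norm (ln (real n))"
        by (intro eventually_at_top_linorderI[of 3]) fastforce
    qed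
    from sum_in_bigo(1)[OF L this] show ?thesis by (simp add: add_ac)
  qed
  moreover have "\<forall>(t, h) \<in> set (tapes (final M x as)). h < Suc (Suc (L (length x)))"
    if "path M x as" for x as
    using counts_initialD(3)[OF cnt that] by (simp add: head_bound_def)
  ultimately have "log_space_on UNIV M"
    unfolding log_space_on_def by (intro exI[of _ "\<lambda>n. Suc (Suc (L n))"]) auto
  moreover have "wf_tm M" by (rule wf_tm_of) (simp add: qs_def)
  ultimately show ?thesis
    using no_output_tm_of counts_initialD(1,2)[OF cnt] unfolding sharpL_def
    by (intro CollectI exI[of _ M]) simp
qed

section \<open>Arithmetic programs\<close>

text \<open>Quantifying over all postconditions, continuations and counts says that the command
  neither multiplies nor discards computations. This makes deterministic code composable without
  mentioning counts.\<close>

definition exec :: "bool list \<Rightarrow> nat \<Rightarrow> cmd \<Rightarrow> store \<Rightarrow> store \<Rightarrow> bool" where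
  "exec x b c \<sigma> \<sigma>' \<longleftrightarrow> (\<forall>Q cs N. run x b Q cs \<sigma>' N \<longrightarrow> run x b Q (c # cs) \<sigma> N)"

lemma exec_run: "exec x b c \<sigma> \<sigma>' \<Longrightarrow> run x b Q cs \<sigma>' N \<Longrightarrow> run x b Q (c # cs) \<sigma> N"
  by (simp add: exec_def)

lemma exec_Skip: "exec x b Skip \<sigma> \<sigma>"
  by (simp add: exec_def run_Skip)

lemma exec_Inc: "\<sigma> r < capacity x b r \<Longrightarrow> exec x b (Inc r) \<sigma> (\<sigma>(r := Suc (\<sigma> r)))"
  using run_Inc[of \<sigma> r x b] by (simp add: exec_def)

lemma exec_Dec: "0 < \<sigma> r \<Longrightarrow> exec x b (Dec r) \<sigma> (\<sigma>(r := \<sigma> r - 1))"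
  using run_Dec[of \<sigma> r x b] by (simp add: exec_def)

lemma exec_Seq: "exec x b c \<sigma> \<sigma>' \<Longrightarrow> exec x b d \<sigma>' \<sigma>'' \<Longrightarrow> exec x b (c ;; d) \<sigma> \<sigma>''"
  by (simp add: exec_def run_Seq)

lemma exec_IfZ:
  "exec x b (if \<sigma> r = 0 then c else d) \<sigma> \<sigma>' \<Longrightarrow> exec x b (IfZ r c d) \<sigma> \<sigma>'"
  using run_IfZ[of x b _ \<sigma> r c d] by (simp add: exec_def)

lemma exec_IfCell:
  "exec x b (if input_cell x (\<sigma> Head) = e then c else d) \<sigma> \<sigma>' \<Longrightarrow> exec x b (IfCell e c d) \<sigma> \<sigma>'"
  using run_IfCell[of x b _ \<sigma> e c d] by (simp add: exec_def)

lemma exec_While0: "\<sigma> r = 0 \<Longrightarrow> exec x b (While r c) \<sigma> \<sigma>"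
  by (simp add: exec_def run_While0)

lemma exec_While:
  "\<sigma> r \<noteq> 0 \<Longrightarrow> exec x b c \<sigma> \<sigma>' \<Longrightarrow> exec x b (While r c) \<sigma>' \<sigma>'' \<Longrightarrow> exec x b (While r c) \<sigma> \<sigma>''"
  by (simp add: exec_def run_While)

text \<open>\<open>st\<close> gives the store after each round in closed form; applications then
  have to verify a single round only.\<close>

lemma exec_loop:
  assumes "\<And>j. j < n \<Longrightarrow> st j r \<noteq> 0 \<and> exec x b c (st j) (st (Suc j))" "st n r = 0"
  shows "exec x b (While r c) (st 0) (st n)"
  using assms
proof (induction n arbitrary: st)
  case 0
  then show ?case by (simp add: exec_While0)
next
  case (Suc n)
  have "exec x b (While r c) (st (Suc 0)) (st (Suc n))"
    using Suc.IH[of "\<lambda>j. st (Suc j)"] Suc.prems by auto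
  then show ?case using exec_While Suc.prems(1)[of 0] by blast
qed

section \<open>Macros for counters\<close>

primrec incs :: "reg \<Rightarrow> nat \<Rightarrow> cmd" where
  "incs r 0 = Skip"
| "incs r (Suc k) = Inc r ;; incs r k"

primrec decs :: "reg \<Rightarrow> nat \<Rightarrow> cmd" where
  "decs r 0 = Skip"
| "decs r (Suc k) = Dec r ;; decs r k"

definition clear :: "reg \<Rightarrow> cmd" where
  "clear r = While r (Dec r)"

definition assign :: "reg \<Rightarrow> nat \<Rightarrow> cmd" where
  "assign r k = clear r ;; incs r k"

text \<open>Counting \<open>r\<close> down selects the command, which is preceded by counting \<open>r\<close> up again.\<close>

primrec switch :: "reg \<Rightarrow> nat \<Rightarrow> (nat \<Rightarrow> cmd) \<Rightarrow> cmd" where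
  "switch r 0 P = Skip"
| "switch r (Suc n) P = IfZ r (P 0) (Dec r ;; switch r n (\<lambda>v. Inc r ;; P (Suc v)))"

definition times :: "reg \<Rightarrow> nat \<Rightarrow> cmd" where
  "times r k = While r (Dec r ;; incs Tmp k) ;; While Tmp (Dec Tmp ;; Inc r)"

definition push :: "nat \<Rightarrow> reg \<Rightarrow> reg \<Rightarrow> cmd" where
  "push S r c = times r S ;; switch c S (incs r)"

text \<open>While \<open>r\<close> is counted down, \<open>c\<close> counts modulo \<open>S\<close>
  and \<open>Tmp\<close> counts the overflows. In the end \<open>c\<close> is the remainder and
  \<open>Tmp\<close> the quotient, which is moved back to \<open>r\<close>.\<close>

definition pop :: "nat \<Rightarrow> reg \<Rightarrow> reg \<Rightarrow> cmd" where
  "pop S r c = clear c ;;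
     While r (Dec r ;; switch c S (\<lambda>v. if Suc v = S then decs c v ;; Inc Tmp else Inc c)) ;;
     While Tmp (Dec Tmp ;; Inc r)"

definition copy :: "reg \<Rightarrow> reg \<Rightarrow> cmd" where
  "copy r c = clear c ;; While r (Dec r ;; Inc c ;; Inc Tmp) ;; While Tmp (Dec Tmp ;; Inc r)"

lemma exec_incs:
  "r \<noteq> Head \<Longrightarrow> \<sigma> r + k \<le> b \<Longrightarrow> exec x b (incs r k) \<sigma> (\<sigma>(r := \<sigma> r + k))"
proof (induction k arbitrary: \<sigma>)
  case 0
  then show ?case by (simp add: exec_Skip)
next
  case (Suc k)
  have "exec x b (Inc r) \<sigma> (\<sigma>(r := Suc (\<sigma> r)))"
    using Suc.prems by (intro exec_Inc) (simp add: capacity_def)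
  moreover have "exec x b (incs r k) (\<sigma>(r := Suc (\<sigma> r))) (\<sigma>(r := \<sigma> r + Suc k))"
    using Suc.IH[of "\<sigma>(r := Suc (\<sigma> r))"] Suc.prems by (simp add: fun_upd_def cong: if_cong)
  ultimately show ?case unfolding incs.simps by (rule exec_Seq)
qed

lemma exec_decs: "k \<le> \<sigma> r \<Longrightarrow> exec x b (decs r k) \<sigma> (\<sigma>(r := \<sigma> r - k))"
proof (induction k arbitrary: \<sigma>)
  case 0
  then show ?case by (simp add: exec_Skip)
next
  case (Suc k)
  have "exec x b (Dec r) \<sigma> (\<sigma>(r := \<sigma> r - 1))"
    using Suc.prems by (intro exec_Dec) simp
  moreover have "exec x b (decs r k) (\<sigma>(r := \<sigma> r - 1)) (\<sigma>(r := \<sigma> r - Suc k))"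
    using Suc.IH[of "\<sigma>(r := \<sigma> r - 1)"] Suc.prems by (simp add: fun_upd_def cong: if_cong)
  ultimately show ?case unfolding decs.simps by (rule exec_Seq)
qed

lemma exec_clear: "exec x b (clear r) \<sigma> (\<sigma>(r := 0))"
proof -
  have "exec x b (While r (Dec r)) ((\<lambda>j. \<sigma>(r := \<sigma> r - j)) 0) ((\<lambda>j. \<sigma>(r := \<sigma> r - j)) (\<sigma> r))"
  proof (rule exec_loop)
    fix j assume "j < \<sigma> r"
    then show "(\<sigma>(r := \<sigma> r - j)) r \<noteq> 0 \<and>
        exec x b (Dec r) (\<sigma>(r := \<sigma> r - j)) (\<sigma>(r := \<sigma> r - Suc j))"
      using exec_Dec[of "\<sigma>(r := \<sigma> r - j)" r x b] by simp
  qed simp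
  then show ?thesis by (simp add: clear_def)
qed

lemma exec_assign: "r \<noteq> Head \<Longrightarrow> k \<le> b \<Longrightarrow> exec x b (assign r k) \<sigma> (\<sigma>(r := k))"
  using exec_Seq[OF exec_clear exec_incs[of r "\<sigma>(r := 0)" k b x]] by (simp add: assign_def)

lemma run_switch:
  assumes "r \<noteq> Head" "\<sigma> r < n" "\<sigma> r \<le> b" "run x b Q (P (\<sigma> r) # cs) \<sigma> N"
  shows "run x b Q (switch r n P # cs) \<sigma> N"
  using assms
proof (induction n arbitrary: P \<sigma>)
  case (Suc n)
  show ?case
  proof (cases "\<sigma> r")
    case 0
    then show ?thesis using Suc.prems by (simp add: run_IfZ)
  next
    case (Suc v)
    let ?\<sigma> = "\<sigma>(r := v)"
    have eq: "?\<sigma>(r := ?\<sigma> r + 1) = \<sigma>" using Suc by auto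
    have "run x b Q (Inc r # P (Suc v) # cs) ?\<sigma> N"
      by (rule run_Inc) (use Suc.prems Suc eq in \<open>simp_all add: capacity_def del: fun_upd_upd\<close>)
    then have "run x b Q ((Inc r ;; P (Suc (?\<sigma> r))) # cs) ?\<sigma> N"
      by (intro run_Seq) simp
    then have "run x b Q (switch r n (\<lambda>v. Inc r ;; P (Suc v)) # cs) ?\<sigma> N"
      by (rule Suc.IH[rotated 3]) (use Suc.prems Suc in auto)
    then have "run x b Q (Dec r # switch r n (\<lambda>v. Inc r ;; P (Suc v)) # cs) \<sigma> N"
      using Suc by (intro run_Dec) auto
    then show ?thesis
      using Suc by (auto intro!: run_IfZ run_Seq)
  qed
qed simp

lemma exec_switch:
  assumes "r \<noteq> Head" "\<sigma> r < n" "\<sigma> r \<le> b" "exec x b (P (\<sigma> r)) \<sigma> \<sigma>'"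
  shows "exec x b (switch r n P) \<sigma> \<sigma>'"
  using assms run_switch unfolding exec_def by blast

lemma exec_return:
  assumes "r \<noteq> Head" "r \<noteq> Tmp" "\<sigma> r + \<sigma> Tmp \<le> b"
  shows "exec x b (While Tmp (Dec Tmp ;; Inc r)) \<sigma> (\<sigma>(r := \<sigma> r + \<sigma> Tmp, Tmp := 0))"
proof -
  let ?st = "\<lambda>j. \<sigma>(r := \<sigma> r + j, Tmp := \<sigma> Tmp - j)"
  have "exec x b (While Tmp (Dec Tmp ;; Inc r)) (?st 0) (?st (\<sigma> Tmp))"
  proof (rule exec_loop)
    fix j assume j: "j < \<sigma> Tmp"
    have "exec x b (Dec Tmp) (?st j) ((?st j)(Tmp := \<sigma> Tmp - Suc j))"
      using exec_Dec[of "?st j" Tmp x b] j by simp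
    moreover have "exec x b (Inc r) ((?st j)(Tmp := \<sigma> Tmp - Suc j)) (?st (Suc j))"
      using exec_Inc[of "(?st j)(Tmp := \<sigma> Tmp - Suc j)" r x b] j assms
      by (auto simp: capacity_def fun_upd_twist)
    ultimately show "?st j Tmp \<noteq> 0 \<and> exec x b (Dec Tmp ;; Inc r) (?st j) (?st (Suc j))"
      using j exec_Seq by auto
  qed simp
  then show ?thesis by simp
qed

lemma exec_times:
  assumes "r \<noteq> Head" "r \<noteq> Tmp" "\<sigma> Tmp = 0" "\<sigma> r * k \<le> b"
  shows "exec x b (times r k) \<sigma> (\<sigma>(r := \<sigma> r * k))"
proof -
  let ?st = "\<lambda>j. \<sigma>(r := \<sigma> r - j, Tmp := j * k)"
  have "exec x b (While r (Dec r ;; incs Tmp k)) (?st 0) (?st (\<sigma> r))"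
  proof (rule exec_loop)
    fix j assume j: "j < \<sigma> r"
    have "Suc j * k \<le> \<sigma> r * k" using j by (intro mult_le_mono) auto
    then have le: "j * k + k \<le> b" using assms(4) by simp
    have "exec x b (Dec r) (?st j) ((?st j)(r := \<sigma> r - Suc j))"
      using exec_Dec[of "?st j" r x b] j assms by simp
    moreover have "exec x b (incs Tmp k) ((?st j)(r := \<sigma> r - Suc j)) (?st (Suc j))"
      using exec_incs[of Tmp "(?st j)(r := \<sigma> r - Suc j)" k b x] le assms
      by (simp add: fun_upd_twist add.commute)
    ultimately show "?st j r \<noteq> 0 \<and> exec x b (Dec r ;; incs Tmp k) (?st j) (?st (Suc j))"
      using j exec_Seq assms by auto
  qed (use assms in simp)
  then have "exec x b (While r (Dec r ;; incs Tmp k)) \<sigma> (?st (\<sigma> r))"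
    using assms by (simp add: fun_upd_idem)
  moreover have "exec x b (While Tmp (Dec Tmp ;; Inc r)) (?st (\<sigma> r)) (\<sigma>(r := \<sigma> r * k))"
    using exec_return[of r "?st (\<sigma> r)" b x] assms by (simp add: fun_upd_twist fun_upd_idem)
  ultimately show ?thesis unfolding times_def by (rule exec_Seq)
qed

lemma exec_push:
  assumes "r \<noteq> Head" "r \<noteq> Tmp" "c \<noteq> Head" "c \<noteq> r" "\<sigma> Tmp = 0" "\<sigma> c < S" "\<sigma> r * S + \<sigma> c \<le> b"
  shows "exec x b (push S r c) \<sigma> (\<sigma>(r := \<sigma> r * S + \<sigma> c))"
proof -
  let ?\<sigma> = "\<sigma>(r := \<sigma> r * S)"
  have "exec x b (times r S) \<sigma> ?\<sigma>"
    by (rule exec_times) (use assms in auto)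
  moreover have "exec x b (switch c S (incs r)) ?\<sigma> (\<sigma>(r := \<sigma> r * S + \<sigma> c))"
    by (rule exec_switch) (use exec_incs[of r ?\<sigma> "\<sigma> c" b x] assms in auto)
  ultimately show ?thesis unfolding push_def by (rule exec_Seq)
qed

lemma exec_pop:
  assumes "r \<noteq> Head" "r \<noteq> Tmp" "c \<noteq> Head" "c \<noteq> Tmp" "c \<noteq> r" "\<sigma> Tmp = 0" "0 < S" "S \<le> b" "\<sigma> r \<le> b"
  shows "exec x b (pop S r c) \<sigma> (\<sigma>(r := \<sigma> r div S, c := \<sigma> r mod S))"
proof -
  let ?st = "\<lambda>j. \<sigma>(r := \<sigma> r - j, c := j mod S, Tmp := j div S)"
  let ?body = "\<lambda>v. if Suc v = S then decs c v ;; Inc Tmp else Inc c"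
  have "exec x b (While r (Dec r ;; switch c S ?body)) (?st 0) (?st (\<sigma> r))"
  proof (rule exec_loop)
    fix j assume j: "j < \<sigma> r"
    let ?\<sigma> = "(?st j)(r := \<sigma> r - Suc j)"
    have "exec x b (Dec r) (?st j) ?\<sigma>"
      using exec_Dec[of "?st j" r x b] j assms by simp
    moreover have "exec x b (?body (?\<sigma> c)) ?\<sigma> (?st (Suc j))"
    proof (cases "Suc (j mod S) = S")
      case True
      have "exec x b (decs c (j mod S)) ?\<sigma> (?\<sigma>(c := 0))"
        using exec_decs[of "j mod S" ?\<sigma> c x b] assms by simp
      moreover have "j div S < b"
        using j assms(9) div_le_dividend[of j S] by linarith
      then have "exec x b (Inc Tmp) (?\<sigma>(c := 0)) (?\<sigma>(c := 0, Tmp := Suc (j div S)))"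
        using exec_Inc[of "?\<sigma>(c := 0)" Tmp x b] assms by (simp add: capacity_def)
      moreover have "Suc j mod S = 0" "Suc j div S = Suc (j div S)"
        using True by (simp_all add: mod_Suc div_Suc)
      then have "?\<sigma>(c := 0, Tmp := Suc (j div S)) = ?st (Suc j)"
        using assms by (auto simp: fun_eq_iff)
      ultimately show ?thesis using True assms exec_Seq by auto
    next
      case False
      have "j mod S < b" using assms mod_less_divisor[of S j] by linarith
      then have "exec x b (Inc c) ?\<sigma> (?\<sigma>(c := Suc (j mod S)))"
        using exec_Inc[of ?\<sigma> c x b] assms by (simp add: capacity_def)
      moreover have "Suc j mod S = Suc (j mod S)" "Suc j div S = j div S"
        using False by (simp_all add: mod_Suc div_Suc)
      then have "?\<sigma>(c := Suc (j mod S)) = ?st (Suc j)"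
        using assms by (auto simp: fun_eq_iff)
      ultimately show ?thesis using False assms by auto
    qed
    then have "exec x b (switch c S ?body) ?\<sigma> (?st (Suc j))"
      by (rule exec_switch[rotated 3])
        (use assms mod_less_divisor[of S j] in \<open>simp_all del: mod_less_divisor\<close>)
    ultimately show "?st j r \<noteq> 0 \<and> exec x b (Dec r ;; switch c S ?body) (?st j) (?st (Suc j))"
      using j exec_Seq assms by auto
  qed (use assms in simp)
  moreover have "?st 0 = \<sigma>(c := 0)"
    using assms by (auto simp: fun_eq_iff)
  ultimately have "exec x b (While r (Dec r ;; switch c S ?body)) (\<sigma>(c := 0)) (?st (\<sigma> r))"
    by simp
  moreover have "exec x b (While Tmp (Dec Tmp ;; Inc r)) (?st (\<sigma> r))
      (\<sigma>(r := \<sigma> r div S, c := \<sigma> r mod S))"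
  proof -
    have "\<sigma> r div S \<le> b" using assms(9) div_le_dividend[of "\<sigma> r" S] by linarith
    moreover have "(?st (\<sigma> r))(r := \<sigma> r div S, Tmp := 0) = \<sigma>(r := \<sigma> r div S, c := \<sigma> r mod S)"
      using assms by (auto simp: fun_eq_iff)
    ultimately show ?thesis
      using exec_return[of r "?st (\<sigma> r)" b x] assms by simp
  qed
  ultimately show ?thesis
    unfolding pop_def by (intro exec_Seq[OF exec_clear] exec_Seq)
qed

lemma exec_copy:
  assumes "r \<noteq> Head" "r \<noteq> Tmp" "c \<noteq> Head" "c \<noteq> Tmp" "c \<noteq> r" "\<sigma> Tmp = 0" "\<sigma> r \<le> b"
  shows "exec x b (copy r c) \<sigma> (\<sigma>(c := \<sigma> r))"
proof -
  let ?st = "\<lambda>j. \<sigma>(r := \<sigma> r - j, c := j, Tmp := j)"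
  have "exec x b (While r (Dec r ;; Inc c ;; Inc Tmp)) (?st 0) (?st (\<sigma> r))"
  proof (rule exec_loop)
    fix j assume j: "j < \<sigma> r"
    let ?\<sigma> = "(?st j)(r := \<sigma> r - Suc j)"
    have "exec x b (Dec r) (?st j) ?\<sigma>"
      using exec_Dec[of "?st j" r x b] j assms by simp
    moreover have "exec x b (Inc c) ?\<sigma> (?\<sigma>(c := Suc j))"
      using exec_Inc[of ?\<sigma> c x b] j assms by (simp add: capacity_def)
    moreover have "exec x b (Inc Tmp) (?\<sigma>(c := Suc j)) (?\<sigma>(c := Suc j, Tmp := Suc j))"
      using exec_Inc[of "?\<sigma>(c := Suc j)" Tmp x b] j assms by (simp add: capacity_def)
    moreover have "?\<sigma>(c := Suc j, Tmp := Suc j) = ?st (Suc j)"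
      using assms by (auto simp: fun_eq_iff)
    ultimately show "?st j r \<noteq> 0 \<and> exec x b (Dec r ;; Inc c ;; Inc Tmp) (?st j) (?st (Suc j))"
      using j exec_Seq assms by (metis (no_types, lifting) fun_upd_apply zero_less_diff less_numeral_extra(3))
  qed (use assms in simp)
  moreover have "?st 0 = \<sigma>(c := 0)"
    using assms by (auto simp: fun_eq_iff)
  ultimately have "exec x b (While r (Dec r ;; Inc c ;; Inc Tmp)) (\<sigma>(c := 0)) (?st (\<sigma> r))"
    by simp
  moreover have "exec x b (While Tmp (Dec Tmp ;; Inc r)) (?st (\<sigma> r)) (\<sigma>(c := \<sigma> r))"
  proof -
    have "(?st (\<sigma> r))(r := \<sigma> r, Tmp := 0) = \<sigma>(c := \<sigma> r)"
      using assms by (auto simp: fun_eq_iff)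
    then show ?thesis
      using exec_return[of r "?st (\<sigma> r)" b x] assms by simp
  qed
  ultimately show ?thesis
    unfolding copy_def by (intro exec_Seq[OF exec_clear] exec_Seq)
qed

text \<open>The closing \<open>Fail\<close> is a branch without surviving computations, so the list
  of alternatives is counted exactly.\<close>

primrec chooses :: "cmd list \<Rightarrow> cmd" where
  "chooses [] = Fail"
| "chooses (c # cs) = Choose c (chooses cs)"

lemma run_chooses:
  assumes "\<And>a. a \<in> set as \<Longrightarrow> run x b Q (P a # cs) \<sigma> (k a)"
  shows "run x b Q (chooses (map P as) # cs) \<sigma> (\<Sum>a\<leftarrow>as. k a)"
  using assms by (induction as) (auto intro: run_Choose run_Fail)

section \<open>Simulation of Turing machines\<close>

text \<open>
  A tape is stored as the symbol under the head and two stacks, the parts of the tape to the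
  left and to the right of the head, written as numbers in base \<open>S\<close>.
\<close>

primrec stack :: "nat \<Rightarrow> nat list \<Rightarrow> nat" where
  "stack S [] = 0"
| "stack S (v # vs) = v + S * stack S vs"

lemma stack_less: "\<forall>v \<in> set vs. v < S \<Longrightarrow> stack S vs < S ^ length vs"
proof (induction vs)
  case (Cons v vs)
  have "stack S vs < S ^ length vs" by (rule Cons.IH) (use Cons.prems in simp)
  then have "stack S vs + 1 \<le> S ^ length vs" "v < S" using Cons.prems by auto
  then have "v + S * stack S vs < S + S * stack S vs" "S * (stack S vs + 1) \<le> S * S ^ length vs"
    using mult_le_mono2[of "stack S vs + 1" "S ^ length vs" S] by simp_all
  then have "v + S * stack S vs < S * S ^ length vs" by simp
  then show ?case by simp
qed simp

section \<open>A work tape as two stacks\<close>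

definition tape_regs :: "nat \<Rightarrow> nat \<Rightarrow> reg set" where
  "tape_regs m j = {Pos m j, Cur m j, LS m j, RS m j}"

text \<open>The cell next to the head is the top of the left stack, hence the reversal. Trailing
  blanks are zero digits and do not change the number, so a program can work on the right stack
  without knowing \<open>s\<close>. The position is kept as well because a left stack of value
  \<open>0\<close> may still contain blanks and would not reveal cell \<open>0\<close>.\<close>

definition tape_rep :: "nat \<Rightarrow> nat \<Rightarrow> nat \<Rightarrow> nat \<Rightarrow> store \<Rightarrow> (nat \<Rightarrow> nat) \<times> nat \<Rightarrow> bool" where
  "tape_rep m j S s \<sigma> = (\<lambda>(t, h). h < s \<and> (\<forall>i. t i < S) \<and> \<sigma> (Pos m j) = h \<and> \<sigma> (Cur m j) = t h \<and>
     \<sigma> (LS m j) = stack S (rev (map t [0..<h])) \<and> \<sigma> (RS m j) = stack S (map t [Suc h..<s]))"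

lemma tape_rep_cong:
  "(\<And>r. r \<in> tape_regs m j \<Longrightarrow> \<sigma>' r = \<sigma> r) \<Longrightarrow> tape_rep m j S s \<sigma>' = tape_rep m j S s \<sigma>"
  by (simp add: tape_rep_def tape_regs_def)

definition tape_move :: "nat \<Rightarrow> nat \<Rightarrow> nat \<Rightarrow> dir \<Rightarrow> cmd" where
  "tape_move m j S d = (case d of
     Lft \<Rightarrow> IfZ (Pos m j) Skip
       (push S (RS m j) (Cur m j) ;; pop S (LS m j) (Cur m j) ;; Dec (Pos m j))
   | Stay \<Rightarrow> Skip
   | Rgt \<Rightarrow> push S (LS m j) (Cur m j) ;; pop S (RS m j) (Cur m j) ;; Inc (Pos m j))"

text \<open>The scanned symbol is included because a head move pushes it before it pops the opposite
  stack. At most \<open>s\<close> digits in base \<open>S\<close> are involved.\<close>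

lemma tape_rep_bounds:
  assumes "tape_rep m j S s \<sigma> (t, h)" "S ^ s \<le> b"
  shows "stack S (rev (map t [0..<Suc h])) \<le> b" "stack S (map t [h..<s]) \<le> b"
proof -
  have less: "\<forall>i. t i < S" and h: "h < s" and S: "0 < S"
    using assms(1) by (auto simp: tape_rep_def intro: le_less_trans)
  have pow: "S ^ n \<le> b" if "n \<le> s" for n
    using power_increasing[of n s S] that S assms(2) by linarith
  have "stack S (rev (map t [0..<Suc h])) < S ^ Suc h"
    using stack_less[of "rev (map t [0..<Suc h])" S] less by auto
  then show "stack S (rev (map t [0..<Suc h])) \<le> b" using pow[of "Suc h"] h by linarith
  have "stack S (map t [h..<s]) < S ^ (s - h)"
    using stack_less[of "map t [h..<s]" S] less by auto
  then show "stack S (map t [h..<s]) \<le> b" using pow[of "s - h"] by linarith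
qed

lemma exec_tape_move:
  assumes rep: "tape_rep m j S s \<sigma> (t, h)" and "move d h < s"
    and b: "S ^ s \<le> b" "S \<le> b" "s \<le> b" and Tmp: "\<sigma> Tmp = 0"
  shows "\<exists>\<sigma>'. exec x b (tape_move m j S d) \<sigma> \<sigma>' \<and> tape_rep m j S s \<sigma>' (t, move d h) \<and>
    (\<forall>r. r \<notin> tape_regs m j \<longrightarrow> \<sigma>' r = \<sigma> r)"
proof -
  note bounds = tape_rep_bounds[OF rep b(1)]
  have less: "\<And>i. t i < S" and h: "h < s" and S: "0 < S"
    and \<sigma>: "\<sigma> (Pos m j) = h" "\<sigma> (Cur m j) = t h"
      "\<sigma> (LS m j) = stack S (rev (map t [0..<h]))" "\<sigma> (RS m j) = stack S (map t [Suc h..<s])"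
    using rep by (auto simp: tape_rep_def intro: le_less_trans)
  show ?thesis
  proof (cases d)
    case Stay
    then show ?thesis using rep by (auto simp: tape_move_def intro!: exI[of _ \<sigma>] exec_Skip)
  next
    case Rgt
    let ?L = "stack S (rev (map t [0..<Suc h]))" and ?R = "stack S (map t [Suc (Suc h)..<s])"
    let ?\<sigma>1 = "\<sigma>(LS m j := ?L)"
    let ?\<sigma>2 = "?\<sigma>1(RS m j := ?R, Cur m j := t (Suc h))"
    let ?\<sigma>3 = "?\<sigma>2(Pos m j := Suc h)"
    have L: "?L = \<sigma> (LS m j) * S + \<sigma> (Cur m j)" using \<sigma> by simp
    have "exec x b (push S (LS m j) (Cur m j)) \<sigma> ?\<sigma>1"
      unfolding L by (rule exec_push) (use \<sigma> less Tmp bounds(1) L in \<open>auto simp: algebra_simps\<close>)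
    moreover have "exec x b (pop S (RS m j) (Cur m j)) ?\<sigma>1 ?\<sigma>2"
    proof -
      have R: "\<sigma> (RS m j) = t (Suc h) + S * ?R"
        using \<sigma> assms(2) Rgt by (simp add: upt_conv_Cons)
      have "stack S (map t [h..<s]) = t h + S * \<sigma> (RS m j)"
        using \<sigma> h by (simp add: upt_conv_Cons)
      moreover have "\<sigma> (RS m j) \<le> S * \<sigma> (RS m j)" using S by simp
      ultimately have "\<sigma> (RS m j) \<le> b" using bounds(2) by linarith
      moreover have "?\<sigma>1 (RS m j) div S = ?R" "?\<sigma>1 (RS m j) mod S = t (Suc h)"
        using R less S by simp_all
      ultimately show ?thesis
        using exec_pop[of "RS m j" "Cur m j" ?\<sigma>1 S b x] Tmp S b by simp
    qed
    moreover have "exec x b (Inc (Pos m j)) ?\<sigma>2 ?\<sigma>3"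
      using exec_Inc[of ?\<sigma>2 "Pos m j" x b] \<sigma> h b by (simp add: capacity_def)
    ultimately have "exec x b (push S (LS m j) (Cur m j) ;; pop S (RS m j) (Cur m j) ;; Inc (Pos m j)) \<sigma> ?\<sigma>3"
      by (rule exec_Seq[OF _ exec_Seq])
    then have "exec x b (tape_move m j S d) \<sigma> ?\<sigma>3"
      using Rgt by (simp add: tape_move_def)
    moreover have "tape_rep m j S s ?\<sigma>3 (t, move d h)"
      using less assms(2) Rgt by (simp add: tape_rep_def)
    moreover have "\<forall>r. r \<notin> tape_regs m j \<longrightarrow> ?\<sigma>3 r = \<sigma> r" by (simp add: tape_regs_def)
    ultimately show ?thesis by blast
  next
    case Lft
    show ?thesis
    proof (cases h)
      case 0
      then have "exec x b (tape_move m j S d) \<sigma> \<sigma>"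
        using Lft \<sigma> by (simp add: tape_move_def exec_IfZ exec_Skip)
      then show ?thesis using rep 0 Lft by auto
    next
      case (Suc h')
      let ?R = "stack S (map t [h..<s])" and ?L = "stack S (rev (map t [0..<h']))"
      let ?\<sigma>1 = "\<sigma>(RS m j := ?R)"
      let ?\<sigma>2 = "?\<sigma>1(LS m j := ?L, Cur m j := t h')"
      let ?\<sigma>3 = "?\<sigma>2(Pos m j := h')"
      have R: "?R = \<sigma> (RS m j) * S + \<sigma> (Cur m j)"
        using \<sigma> h by (simp add: upt_conv_Cons)
      have "exec x b (push S (RS m j) (Cur m j)) \<sigma> ?\<sigma>1"
        unfolding R by (rule exec_push) (use \<sigma> less Tmp bounds(2) R in \<open>auto simp: algebra_simps\<close>)
      moreover have "exec x b (pop S (LS m j) (Cur m j)) ?\<sigma>1 ?\<sigma>2"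
      proof -
        have L: "\<sigma> (LS m j) = t h' + S * ?L"
          using \<sigma> Suc by simp
        have "stack S (rev (map t [0..<Suc h])) = t h + S * \<sigma> (LS m j)"
          using \<sigma> by simp
        moreover have "\<sigma> (LS m j) \<le> S * \<sigma> (LS m j)" using S by simp
        ultimately have "\<sigma> (LS m j) \<le> b" using bounds(1) by linarith
        moreover have "?\<sigma>1 (LS m j) div S = ?L" "?\<sigma>1 (LS m j) mod S = t h'"
          using L less S by simp_all
        ultimately show ?thesis
          using exec_pop[of "LS m j" "Cur m j" ?\<sigma>1 S b x] Tmp S b by simp
      qed
      moreover have "exec x b (Dec (Pos m j)) ?\<sigma>2 ?\<sigma>3"
        using exec_Dec[of ?\<sigma>2 "Pos m j" x b] \<sigma> Suc by simp
      ultimately have "exec x b (push S (RS m j) (Cur m j) ;; pop S (LS m j) (Cur m j) ;; Dec (Pos m j)) \<sigma> ?\<sigma>3"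
        by (rule exec_Seq[OF _ exec_Seq])
      then have "exec x b (tape_move m j S d) \<sigma> ?\<sigma>3"
        using Lft \<sigma> Suc by (simp add: tape_move_def exec_IfZ)
      moreover have "tape_rep m j S s ?\<sigma>3 (t, move d h)"
        using less h Lft Suc by (simp add: tape_rep_def)
      moreover have "\<forall>r. r \<notin> tape_regs m j \<longrightarrow> ?\<sigma>3 r = \<sigma> r" by (simp add: tape_regs_def)
      ultimately show ?thesis by blast
    qed
  qed
qed

section \<open>Acting on all work tapes\<close>

definition tape_write :: "nat \<Rightarrow> nat \<Rightarrow> nat \<Rightarrow> nat \<times> dir \<Rightarrow> cmd" where
  "tape_write m j S = (\<lambda>(v, d). assign (Cur m j) v ;; tape_move m j S d)"

text \<open>Neither stack contains the scanned cell, so writing only replaces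
  \<open>Cur\<close>.\<close>

lemma exec_tape_write:
  assumes rep: "tape_rep m j S s \<sigma> th" and "snd (update_tape vd th) < s" and v: "fst vd < S"
    and b: "S ^ s \<le> b" "S \<le> b" "s \<le> b" and Tmp: "\<sigma> Tmp = 0"
  shows "\<exists>\<sigma>'. exec x b (tape_write m j S vd) \<sigma> \<sigma>' \<and> tape_rep m j S s \<sigma>' (update_tape vd th) \<and>
    (\<forall>r. r \<notin> tape_regs m j \<longrightarrow> \<sigma>' r = \<sigma> r)"
proof -
  obtain v d t h where vd: "vd = (v, d)" and th: "th = (t, h)" by fastforce
  let ?\<sigma> = "\<sigma>(Cur m j := v)"
  have "map (t(h := v)) [0..<h] = map t [0..<h]" "map (t(h := v)) [Suc h..<s] = map t [Suc h..<s]"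
    by auto
  then have "tape_rep m j S s ?\<sigma> (t(h := v), h)"
    using rep v vd unfolding th tape_rep_def by simp
  from exec_tape_move[OF this _ b, of d x]
  obtain \<sigma>' where \<sigma>': "exec x b (tape_move m j S d) ?\<sigma> \<sigma>'"
      "tape_rep m j S s \<sigma>' (t(h := v), move d h)" "\<forall>r. r \<notin> tape_regs m j \<longrightarrow> \<sigma>' r = ?\<sigma> r"
    using assms(2) vd th Tmp by auto
  have "exec x b (tape_write m j S vd) \<sigma> \<sigma>'"
    using exec_Seq[OF exec_assign \<sigma>'(1)] v vd b by (simp add: tape_write_def)
  then show ?thesis using \<sigma>'(2,3) vd th by (auto simp: tape_regs_def)
qed

primrec tape_writes :: "nat \<Rightarrow> nat \<Rightarrow> nat \<Rightarrow> (nat \<times> dir) list \<Rightarrow> cmd" where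
  "tape_writes m j S [] = Skip"
| "tape_writes m j S (vd # ws) = tape_write m j S vd ;; tape_writes m (Suc j) S ws"

lemma tape_regs_disjoint: "r \<in> tape_regs m i \<Longrightarrow> r \<in> tape_regs m j \<Longrightarrow> i = j"
  by (auto simp: tape_regs_def)

lemma Tmp_tape_regs [simp]: "Tmp \<notin> tape_regs m j"
  by (simp add: tape_regs_def)

text \<open>Different tapes own disjoint registers, so they can be updated one after the other
  without disturbing each other. The first index \<open>j\<close> is general for the
  induction.\<close>

lemma exec_tape_writes:
  assumes "length ws = length ts" "\<And>i. i < length ts \<Longrightarrow> tape_rep m (j + i) S s \<sigma> (ts ! i)"
    and "\<And>i. i < length ts \<Longrightarrow> snd (update_tape (ws ! i) (ts ! i)) < s"
    and "\<And>i. i < length ts \<Longrightarrow> fst (ws ! i) < S"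
    and b: "S ^ s \<le> b" "S \<le> b" "s \<le> b" and "\<sigma> Tmp = 0"
  shows "\<exists>\<sigma>'. exec x b (tape_writes m j S ws) \<sigma> \<sigma>' \<and>
    (\<forall>i < length ts. tape_rep m (j + i) S s \<sigma>' (update_tape (ws ! i) (ts ! i))) \<and>
    (\<forall>r. (\<forall>i \<ge> j. r \<notin> tape_regs m i) \<longrightarrow> \<sigma>' r = \<sigma> r)"
  using assms(1-4,8)
proof (induction ws arbitrary: ts j \<sigma>)
  case Nil
  then show ?case by (auto intro!: exI[of _ \<sigma>] exec_Skip)
next
  case (Cons vd ws)
  obtain th ts' where ts: "ts = th # ts'" using Cons.prems(1) by (cases ts) auto
  obtain \<sigma>1 where \<sigma>1: "exec x b (tape_write m j S vd) \<sigma> \<sigma>1" "tape_rep m j S s \<sigma>1 (update_tape vd th)"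
      "\<forall>r. r \<notin> tape_regs m j \<longrightarrow> \<sigma>1 r = \<sigma> r"
    using exec_tape_write[OF _ _ _ b, of m j \<sigma> th vd x]
      Cons.prems(2)[of 0] Cons.prems(3)[of 0] Cons.prems(4)[of 0] Cons.prems(5) ts by auto
  have rep: "tape_rep m (Suc j + i) S s \<sigma>1 (ts' ! i)" if "i < length ts'" for i
  proof -
    have "tape_rep m (Suc j + i) S s \<sigma>1 = tape_rep m (Suc j + i) S s \<sigma>"
      by (rule tape_rep_cong) (use \<sigma>1(3) tape_regs_disjoint[of _ m "Suc j + i" j] in force)
    then show ?thesis using Cons.prems(2)[of "Suc i"] that ts by simp
  qed
  obtain \<sigma>2 where \<sigma>2: "exec x b (tape_writes m (Suc j) S ws) \<sigma>1 \<sigma>2"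
      "\<forall>i < length ts'. tape_rep m (Suc j + i) S s \<sigma>2 (update_tape (ws ! i) (ts' ! i))"
      "\<forall>r. (\<forall>i \<ge> Suc j. r \<notin> tape_regs m i) \<longrightarrow> \<sigma>2 r = \<sigma>1 r"
  proof -
    have "\<exists>\<sigma>'. exec x b (tape_writes m (Suc j) S ws) \<sigma>1 \<sigma>' \<and>
      (\<forall>i < length ts'. tape_rep m (Suc j + i) S s \<sigma>' (update_tape (ws ! i) (ts' ! i))) \<and>
      (\<forall>r. (\<forall>i \<ge> Suc j. r \<notin> tape_regs m i) \<longrightarrow> \<sigma>' r = \<sigma>1 r)"
    proof (rule Cons.IH[OF _ rep])
      show "snd (update_tape (ws ! i) (ts' ! i)) < s" "fst (ws ! i) < S" if "i < length ts'" for i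
        using Cons.prems(3,4)[of "Suc i"] that ts by auto
    qed (use Cons.prems \<sigma>1(3) ts in auto)
    then show ?thesis using that by blast
  qed
  have "\<sigma>2 r = \<sigma>1 r" if "r \<in> tape_regs m j" for r
  proof -
    have "\<forall>i \<ge> Suc j. r \<notin> tape_regs m i"
      using tape_regs_disjoint[OF that] by force
    then show ?thesis using \<sigma>2(3) by blast
  qed
  then have "tape_rep m j S s \<sigma>2 = tape_rep m j S s \<sigma>1"
    by (rule tape_rep_cong)
  then have "\<forall>i < length ts. tape_rep m (j + i) S s \<sigma>2 (update_tape ((vd # ws) ! i) (ts ! i))"
    using \<sigma>1(2) \<sigma>2(2) ts by (auto simp: less_Suc_eq_0_disj)
  moreover have "exec x b (tape_writes m j S (vd # ws)) \<sigma> \<sigma>2"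
    using exec_Seq[OF \<sigma>1(1) \<sigma>2(1)] by simp
  moreover have "\<forall>r. (\<forall>i \<ge> j. r \<notin> tape_regs m i) \<longrightarrow> \<sigma>2 r = \<sigma> r"
    using \<sigma>1(3) \<sigma>2(3) by simp
  ultimately show ?case by blast
qed

text \<open>Nested switches unfold the transition table into the program text: \<open>P\<close> is
  applied to every possible list of scanned symbols when the program is built, not when it
  runs.\<close>

primrec with_symbols :: "nat \<Rightarrow> nat \<Rightarrow> nat \<Rightarrow> nat \<Rightarrow> (nat list \<Rightarrow> cmd) \<Rightarrow> cmd" where
  "with_symbols m S j 0 P = P []"
| "with_symbols m S j (Suc n) P =
     switch (Cur m j) S (\<lambda>v. with_symbols m S (Suc j) n (\<lambda>vs. P (v # vs)))"

lemma run_with_symbols: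
  assumes "\<And>i. i < n \<Longrightarrow> \<sigma> (Cur m (j + i)) < S" "S \<le> b"
    and "run x b Q (P (map (\<lambda>i. \<sigma> (Cur m i)) [j..<j + n]) # cs) \<sigma> N"
  shows "run x b Q (with_symbols m S j n P # cs) \<sigma> N"
  using assms
proof (induction n arbitrary: j P)
  case (Suc n)
  have "run x b Q (with_symbols m S (Suc j) n (\<lambda>vs. P (\<sigma> (Cur m j) # vs)) # cs) \<sigma> N"
  proof (rule Suc.IH)
    show "\<sigma> (Cur m (Suc j + i)) < S" if "i < n" for i
      using Suc.prems(1)[of "Suc i"] that by simp
  qed (use Suc.prems in \<open>simp_all add: upt_conv_Cons del: upt_Suc\<close>)
  then show ?case
    using Suc.prems(1)[of 0] Suc.prems(2) by (auto intro!: run_switch)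
qed simp

text \<open>\<open>perform\<close> clips a move beyond an end marker. Here the scanned cell
  \<open>c\<close> tells when that happens, so \<open>fwd\<close> and \<open>bwd\<close> are invoked
  only inside the permitted range.\<close>

definition do_action ::
  "nat \<Rightarrow> nat \<Rightarrow> cmd \<Rightarrow> cmd \<Rightarrow> (bool \<Rightarrow> cmd) \<Rightarrow> 'a cell \<Rightarrow> action \<Rightarrow> cmd" where
  "do_action m S fwd bwd out c a =
     assign (St m) (target a) ;;
     (case input_move a of
        Lft \<Rightarrow> if c = LeftEnd then Skip else bwd
      | Stay \<Rightarrow> Skip
      | Rgt \<Rightarrow> if c = RightEnd then Skip else fwd) ;;
     tape_writes m 0 S (work a) ;;
     (case emit a of None \<Rightarrow> Skip | Some d \<Rightarrow> out d)"

section \<open>One step of the simulated machine\<close>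

definition listing :: "'b set \<Rightarrow> 'b list" where
  "listing A = (SOME xs. set xs = A \<and> distinct xs)"

lemma listing: "finite A \<Longrightarrow> set (listing A) = A" "finite A \<Longrightarrow> distinct (listing A)"
  using someI_ex[OF finite_distinct_list[of A]] by (auto simp: listing_def)

text \<open>
  The simulated machine reads its input through \<open>rd\<close>, which passes the current cell to its
  continuation; \<open>fwd\<close> and \<open>bwd\<close> move the simulated input head and \<open>out\<close> consumes an output bit.
\<close>

definition sim_step ::
  "'a tm \<Rightarrow> nat \<Rightarrow> (('a cell \<Rightarrow> cmd) \<Rightarrow> cmd) \<Rightarrow> cmd \<Rightarrow> cmd \<Rightarrow> (bool \<Rightarrow> cmd) \<Rightarrow> cmd" where
  "sim_step M m rd fwd bwd out =
     rd (\<lambda>c. switch (St m) (num_states M) (\<lambda>q.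
       with_symbols m (num_symbols M) 0 (num_tapes M) (\<lambda>ss.
         if delta M q c ss = {} then Dec (Go m)
         else chooses (map (do_action m (num_symbols M) fwd bwd out c) (listing (delta M q c ss))))))"

definition check :: "'a tm \<Rightarrow> nat \<Rightarrow> cmd" where
  "check M m = switch (St m) (num_states M) (\<lambda>q. if q \<in> accepting M then Skip else Fail)"

fun own :: "nat \<Rightarrow> reg \<Rightarrow> bool" where
  "own m (St k) \<longleftrightarrow> k = m"
| "own m (Go k) \<longleftrightarrow> k = m"
| "own m (Pos k j) \<longleftrightarrow> k = m"
| "own m (Cur k j) \<longleftrightarrow> k = m"
| "own m (LS k j) \<longleftrightarrow> k = m"
| "own m (RS k j) \<longleftrightarrow> k = m"
| "own m r \<longleftrightarrow> False"

lemma own_tape_regs: "r \<in> tape_regs m j \<Longrightarrow> own m r"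
  by (auto simp: tape_regs_def)

text \<open>
  \<open>Inv v zs \<sigma>\<close> says that \<open>\<sigma>\<close> encodes position \<open>v\<close> of the simulated input head on the virtual
  input \<open>w\<close>, and the output \<open>zs\<close> produced so far, which is a prefix of \<open>y\<close>.
\<close>

locale simulation =
  fixes x :: "bool list" and b :: nat and M :: "'a tm" and m :: nat and w :: "'a list"
    and s :: nat and rd :: "('a cell \<Rightarrow> cmd) \<Rightarrow> cmd" and fwd bwd :: cmd and out :: "bool \<Rightarrow> cmd"
    and y :: "bool list" and Inv :: "nat \<Rightarrow> bool list \<Rightarrow> store \<Rightarrow> bool"
  assumes wf: "wf_tm M"
    and b: "num_symbols M ^ s \<le> b" "num_symbols M \<le> b" "s \<le> b" "num_states M \<le> b"
    and Inv_own: "Inv v zs \<sigma> \<Longrightarrow> (\<And>r. \<not> own m r \<Longrightarrow> \<sigma>' r = \<sigma> r) \<Longrightarrow> Inv v zs \<sigma>'"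
    and Inv_Tmp: "Inv v zs \<sigma> \<Longrightarrow> \<sigma> Tmp = 0"
    and rd: "Inv v zs \<sigma> \<Longrightarrow> v \<le> length w + 1 \<Longrightarrow>
      \<exists>\<sigma>'. Inv v zs \<sigma>' \<and> (\<forall>r. own m r \<longrightarrow> \<sigma>' r = \<sigma> r) \<and>
        (\<forall>P Q cs N. run x b Q (P (input_cell w v) # cs) \<sigma>' N \<longrightarrow> run x b Q (rd P # cs) \<sigma> N)"
    and fwd: "Inv v zs \<sigma> \<Longrightarrow> v \<le> length w \<Longrightarrow>
      \<exists>\<sigma>'. exec x b fwd \<sigma> \<sigma>' \<and> Inv (Suc v) zs \<sigma>' \<and> (\<forall>r. own m r \<longrightarrow> \<sigma>' r = \<sigma> r)"
    and bwd: "Inv (Suc v) zs \<sigma> \<Longrightarrow> v \<le> length w \<Longrightarrow>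
      \<exists>\<sigma>'. exec x b bwd \<sigma> \<sigma>' \<and> Inv v zs \<sigma>' \<and> (\<forall>r. own m r \<longrightarrow> \<sigma>' r = \<sigma> r)"
    and out: "Inv v zs \<sigma> \<Longrightarrow> y = zs @ d # ys \<Longrightarrow>
      \<exists>\<sigma>'. exec x b (out d) \<sigma> \<sigma>' \<and> Inv v (zs @ [d]) \<sigma>' \<and> (\<forall>r. own m r \<longrightarrow> \<sigma>' r = \<sigma> r)"
begin

abbreviation "S \<equiv> num_symbols M"
abbreviation "step \<equiv> sim_step M m rd fwd bwd out"

definition rep :: "config \<Rightarrow> bool list \<Rightarrow> store \<Rightarrow> bool" where
  "rep c zs \<sigma> \<longleftrightarrow> wf_config M c \<and> input_pos c \<le> length w + 1 \<and> \<sigma> (St m) = state c \<and>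
     (\<forall>j < num_tapes M. tape_rep m j S s \<sigma> (tapes c ! j)) \<and> Inv (input_pos c) zs \<sigma>"

definition emitted :: "action \<Rightarrow> bool list" where
  "emitted a = (case emit a of None \<Rightarrow> [] | Some d \<Rightarrow> [d])"

lemma rep_Inv_change:
  assumes "rep c zs \<sigma>" "\<forall>r. own m r \<longrightarrow> \<sigma>' r = \<sigma> r"
  shows "\<sigma>' (St m) = state c" "\<sigma>' (Go m) = \<sigma> (Go m)"
    "\<And>j. j < num_tapes M \<Longrightarrow> tape_rep m j S s \<sigma>' (tapes c ! j)"
proof -
  show "\<sigma>' (St m) = state c" "\<sigma>' (Go m) = \<sigma> (Go m)"
    using assms by (auto simp: rep_def)
  have "tape_rep m j S s \<sigma>' = tape_rep m j S s \<sigma>" for j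
    by (rule tape_rep_cong) (use assms(2) own_tape_regs in blast)
  then show "\<And>j. j < num_tapes M \<Longrightarrow> tape_rep m j S s \<sigma>' (tapes c ! j)"
    using assms(1) by (simp add: rep_def)
qed

lemma exec_input_move:
  assumes "Inv v zs \<sigma>" "v \<le> length w + 1"
  shows "\<exists>\<sigma>'. exec x b (case d of
        Lft \<Rightarrow> if input_cell w v = LeftEnd then Skip else bwd
      | Stay \<Rightarrow> Skip
      | Rgt \<Rightarrow> if input_cell w v = RightEnd then Skip else fwd) \<sigma> \<sigma>' \<and>
    Inv (min (move d v) (length w + 1)) zs \<sigma>' \<and> (\<forall>r. own m r \<longrightarrow> \<sigma>' r = \<sigma> r)"
proof (cases d)
  case Lft
  show ?thesis
  proof (cases v)
    case 0
    then show ?thesis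
      using Lft assms by (auto simp: input_cell_def intro!: exI[of _ \<sigma>] exec_Skip)
  next
    case (Suc v')
    then show ?thesis
      using Lft assms bwd[of v' zs \<sigma>] by (auto simp: input_cell_def min_absorb1)
  qed
next
  case Stay
  then show ?thesis using assms by (auto simp: min_absorb1 intro!: exI[of _ \<sigma>] exec_Skip)
next
  case Rgt
  show ?thesis
  proof (cases "v \<le> length w")
    case True
    then show ?thesis
      using Rgt assms fwd[of v zs \<sigma>] by (auto simp: input_cell_def min_absorb1)
  next
    case False
    then have "v = length w + 1" using assms by simp
    then show ?thesis
      using Rgt assms by (auto simp: input_cell_def intro!: exI[of _ \<sigma>] exec_Skip)
  qed
qed

lemma exec_do_action:
  assumes rep: "rep c zs \<sigma>" and a: "a \<in> actions M w c"
    and heads: "head_bound s (perform w a c)" and y: "y = zs @ emitted a @ ys"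
  shows "\<exists>\<sigma>'. exec x b (do_action m S fwd bwd out (input_cell w (input_pos c)) a) \<sigma> \<sigma>' \<and>
    rep (perform w a c) (zs @ emitted a) \<sigma>' \<and> \<sigma>' (Go m) = \<sigma> (Go m)"
proof -
  have wfc: "wf_config M c" and pos: "input_pos c \<le> length w + 1" and Inv: "Inv (input_pos c) zs \<sigma>"
    using rep by (simp_all add: rep_def)
  note D = wf_tm_actionD[OF wf wfc a]
  have len: "length (work a) = length (tapes c)" "length (tapes c) = num_tapes M"
    using D wfc by (simp_all add: wf_config_def)
  let ?\<sigma>1 = "\<sigma>(St m := target a)"
  have e1: "exec x b (assign (St m) (target a)) \<sigma> ?\<sigma>1"
    using D b by (intro exec_assign) auto
  have Inv1: "Inv (input_pos c) zs ?\<sigma>1"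
    by (rule Inv_own[OF Inv]) auto
  have rep1: "tape_rep m j S s ?\<sigma>1 (tapes c ! j)" if "j < num_tapes M" for j
  proof -
    have "tape_rep m j S s ?\<sigma>1 = tape_rep m j S s \<sigma>"
      by (rule tape_rep_cong) (auto simp: tape_regs_def)
    then show ?thesis using rep that by (simp add: rep_def)
  qed
  obtain \<sigma>2 where \<sigma>2: "exec x b (case input_move a of
        Lft \<Rightarrow> if input_cell w (input_pos c) = LeftEnd then Skip else bwd
      | Stay \<Rightarrow> Skip
      | Rgt \<Rightarrow> if input_cell w (input_pos c) = RightEnd then Skip else fwd) ?\<sigma>1 \<sigma>2"
      "Inv (min (move (input_move a) (input_pos c)) (length w + 1)) zs \<sigma>2"
      "\<And>r. own m r \<Longrightarrow> \<sigma>2 r = ?\<sigma>1 r"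
    using exec_input_move[OF Inv1 pos, of "input_move a"] by auto
  have rep2: "tape_rep m (0 + j) S s \<sigma>2 (tapes c ! j)" if "j < length (tapes c)" for j
  proof -
    have "tape_rep m j S s \<sigma>2 = tape_rep m j S s ?\<sigma>1"
      by (rule tape_rep_cong) (use \<sigma>2(3) own_tape_regs in blast)
    then show ?thesis using rep1 that len by simp
  qed
  have upd: "snd (update_tape (work a ! i) (tapes c ! i)) < s" if "i < length (tapes c)" for i
  proof -
    have "update_tape (work a ! i) (tapes c ! i) = map2 update_tape (work a) (tapes c) ! i"
      using that len by simp
    also have "\<dots> \<in> set (map2 update_tape (work a) (tapes c))"
      using that len by (intro nth_mem) simp
    finally show ?thesis
      using heads by (auto simp: head_bound_def perform_def split: prod.splits)
  qed
  obtain \<sigma>3 where \<sigma>3: "exec x b (tape_writes m 0 S (work a)) \<sigma>2 \<sigma>3"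
      "\<forall>i < length (tapes c). tape_rep m (0 + i) S s \<sigma>3 (update_tape (work a ! i) (tapes c ! i))"
      "\<forall>r. (\<forall>i \<ge> 0. r \<notin> tape_regs m i) \<longrightarrow> \<sigma>3 r = \<sigma>2 r"
    using exec_tape_writes[OF len(1) rep2 upd _ b(1-3) Inv_Tmp[OF \<sigma>2(2)], of x] D(3) len
    by auto
  have Inv3: "Inv (min (move (input_move a) (input_pos c)) (length w + 1)) zs \<sigma>3"
    by (rule Inv_own[OF \<sigma>2(2)]) (use \<sigma>3(3) own_tape_regs in blast)
  obtain \<sigma>4 where \<sigma>4: "exec x b (case emit a of None \<Rightarrow> Skip | Some d \<Rightarrow> out d) \<sigma>3 \<sigma>4"
      "Inv (min (move (input_move a) (input_pos c)) (length w + 1)) (zs @ emitted a) \<sigma>4"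
      "\<And>r. own m r \<Longrightarrow> \<sigma>4 r = \<sigma>3 r"
  proof (cases "emit a")
    case None
    then show ?thesis using that[of \<sigma>3] Inv3 by (simp add: emitted_def exec_Skip)
  next
    case (Some d)
    then show ?thesis using that out[OF Inv3, of d ys] y by (auto simp: emitted_def)
  qed
  have "exec x b (do_action m S fwd bwd out (input_cell w (input_pos c)) a) \<sigma> \<sigma>4"
    unfolding do_action_def by (intro exec_Seq[OF e1] exec_Seq[OF \<sigma>2(1)] exec_Seq[OF \<sigma>3(1)] \<sigma>4(1))
  moreover have "\<sigma>4 (St m) = target a" "\<sigma>4 (Go m) = \<sigma> (Go m)"
    using \<sigma>4(3) \<sigma>3(3) \<sigma>2(3) by (simp_all add: tape_regs_def)
  moreover have "tape_rep m j S s \<sigma>4 (tapes (perform w a c) ! j)" if "j < num_tapes M" for j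
  proof -
    have "tape_rep m j S s \<sigma>4 = tape_rep m j S s \<sigma>3"
      by (rule tape_rep_cong) (use \<sigma>4(3) own_tape_regs in blast)
    then show ?thesis using \<sigma>3(2) that len by (simp add: perform_def)
  qed
  ultimately show ?thesis
    using \<sigma>4(2) wf_config_perform[OF wf wfc a] by (auto simp: rep_def perform_def)
qed

text \<open>Reading a cell may involve an entire recomputation, hence a new store. The registers
  owned by the simulated machine survive it, so the switches still see the encoded state and
  symbols.\<close>

lemma run_step:
  assumes rep: "rep c zs \<sigma>"
  shows "\<exists>\<sigma>'. rep c zs \<sigma>' \<and> \<sigma>' (Go m) = \<sigma> (Go m) \<and>
    (\<forall>Q cs N. run x b Q ((if actions M w c = {} then Dec (Go m)
        else chooses (map (do_action m S fwd bwd out (input_cell w (input_pos c)))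
          (listing (actions M w c)))) # cs) \<sigma>' N \<longrightarrow> run x b Q (step # cs) \<sigma> N)"
proof -
  have wfc: "wf_config M c" and pos: "input_pos c \<le> length w + 1" and Inv: "Inv (input_pos c) zs \<sigma>"
    using rep by (simp_all add: rep_def)
  obtain \<sigma>' where \<sigma>': "Inv (input_pos c) zs \<sigma>'" "\<forall>r. own m r \<longrightarrow> \<sigma>' r = \<sigma> r"
      "\<And>P Q cs N. run x b Q (P (input_cell w (input_pos c)) # cs) \<sigma>' N \<Longrightarrow> run x b Q (rd P # cs) \<sigma> N"
    using rd[OF Inv pos] by blast
  note R = rep_Inv_change[OF rep \<sigma>'(2)]
  have rep': "rep c zs \<sigma>'" using R \<sigma>'(1) wfc pos by (simp add: rep_def)
  have cur: "\<sigma>' (Cur m j) = (case tapes c ! j of (t, h) \<Rightarrow> t h)" "\<sigma>' (Cur m j) < S"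
    if "j < num_tapes M" for j
    using R(3)[OF that] by (auto simp: tape_rep_def split: prod.splits)
  have syms: "map (\<lambda>j. \<sigma>' (Cur m j)) [0..<0 + num_tapes M] = map (\<lambda>(t, h). t h) (tapes c)"
    by (rule nth_equalityI) (use wfc cur in \<open>auto simp: wf_config_def split: prod.splits\<close>)
  have acts: "actions M w c = delta M (\<sigma>' (St m)) (input_cell w (input_pos c))
      (map (\<lambda>j. \<sigma>' (Cur m j)) [0..<0 + num_tapes M])"
    unfolding syms R(1) actions_def ..
  have "run x b Q (step # cs) \<sigma> N"
    if "run x b Q ((if actions M w c = {} then Dec (Go m)
        else chooses (map (do_action m S fwd bwd out (input_cell w (input_pos c)))
          (listing (actions M w c)))) # cs) \<sigma>' N" for Q cs N
    unfolding sim_step_def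
  proof (rule \<sigma>'(3), rule run_switch, goal_cases)
    case 4
    show ?case
      by (rule run_with_symbols, use cur b in simp, rule b(2), rule that[unfolded acts])
  qed (use R(1) wfc b(4) in \<open>simp_all add: wf_config_def\<close>)
  then show ?thesis using rep' R(2) by blast
qed

lemma exec_step_halted:
  assumes "rep c zs \<sigma>" "actions M w c = {}" "\<sigma> (Go m) = 1"
  shows "\<exists>\<sigma>'. exec x b step \<sigma> \<sigma>' \<and> rep c zs \<sigma>' \<and> \<sigma>' (Go m) = 0"
proof -
  obtain \<sigma>1 where \<sigma>1: "rep c zs \<sigma>1" "\<sigma>1 (Go m) = 1"
      "\<And>Q cs N. run x b Q (Dec (Go m) # cs) \<sigma>1 N \<Longrightarrow> run x b Q (step # cs) \<sigma> N"
    using run_step[OF assms(1)] assms(2,3) by auto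
  let ?\<sigma> = "\<sigma>1(Go m := 0)"
  have "exec x b step \<sigma> ?\<sigma>"
    using \<sigma>1(2,3) run_Dec[of \<sigma>1 "Go m" x b] by (simp add: exec_def)
  moreover have "tape_rep m j S s ?\<sigma> = tape_rep m j S s \<sigma>1" for j
    by (rule tape_rep_cong) (auto simp: tape_regs_def)
  moreover have "Inv (input_pos c) zs ?\<sigma>"
    by (rule Inv_own[of _ _ \<sigma>1]) (use \<sigma>1(1) in \<open>auto simp: rep_def\<close>)
  ultimately show ?thesis
    using \<sigma>1(1) by (intro exI[of _ ?\<sigma>]) (auto simp: rep_def)
qed

text \<open>The enumeration of the actions has no repetitions, so the list sum of
  \<open>chooses\<close> is the sum over the set of actions, just as in
  \<open>counts_step\<close>.\<close>

lemma run_step_actions: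
  assumes "rep c zs \<sigma>" "actions M w c \<noteq> {}" "\<sigma> (Go m) = 1"
    and "\<And>a. a \<in> actions M w c \<Longrightarrow> head_bound s (perform w a c) \<and> (\<exists>ys. y = zs @ emitted a @ ys)"
  shows "\<exists>F. (\<forall>a \<in> actions M w c. rep (perform w a c) (zs @ emitted a) (F a) \<and> F a (Go m) = 1) \<and>
    (\<forall>Q cs k. (\<forall>a \<in> actions M w c. run x b Q cs (F a) (k a)) \<longrightarrow>
       run x b Q (step # cs) \<sigma> (\<Sum>a\<in>actions M w c. k a))"
proof -
  let ?A = "actions M w c"
  let ?P = "do_action m S fwd bwd out (input_cell w (input_pos c))"
  have fin: "finite ?A"
    using assms(1) by (intro finite_actions[OF wf]) (simp add: rep_def)
  obtain \<sigma>1 where \<sigma>1: "rep c zs \<sigma>1" "\<sigma>1 (Go m) = 1"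
      "\<And>Q cs N. run x b Q (chooses (map ?P (listing ?A)) # cs) \<sigma>1 N \<Longrightarrow> run x b Q (step # cs) \<sigma> N"
    using run_step[OF assms(1)] assms(2,3) by auto
  have "\<forall>a \<in> ?A. \<exists>\<sigma>'. exec x b (?P a) \<sigma>1 \<sigma>' \<and> rep (perform w a c) (zs @ emitted a) \<sigma>' \<and> \<sigma>' (Go m) = 1"
    using exec_do_action[OF \<sigma>1(1)] \<sigma>1(2) assms(4) by metis
  then obtain F where F: "\<And>a. a \<in> ?A \<Longrightarrow>
      exec x b (?P a) \<sigma>1 (F a) \<and> rep (perform w a c) (zs @ emitted a) (F a) \<and> F a (Go m) = 1"
    by metis
  have "run x b Q (step # cs) \<sigma> (\<Sum>a\<in>?A. k a)" if "\<And>a. a \<in> ?A \<Longrightarrow> run x b Q cs (F a) (k a)" for Q cs k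
  proof -
    have "run x b Q (chooses (map ?P (listing ?A)) # cs) \<sigma>1 (\<Sum>a\<leftarrow>listing ?A. k a)"
      by (rule run_chooses) (use that F listing(1)[OF fin] exec_run in blast)
    then show ?thesis
      using \<sigma>1(3) listing[OF fin] by (simp add: sum_list_distinct_conv_sum_set)
  qed
  then show ?thesis using F by (intro exI[of _ F]) auto
qed

lemma output_word_simps [simp]:
  "output_word [] = []" "output_word (a # as) = emitted a @ output_word as"
  by (simp_all add: output_word_def emitted_def map_filter_simps split: option.splits)

text \<open>With a single action the sum has one term and a step becomes an \<open>exec\<close>. The
  complete output \<open>y\<close> is fixed in advance because \<open>out\<close> only has to cope
  with prefixes of it, which keeps its counters bounded.\<close>

lemma exec_deterministic_loop:
  assumes "deterministic M"
    and "rep c zs \<sigma>" "\<sigma> (Go m) = 1" "path_from M w c as" "actions M w (fold (perform w) as c) = {}"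
    and "\<And>bs. path_from M w c bs \<Longrightarrow> head_bound s (fold (perform w) bs c)" "y = zs @ output_word as @ ys"
  shows "\<exists>\<sigma>'. exec x b (While (Go m) step) \<sigma> \<sigma>' \<and> (\<exists>v. Inv v (zs @ output_word as) \<sigma>')"
  using assms(2-)
proof (induction as arbitrary: c zs \<sigma>)
  case Nil
  then obtain \<sigma>' where \<sigma>': "exec x b step \<sigma> \<sigma>'" "rep c zs \<sigma>'" "\<sigma>' (Go m) = 0"
    using exec_step_halted by fastforce
  have "exec x b (While (Go m) step) \<sigma> \<sigma>'"
    using exec_While[OF _ \<sigma>'(1) exec_While0[of \<sigma>' "Go m", OF \<sigma>'(3)]] Nil by simp
  then show ?case using \<sigma>'(2) by (auto simp: rep_def)
next
  case (Cons a as)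
  have a: "actions M w c = {a}"
    using Cons.prems(3) assms(1) by (auto simp: deterministic_def actions_def)
  have "head_bound s (perform w a c)" using Cons.prems(5)[of "[a]"] a by simp
  then obtain F where F: "rep (perform w a c) (zs @ emitted a) (F a)" "F a (Go m) = 1"
      "\<And>Q cs k. run x b Q cs (F a) (k a) \<Longrightarrow> run x b Q (step # cs) \<sigma> (k a)"
    using run_step_actions[OF Cons.prems(1) _ Cons.prems(2)] a Cons.prems(6) by auto
  have "exec x b step \<sigma> (F a)"
    using F(3)[where k = "\<lambda>_. N" for N] by (auto simp: exec_def)
  moreover have "\<exists>\<sigma>'. exec x b (While (Go m) step) (F a) \<sigma>' \<and>
      (\<exists>v. Inv v ((zs @ emitted a) @ output_word as) \<sigma>')"
  proof (rule Cons.IH[OF F(1,2)])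
    show "head_bound s (fold (perform w) bs (perform w a c))"
      if "path_from M w (perform w a c) bs" for bs
      using Cons.prems(5)[of "a # bs"] that a by simp
  qed (use Cons.prems in auto)
  ultimately show ?case
    using exec_While[of \<sigma> "Go m" x b step] Cons.prems(2) by fastforce
qed

text \<open>Each accepting leaf of the tree goes on with \<open>cs\<close> and contributes
  \<open>N\<close>, each rejecting leaf meets \<open>Fail\<close> and contributes \<open>0\<close>.
  The final head position is arbitrary since leaves may differ in it, while \<open>N\<close> must be
  the same for all.\<close>

lemma run_counting_loop:
  assumes "no_output M"
    and "counts M w (\<lambda>c. wf_config M c \<and> head_bound s c) c k" "rep c zs \<sigma>" "\<sigma> (Go m) = 1"
    and "\<And>\<sigma>' v. Inv v zs \<sigma>' \<Longrightarrow> run x b Q cs \<sigma>' N" "y = zs"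
  shows "run x b Q (While (Go m) step # check M m # cs) \<sigma> (k * N)"
  using assms(2-)
proof (induction arbitrary: \<sigma>)
  case (counts_halt c)
  then obtain \<sigma>' where \<sigma>': "exec x b step \<sigma> \<sigma>'" "rep c zs \<sigma>'" "\<sigma>' (Go m) = 0"
    using exec_step_halted by metis
  have "exec x b (While (Go m) step) \<sigma> \<sigma>'"
    using exec_While[OF _ \<sigma>'(1) exec_While0[of \<sigma>' "Go m", OF \<sigma>'(3)]] counts_halt by simp
  moreover have "run x b Q (check M m # cs) \<sigma>' ((if state c \<in> accepting M then 1 else 0) * N)"
    unfolding check_def
    by (rule run_switch)
      (use \<sigma>'(2) counts_halt b(4) in \<open>auto simp: rep_def wf_config_def intro: run_Skip run_Fail\<close>)
  ultimately show ?case by (rule exec_run)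
next
  case (counts_step c k)
  have hb: "head_bound s (perform w a c) \<and> (\<exists>ys. y = zs @ emitted a @ ys)" if "a \<in> actions M w c" for a
  proof -
    have "emit a = None" using that assms(1) by (auto simp: no_output_def actions_def)
    moreover have "head_bound s (perform w a c)"
      using counts_invariant[OF counts_step.hyps(4)[OF that], of "[]"] by simp
    ultimately show ?thesis using counts_step.prems by (simp add: emitted_def)
  qed
  obtain F where F: "\<And>a. a \<in> actions M w c \<Longrightarrow> rep (perform w a c) (zs @ emitted a) (F a) \<and> F a (Go m) = 1"
      "\<And>Q cs k. (\<And>a. a \<in> actions M w c \<Longrightarrow> run x b Q cs (F a) (k a)) \<Longrightarrow>
        run x b Q (step # cs) \<sigma> (\<Sum>a\<in>actions M w c. k a)"
    using run_step_actions[OF counts_step.prems(1) counts_step.hyps(2) counts_step.prems(2) hb] by metis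
  have "run x b Q (step # While (Go m) step # check M m # cs) \<sigma> (\<Sum>a\<in>actions M w c. k a * N)"
  proof (rule F(2))
    fix a assume a: "a \<in> actions M w c"
    then have "emitted a = []" using hb[OF a] counts_step.prems(4) by simp
    then show "run x b Q (While (Go m) step # check M m # cs) (F a) (k a * N)"
      using counts_step.IH[OF a] F(1)[OF a] counts_step.prems by simp
  qed
  then show ?case
    using counts_step.prems(2) by (auto intro!: run_While simp: sum_distrib_right)
qed

end

section \<open>Restarting a simulated machine\<close>

definition reset_tape :: "nat \<Rightarrow> nat \<Rightarrow> cmd" where
  "reset_tape m j = clear (Pos m j) ;; clear (Cur m j) ;; clear (LS m j) ;; clear (RS m j)"

primrec reset_tapes :: "nat \<Rightarrow> nat \<Rightarrow> cmd" where
  "reset_tapes m 0 = Skip"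
| "reset_tapes m (Suc n) = reset_tapes m n ;; reset_tape m n"

definition reset :: "nat \<Rightarrow> nat \<Rightarrow> cmd" where
  "reset m n = clear (St m) ;; assign (Go m) 1 ;; reset_tapes m n"

lemma exec_reset_tape:
  "exec x b (reset_tape m j) \<sigma> (\<lambda>r. if r \<in> tape_regs m j then 0 else \<sigma> r)"
proof -
  have "(\<lambda>r. if r \<in> tape_regs m j then 0 else \<sigma> r) =
      \<sigma>(Pos m j := 0, Cur m j := 0, LS m j := 0, RS m j := 0)"
    by (auto simp: tape_regs_def fun_eq_iff)
  then show ?thesis
    unfolding reset_tape_def by (auto intro!: exec_Seq exec_clear simp del: fun_upd_apply)
qed

lemma exec_reset_tapes:
  "exec x b (reset_tapes m n) \<sigma> (\<lambda>r. if \<exists>j < n. r \<in> tape_regs m j then 0 else \<sigma> r)"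
proof (induction n)
  case 0
  then show ?case by (simp add: exec_Skip)
next
  case (Suc n)
  have eq: "(\<lambda>r. if r \<in> tape_regs m n then 0 else if \<exists>j < n. r \<in> tape_regs m j then 0 else \<sigma> r) =
      (\<lambda>r. if \<exists>j < Suc n. r \<in> tape_regs m j then 0 else \<sigma> r)"
    by (auto simp: fun_eq_iff less_Suc_eq)
  show ?case
    using exec_Seq[OF Suc.IH exec_reset_tape[of x b m n]] unfolding eq by simp
qed

lemma exec_reset:
  assumes "1 \<le> b"
  shows "\<exists>\<sigma>'. exec x b (reset m n) \<sigma> \<sigma>' \<and> \<sigma>' (St m) = 0 \<and> \<sigma>' (Go m) = 1 \<and>
    (\<forall>j < n. \<forall>r \<in> tape_regs m j. \<sigma>' r = 0) \<and> (\<forall>r. \<not> own m r \<longrightarrow> \<sigma>' r = \<sigma> r)"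
proof -
  let ?\<sigma>1 = "\<sigma>(St m := 0, Go m := 1)"
  let ?\<sigma>2 = "\<lambda>r. if \<exists>j < n. r \<in> tape_regs m j then 0 else ?\<sigma>1 r"
  have "exec x b (reset m n) \<sigma> ?\<sigma>2"
    unfolding reset_def using assms
    by (intro exec_Seq[OF exec_clear] exec_Seq[OF exec_assign] exec_reset_tapes) auto
  moreover have "?\<sigma>2 (St m) = 0" "?\<sigma>2 (Go m) = 1" by (simp_all add: tape_regs_def)
  moreover have "\<forall>r. \<not> own m r \<longrightarrow> ?\<sigma>2 r = \<sigma> r" using own_tape_regs by auto
  moreover have "\<forall>j < n. \<forall>r \<in> tape_regs m j. ?\<sigma>2 r = 0" by auto
  ultimately show ?thesis by blast
qed

lemma stack_zeros: "set vs \<subseteq> {0} \<Longrightarrow> stack S vs = 0"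
  by (induction vs) auto

lemma stack_append: "stack S (vs @ ws) = stack S vs + S ^ length vs * stack S ws"
  by (induction vs) (auto simp: algebra_simps)

lemma (in simulation) rep_initial:
  assumes "\<sigma> (St m) = 0" "\<And>j r. j < num_tapes M \<Longrightarrow> r \<in> tape_regs m j \<Longrightarrow> \<sigma> r = 0"
    and "Inv 0 [] \<sigma>" "head_bound s (initial M)"
  shows "rep (initial M) [] \<sigma>"
proof -
  have "tape_rep m j S s \<sigma> (\<lambda>_. 0, 0)" if j: "j < num_tapes M" for j
  proof -
    have "0 < s" using assms(4) j by (simp add: head_bound_def initial_def)
    moreover have "0 < S" using wf by (simp add: wf_tm_def)
    moreover have "\<sigma> (Pos m j) = 0" "\<sigma> (Cur m j) = 0" "\<sigma> (LS m j) = 0" "\<sigma> (RS m j) = 0"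
      using assms(2)[OF j] by (auto simp: tape_regs_def)
    moreover have "stack S (map (\<lambda>_. 0) vs) = 0" for vs :: "nat list"
      by (rule stack_zeros) auto
    ultimately show ?thesis by (simp add: tape_rep_def)
  qed
  then show ?thesis
    using assms(1,3) wf_config_initial[OF wf] by (simp add: rep_def initial_def)
qed

section \<open>The number of factors\<close>

text \<open>Horner's rule in the order of emission: a new bit doubles the value and is
  added.\<close>

definition binval :: "bool list \<Rightarrow> nat" where
  "binval = foldl (\<lambda>n d. 2 * n + of_bool d) 0"

lemma binval_simps [simp]: "binval [] = 0" "binval (ds @ [d]) = 2 * binval ds + of_bool d"
  by (simp_all add: binval_def)

lemma binval_binary: "binval (binary n) = n"
proof (induction n rule: less_induct)
  case (less n)
  show ?case
  proof (cases "n < 2")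
    case True
    then have "binary n = [] @ [n = 1]" by (simp add: binary.simps)
    then show ?thesis using True by (simp only: binval_simps) auto
  next
    case False
    then have "binary n = binary (n div 2) @ [odd n]" by (subst binary.simps) simp
    then show ?thesis using less[of "n div 2"] False by (simp add: mod2_eq_if[symmetric] of_bool_def)
  qed
qed

text \<open>The value of a prefix of the output thus never exceeds the final one, so a bound on
  \<open>p x\<close> bounds the counter throughout.\<close>

lemma binval_append_le: "binval ds \<le> binval (ds @ es)"
proof (induction es rule: rev_induct)
  case (snoc e es)
  then show ?case by (simp flip: append_assoc)
qed simp

text \<open>
  The machines for \<open>p\<close>, \<open>g\<close> and \<open>f\<close> have the numbers 0, 1 and 2.  \<open>Var 0\<close> holds the number of factors
  left, \<open>Var 1\<close> the index \<open>i\<close> of the current factor, and \<open>Var 4\<close> the head position on \<open>g (x, i)\<close>.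
\<close>

definition p_read :: "(bool cell \<Rightarrow> cmd) \<Rightarrow> cmd" where
  "p_read P = IfCell LeftEnd (P LeftEnd) (IfCell RightEnd (P RightEnd)
     (IfCell (Cell True) (P (Cell True)) (P (Cell False))))"

lemma run_p_read:
  assumes "run x b Q (P (input_cell x (\<sigma> Head)) # cs) \<sigma> N"
  shows "run x b Q (p_read P # cs) \<sigma> N"
  unfolding p_read_def using assms
  by (cases "input_cell x (\<sigma> Head)") (auto intro!: run_IfCell split: if_splits)

definition p_out :: "bool \<Rightarrow> cmd" where
  "p_out d = times (Var 0) 2 ;; incs (Var 0) (of_bool d)"

definition p_loop :: "bool tm \<Rightarrow> cmd" where
  "p_loop M = While (Go 0) (sim_step M 0 p_read (Inc Head) (Dec Head) p_out)"

text \<open>This machine reads the real input, so its head is \<open>Head\<close> itself and no cell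
  has to be recomputed.\<close>

lemma exec_p_loop:
  assumes M: "wf_tm M" "deterministic M" "halting_path M x as" "output_word as = binary P"
    and s: "\<And>bs. path M x bs \<Longrightarrow> head_bound s (final M x bs)"
    and b: "num_symbols M ^ s \<le> b" "num_symbols M \<le> b" "s \<le> b" "num_states M \<le> b" "P \<le> b"
  shows "\<exists>\<sigma>'. exec x b (p_loop M) ((\<lambda>_. 0)(Go 0 := 1)) \<sigma>' \<and>
    \<sigma>' Tmp = 0 \<and> \<sigma>' (Var 0) = P \<and> \<sigma>' (Var 1) = 0"
proof -
  let ?Inv = "\<lambda>v zs \<sigma>. \<sigma> Head = v \<and> \<sigma> Tmp = 0 \<and> \<sigma> (Var 0) = binval zs \<and> \<sigma> (Var 1) = 0"
  interpret simulation x b M 0 x s p_read "Inc Head" "Dec Head" p_out "binary P" ?Inv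
  proof
    fix v zs \<sigma> assume Inv: "?Inv v zs \<sigma>"
    show "\<exists>\<sigma>'. ?Inv v zs \<sigma>' \<and> (\<forall>r. own 0 r \<longrightarrow> \<sigma>' r = \<sigma> r) \<and>
        (\<forall>P Q cs N. run x b Q (P (input_cell x v) # cs) \<sigma>' N \<longrightarrow> run x b Q (p_read P # cs) \<sigma> N)"
      using Inv by (intro exI[of _ \<sigma>]) (auto intro: run_p_read)
    show "\<exists>\<sigma>'. exec x b (Inc Head) \<sigma> \<sigma>' \<and> ?Inv (Suc v) zs \<sigma>' \<and> (\<forall>r. own 0 r \<longrightarrow> \<sigma>' r = \<sigma> r)"
      if "v \<le> length x"
      using Inv that exec_Inc[of \<sigma> Head x b] by (intro exI[of _ "\<sigma>(Head := Suc v)"]) (auto simp: capacity_def)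
  next
    fix v zs \<sigma> assume Inv: "?Inv (Suc v) zs \<sigma>"
    then show "\<exists>\<sigma>'. exec x b (Dec Head) \<sigma> \<sigma>' \<and> ?Inv v zs \<sigma>' \<and> (\<forall>r. own 0 r \<longrightarrow> \<sigma>' r = \<sigma> r)"
      using exec_Dec[of \<sigma> Head x b] by (intro exI[of _ "\<sigma>(Head := v)"]) auto
  next
    fix v zs \<sigma> d ys assume Inv: "?Inv v zs \<sigma>" and y: "binary P = zs @ d # ys"
    have le: "binval zs * 2 + of_bool d \<le> b"
      using binval_append_le[of "zs @ [d]" ys] binval_binary[of P] y b(5) by simp
    let ?\<sigma>1 = "\<sigma>(Var 0 := \<sigma> (Var 0) * 2)"
    have "exec x b (times (Var 0) 2) \<sigma> ?\<sigma>1"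
      by (rule exec_times) (use Inv le in auto)
    moreover have "exec x b (incs (Var 0) (of_bool d)) ?\<sigma>1 (?\<sigma>1(Var 0 := ?\<sigma>1 (Var 0) + of_bool d))"
      by (rule exec_incs) (use Inv le in auto)
    ultimately have "exec x b (p_out d) \<sigma> (?\<sigma>1(Var 0 := ?\<sigma>1 (Var 0) + of_bool d))"
      unfolding p_out_def by (rule exec_Seq)
    then show "\<exists>\<sigma>'. exec x b (p_out d) \<sigma> \<sigma>' \<and> ?Inv v (zs @ [d]) \<sigma>' \<and> (\<forall>r. own 0 r \<longrightarrow> \<sigma>' r = \<sigma> r)"
      using Inv by (intro exI[of _ "?\<sigma>1(Var 0 := ?\<sigma>1 (Var 0) + of_bool d)"]) auto
  qed (use M b in auto)
  let ?\<sigma> = "(\<lambda>_. 0)(Go 0 := 1)"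
  have "rep (initial M) [] ?\<sigma>"
    by (rule rep_initial) (use s[of "[]"] in \<open>auto simp: path_def final_def tape_regs_def\<close>)
  then have "\<exists>\<sigma>'. exec x b (p_loop M) ?\<sigma> \<sigma>' \<and> (\<exists>v. ?Inv v ([] @ output_word as) \<sigma>')"
    unfolding p_loop_def
    by (rule exec_deterministic_loop[OF M(2)])
      (use M s in \<open>auto simp: halting_path_def path_def final_def\<close>)
  then show ?thesis using M(4) binval_binary by auto
qed

section \<open>Recomputing the symbols of a factor\<close>

text \<open>
  The part of \<^const>\<open>encode_pair\<close> after \<open>x\<close> lies on the tape \<open>(3, 0)\<close>, the separator \<open>3\<close> in front of the
  binary digits of \<open>i\<close>.  The real input head stands on the right end marker while the simulated one
  visits that part.
\<close>

definition digit :: "bool \<Rightarrow> nat" where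
  "digit d = (if d then 2 else 1)"

text \<open>With \<open>1\<close> and \<open>2\<close> for the bits and \<open>3\<close> for the
  separator, the blank \<open>0\<close> is left to stand for the right end marker; hence the base
  \<open>4\<close>.\<close>

definition number_tape :: "nat \<Rightarrow> nat \<Rightarrow> nat" where
  "number_tape i j = (if j = 0 then 3
     else if j \<le> length (binary i) then digit (binary i ! (j - 1)) else 0)"

text \<open>Halving yields the least significant bit first, and each bit is pushed on the right
  stack, so the most significant one ends up next to the head. \<open>Inc\<close> turns a bit into
  its code, and the copy protects the index itself.\<close>

definition load :: cmd where
  "load = clear (Pos 3 0) ;; clear (LS 3 0) ;; clear (RS 3 0) ;; copy (Var 1) (Var 2) ;;
     While (Var 2) (pop 2 (Var 2) (Cur 3 0) ;; Inc (Cur 3 0) ;; push 4 (RS 3 0) (Cur 3 0)) ;;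
     assign (Cur 3 0) 3"

text \<open>Unlike \<open>binary\<close>, this is empty at \<open>0\<close>, in accordance with a
  loop that stops once the number is used up.\<close>

definition digits :: "nat \<Rightarrow> nat list" where
  "digits i = (if i = 0 then [] else map digit (binary i))"

lemma digits_step: "0 < u \<Longrightarrow> digits u = digits (u div 2) @ [1 + u mod 2]"
  by (subst digits_def, subst binary.simps)
    (auto simp: digits_def digit_def odd_iff_mod_2_eq_one even_iff_mod_2_eq_zero)

text \<open>The digits still to come, placed on top of the current stack, always form the same
  number; this also bounds all intermediate stacks.\<close>

lemma exec_load_loop:
  assumes "\<sigma> Tmp = 0" "\<sigma> (Var 2) \<le> b" "4 \<le> b"
    and "stack 4 (digits (\<sigma> (Var 2))) + 4 ^ length (digits (\<sigma> (Var 2))) * \<sigma> (RS 3 0) \<le> b"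
  shows "\<exists>k. exec x b (While (Var 2) (pop 2 (Var 2) (Cur 3 0) ;; Inc (Cur 3 0) ;; push 4 (RS 3 0) (Cur 3 0)))
    \<sigma> (\<sigma>(Var 2 := 0, Cur 3 0 := k, RS 3 0 := stack 4 (digits (\<sigma> (Var 2))) +
      4 ^ length (digits (\<sigma> (Var 2))) * \<sigma> (RS 3 0)))"
  using assms
proof (induction "\<sigma> (Var 2)" arbitrary: \<sigma> rule: less_induct)
  case less
  let ?c = "pop 2 (Var 2) (Cur 3 0) ;; Inc (Cur 3 0) ;; push 4 (RS 3 0) (Cur 3 0)"
  show ?case
  proof (cases "\<sigma> (Var 2) = 0")
    case True
    have "\<sigma>(Var 2 := 0, Cur 3 0 := \<sigma> (Cur 3 0), RS 3 0 := \<sigma> (RS 3 0)) = \<sigma>"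
      using True by (auto simp: fun_eq_iff)
    then show ?thesis
      using True exec_While0[of \<sigma> "Var 2" x b ?c]
      by (intro exI[of _ "\<sigma> (Cur 3 0)"]) (simp add: digits_def)
  next
    case False
    define u where "u = \<sigma> (Var 2)"
    define A where "A = \<sigma> (RS 3 0) * 4 + (1 + u mod 2)"
    let ?\<sigma>1 = "\<sigma>(Var 2 := u div 2, Cur 3 0 := u mod 2)"
    let ?\<sigma>2 = "\<sigma>(Var 2 := u div 2, Cur 3 0 := 1 + u mod 2)"
    let ?\<sigma>3 = "?\<sigma>2(RS 3 0 := A)"
    have u: "0 < u" using False by (simp add: u_def)
    have final: "stack 4 (digits (u div 2)) + 4 ^ length (digits (u div 2)) * A =
        stack 4 (digits u) + 4 ^ length (digits u) * \<sigma> (RS 3 0)"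
      by (simp add: digits_step[OF u] stack_append A_def algebra_simps)
    moreover have "A \<le> 4 ^ length (digits (u div 2)) * A" by simp
    ultimately have A: "A \<le> b" using less.prems(4) unfolding u_def by linarith
    have "exec x b (pop 2 (Var 2) (Cur 3 0)) \<sigma> ?\<sigma>1"
      using exec_pop[of "Var 2" "Cur 3 0" \<sigma> 2 b x] less.prems by (simp add: u_def)
    moreover have "exec x b (Inc (Cur 3 0)) ?\<sigma>1 ?\<sigma>2"
    proof -
      have "u mod 2 < b" using less.prems(3) mod_less_divisor[of 2 u] by linarith
      then show ?thesis using exec_Inc[of ?\<sigma>1 "Cur 3 0" x b] by (simp add: capacity_def)
    qed
    moreover have "exec x b (push 4 (RS 3 0) (Cur 3 0)) ?\<sigma>2 ?\<sigma>3"
    proof -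
      have "1 + u mod 2 < 4" by linarith
      then show ?thesis
        using exec_push[of "RS 3 0" "Cur 3 0" ?\<sigma>2 4 b x] less.prems A by (simp add: A_def)
    qed
    ultimately have "exec x b ?c \<sigma> ?\<sigma>3" by (rule exec_Seq[OF _ exec_Seq])
    moreover obtain k where "exec x b (While (Var 2) ?c) ?\<sigma>3
        (?\<sigma>3(Var 2 := 0, Cur 3 0 := k, RS 3 0 := stack 4 (digits u) + 4 ^ length (digits u) * \<sigma> (RS 3 0)))"
    proof -
      have "u div 2 \<le> b" using less.prems(2) div_le_dividend[of u 2] by (simp add: u_def)
      then show ?thesis
        using less.hyps[of ?\<sigma>3] less.prems u final that by (auto simp: u_def)
    qed
    moreover have "?\<sigma>3(Var 2 := 0, Cur 3 0 := k, RS 3 0 := z) = \<sigma>(Var 2 := 0, Cur 3 0 := k, RS 3 0 := z)" for z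
      by (auto simp: fun_eq_iff)
    ultimately show ?thesis
      using exec_While[of \<sigma> "Var 2" x b ?c ?\<sigma>3] False unfolding u_def by metis
  qed
qed

lemma number_tape_less: "number_tape i j < 4"
  by (simp add: number_tape_def digit_def)

lemma map_number_tape:
  assumes "0 < i"
  shows "map (number_tape i) [Suc 0..<length (binary i) + 2] = digits i @ [0]"
proof (rule nth_equalityI)
  fix j assume "j < length (map (number_tape i) [Suc 0..<length (binary i) + 2])"
  then have "j < length (binary i) + 1" by (simp del: upt_Suc)
  then show "map (number_tape i) [Suc 0..<length (binary i) + 2] ! j = (digits i @ [0]) ! j"
    using assms by (auto simp: number_tape_def digits_def nth_append simp del: upt_Suc)
qed (use assms in \<open>simp add: digits_def del: upt_Suc\<close>)

text \<open>The length \<open>length (binary i) + 2\<close> comprises the separator, the digits and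
  one blank for the right end marker.\<close>

lemma exec_load:
  assumes "\<sigma> Tmp = 0" "\<sigma> (Var 1) = i" "0 < i" "i \<le> b" "4 ^ (length (binary i) + 2) \<le> b"
  shows "\<exists>\<sigma>'. exec x b load \<sigma> \<sigma>' \<and>
    tape_rep 3 0 4 (length (binary i) + 2) \<sigma>' (number_tape i, 0) \<and>
    (\<forall>r. r \<noteq> Var 2 \<and> r \<notin> tape_regs 3 0 \<longrightarrow> \<sigma>' r = \<sigma> r)"
proof -
  have "(4 :: nat) ^ 1 \<le> 4 ^ (length (binary i) + 2)" by (rule power_increasing) auto
  then have b4: "4 \<le> b" using assms(5) unfolding power_one_right by (rule order.trans)
  have "stack 4 (digits i) < 4 ^ length (digits i)"
    by (rule stack_less) (auto simp: digits_def digit_def)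
  also have "\<dots> \<le> (4 :: nat) ^ (length (binary i) + 2)"
    by (rule power_increasing) (auto simp: digits_def)
  finally have le: "stack 4 (digits i) \<le> b" using assms(5) by simp
  let ?\<sigma>1 = "\<sigma>(Pos 3 0 := 0, LS 3 0 := 0, RS 3 0 := 0)"
  let ?\<sigma>2 = "?\<sigma>1(Var 2 := i)"
  have e2: "exec x b (copy (Var 1) (Var 2)) ?\<sigma>1 ?\<sigma>2"
    using exec_copy[of "Var 1" "Var 2" ?\<sigma>1 b x] assms by simp
  obtain k where e3: "exec x b
      (While (Var 2) (pop 2 (Var 2) (Cur 3 0) ;; Inc (Cur 3 0) ;; push 4 (RS 3 0) (Cur 3 0)))
      ?\<sigma>2 (?\<sigma>2(Var 2 := 0, Cur 3 0 := k, RS 3 0 := stack 4 (digits i)))"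
    using exec_load_loop[of ?\<sigma>2 b x] assms b4 le by auto
  let ?\<sigma>4 = "?\<sigma>2(Var 2 := 0, Cur 3 0 := k, RS 3 0 := stack 4 (digits i), Cur 3 0 := 3)"
  have "exec x b load \<sigma> ?\<sigma>4"
    unfolding load_def
    by (intro exec_Seq[OF exec_clear] exec_Seq[OF e2] exec_Seq[OF e3] exec_assign) (use b4 in auto)
  moreover have "tape_rep 3 0 4 (length (binary i) + 2) ?\<sigma>4 (number_tape i, 0)"
    using map_number_tape[OF assms(3)] number_tape_less
    by (simp add: tape_rep_def stack_append del: upt_Suc) (simp add: number_tape_def)
  moreover have "\<forall>r. r \<noteq> Var 2 \<and> r \<notin> tape_regs 3 0 \<longrightarrow> ?\<sigma>4 r = \<sigma> r"
    by (simp add: tape_regs_def)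
  ultimately show ?thesis by blast
qed

section \<open>The virtual input of the machine for \<open>g\<close>\<close>

definition g_cell :: "nat \<Rightarrow> bool option cell" where
  "g_cell k = (if k = 0 then RightEnd else if k = 3 then Cell None else Cell (Some (k = 2)))"

definition g_read :: "(bool option cell \<Rightarrow> cmd) \<Rightarrow> cmd" where
  "g_read P = IfCell RightEnd (switch (Cur 3 0) 4 (\<lambda>k. P (g_cell k)))
     (IfCell LeftEnd (P LeftEnd)
       (IfCell (Cell True) (P (Cell (Some True))) (P (Cell (Some False)))))"

text \<open>The two halves of the input meet at position \<open>length x + 1\<close>, where the real
  right end marker coincides with the separator in cell \<open>0\<close> of the tape. Before it the
  real head moves, behind it the tape head.\<close>

definition g_fwd :: cmd where
  "g_fwd = IfCell RightEnd (tape_move 3 0 4 Rgt) (Inc Head)"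

definition g_bwd :: cmd where
  "g_bwd = IfCell RightEnd (IfZ (Pos 3 0) (Dec Head) (tape_move 3 0 4 Lft)) (Dec Head)"

text \<open>\<open>Var 5\<close> counts the output down to the wanted symbol, which is then stored in \<open>Var 6\<close>.\<close>

definition g_out :: "bool \<Rightarrow> cmd" where
  "g_out d = IfZ (Var 5) Skip (Dec (Var 5) ;; IfZ (Var 5) (assign (Var 6) (digit d)) Skip)"

text \<open>The initial \<open>3\<close> in \<open>Var 6\<close> survives if the output is shorter
  than requested, and then stands for the right end marker of \<open>g (x, i)\<close>. This differs
  from its meaning on the tape \<open>(3, 0)\<close>.\<close>

definition fetch :: "bool option tm \<Rightarrow> cmd" where
  "fetch M = copy (Var 4) (Var 5) ;; assign (Var 6) 3 ;; load ;; clear Head ;;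
     reset 1 (num_tapes M) ;; While (Go 1) (sim_step M 1 g_read g_fwd g_bwd g_out)"

lemma length_encode_pair: "length (encode_pair (x, i)) = length x + 1 + length (binary i)"
  by (simp add: encode_pair_def)

lemma input_cell_encode_pair:
  "input_cell (encode_pair (x, i)) v =
     (if v \<le> length x then map_cell Some (input_cell x v)
      else g_cell (number_tape i (v - (length x + 1))))"
proof (cases "v \<le> length x")
  case True
  then show ?thesis
    by (auto simp: input_cell_def length_encode_pair) (simp add: encode_pair_def nth_append)
next
  case False
  define j where "j = v - (length x + 1)"
  have v: "v = length x + 1 + j" using False by (simp add: j_def)
  have "input_cell (encode_pair (x, i)) (length x + 1 + j) = g_cell (number_tape i j)"
  proof (cases j)
    case 0
    then show ?thesis
      by (simp add: input_cell_def length_encode_pair number_tape_def g_cell_def)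
        (simp add: encode_pair_def nth_append)
  next
    case (Suc k)
    then show ?thesis
      by (auto simp: input_cell_def length_encode_pair number_tape_def g_cell_def digit_def)
        (auto simp: encode_pair_def nth_append)
  qed
  then show ?thesis using False by (simp add: v)
qed

text \<open>As long as the simulated head is on \<open>x\<close>, the truncated difference is
  \<open>0\<close>: the tape head waits on the separator.\<close>

definition g_pos :: "bool list \<Rightarrow> nat \<Rightarrow> nat \<Rightarrow> store \<Rightarrow> bool" where
  "g_pos x i v \<sigma> \<longleftrightarrow> \<sigma> Head = min v (length x + 1) \<and>
     tape_rep 3 0 4 (length (binary i) + 2) \<sigma> (number_tape i, v - (length x + 1))"

lemma input_cell_RightEnd: "input_cell x v = RightEnd \<longleftrightarrow> length x < v"
  by (auto simp: input_cell_def)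

lemma run_g_read:
  assumes "g_pos x i v \<sigma>" "4 \<le> b"
    and "run x b Q (P (input_cell (encode_pair (x, i)) v) # cs) \<sigma> N"
  shows "run x b Q (g_read P # cs) \<sigma> N"
proof (cases "v \<le> length x")
  case True
  then have Head: "\<sigma> Head = v" using assms(1) by (simp add: g_pos_def)
  have "input_cell x v \<noteq> RightEnd" using True by (simp add: input_cell_RightEnd)
  then show ?thesis
    unfolding g_read_def using assms(3) Head True
    by (cases "input_cell x v") (auto intro!: run_IfCell simp: input_cell_encode_pair split: if_splits)
next
  case False
  then have "\<sigma> Head = length x + 1" using assms(1) by (simp add: g_pos_def)
  then have cell: "input_cell x (\<sigma> Head) = RightEnd" by (simp add: input_cell_RightEnd)
  have cur: "\<sigma> (Cur 3 0) = number_tape i (v - (length x + 1))"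
    using assms(1) by (simp add: g_pos_def tape_rep_def)
  have "run x b Q (switch (Cur 3 0) 4 (\<lambda>k. P (g_cell k)) # cs) \<sigma> N"
    by (rule run_switch)
      (use assms(2,3) cur False number_tape_less[of i "v - (length x + 1)"] in
        \<open>simp_all add: input_cell_encode_pair\<close>)
  then show ?thesis
    unfolding g_read_def by (intro run_IfCell) (simp add: cell)
qed

lemma g_pos_cong:
  "g_pos x i v \<sigma> \<Longrightarrow> \<sigma>' Head = \<sigma> Head \<Longrightarrow> (\<And>r. r \<in> tape_regs 3 0 \<Longrightarrow> \<sigma>' r = \<sigma> r) \<Longrightarrow> g_pos x i v \<sigma>'"
  using tape_rep_cong[of 3 0 \<sigma>' \<sigma>] by (simp add: g_pos_def)

context
  fixes x :: "bool list" and i b :: nat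
  assumes b4: "4 ^ (length (binary i) + 2) \<le> b" "length (binary i) + 2 \<le> b"
begin

lemma four_le: "4 \<le> b"
proof -
  have "(4 :: nat) ^ 1 \<le> 4 ^ (length (binary i) + 2)" by (rule power_increasing) auto
  then show ?thesis using b4(1) unfolding power_one_right by (rule order.trans)
qed

lemma exec_g_fwd:
  assumes "g_pos x i v \<sigma>" "v \<le> length (encode_pair (x, i))" "\<sigma> Tmp = 0"
  shows "\<exists>\<sigma>'. exec x b g_fwd \<sigma> \<sigma>' \<and> g_pos x i (Suc v) \<sigma>' \<and>
    (\<forall>r. r \<noteq> Head \<and> r \<notin> tape_regs 3 0 \<longrightarrow> \<sigma>' r = \<sigma> r)"
proof (cases "v \<le> length x")
  case True
  let ?\<sigma> = "\<sigma>(Head := Suc v)"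
  have Head: "\<sigma> Head = v" using assms(1) True by (simp add: g_pos_def)
  have "exec x b (Inc Head) \<sigma> ?\<sigma>"
    using exec_Inc[of \<sigma> Head x b] True Head by (simp add: capacity_def)
  then have "exec x b g_fwd \<sigma> ?\<sigma>"
    unfolding g_fwd_def by (intro exec_IfCell) (use Head True in \<open>simp add: input_cell_RightEnd\<close>)
  moreover have "tape_rep 3 0 4 s ?\<sigma> = tape_rep 3 0 4 s \<sigma>" for s
    by (rule tape_rep_cong) (auto simp: tape_regs_def)
  then have "g_pos x i (Suc v) ?\<sigma>" using assms(1) True by (simp add: g_pos_def)
  ultimately show ?thesis by (intro exI[of _ ?\<sigma>]) auto
next
  case False
  then have Head: "\<sigma> Head = length x + 1" using assms(1) by (simp add: g_pos_def)
  have rep: "tape_rep 3 0 4 (length (binary i) + 2) \<sigma> (number_tape i, v - (length x + 1))"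
    using assms(1) by (simp add: g_pos_def)
  have lt: "move Rgt (v - (length x + 1)) < length (binary i) + 2"
    using assms(2) False by (simp add: length_encode_pair)
  obtain \<sigma>' where \<sigma>': "exec x b (tape_move 3 0 4 Rgt) \<sigma> \<sigma>'"
      "tape_rep 3 0 4 (length (binary i) + 2) \<sigma>' (number_tape i, Suc (v - (length x + 1)))"
      "\<forall>r. r \<notin> tape_regs 3 0 \<longrightarrow> \<sigma>' r = \<sigma> r"
    using exec_tape_move[OF rep lt b4(1) four_le b4(2) assms(3), of x] by auto
  have e: "exec x b g_fwd \<sigma> \<sigma>'"
    unfolding g_fwd_def by (intro exec_IfCell) (use Head \<sigma>' in \<open>simp add: input_cell_RightEnd\<close>)
  have "\<sigma>' Head = \<sigma> Head" using \<sigma>'(3) by (simp add: tape_regs_def)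
  moreover have "Suc (v - Suc (length x)) = v - length x" using False by simp
  ultimately have "g_pos x i (Suc v) \<sigma>'"
    using \<sigma>'(2) False Head by (simp add: g_pos_def)
  then show ?thesis using \<sigma>'(3) e by (intro exI[of _ \<sigma>']) auto
qed

lemma exec_g_bwd:
  assumes "g_pos x i (Suc v) \<sigma>" "\<sigma> Tmp = 0"
  shows "\<exists>\<sigma>'. exec x b g_bwd \<sigma> \<sigma>' \<and> g_pos x i v \<sigma>' \<and>
    (\<forall>r. r \<noteq> Head \<and> r \<notin> tape_regs 3 0 \<longrightarrow> \<sigma>' r = \<sigma> r)"
proof (cases "v \<le> length x")
  case True
  let ?\<sigma> = "\<sigma>(Head := v)"
  have Head: "\<sigma> Head = Suc v" and Pos: "\<sigma> (Pos 3 0) = 0"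
    using assms(1) True by (simp_all add: g_pos_def tape_rep_def)
  have e: "exec x b (Dec Head) \<sigma> ?\<sigma>"
    using exec_Dec[of \<sigma> Head x b] Head by simp
  then have "exec x b g_bwd \<sigma> ?\<sigma>"
    unfolding g_bwd_def by (intro exec_IfCell) (use Pos in \<open>simp add: exec_IfZ\<close>)
  moreover have "tape_rep 3 0 4 s ?\<sigma> = tape_rep 3 0 4 s \<sigma>" for s
    by (rule tape_rep_cong) (auto simp: tape_regs_def)
  then have "g_pos x i v ?\<sigma>" using assms(1) True by (simp add: g_pos_def)
  ultimately show ?thesis by (intro exI[of _ ?\<sigma>]) auto
next
  case False
  then have Head: "\<sigma> Head = length x + 1" and Pos: "\<sigma> (Pos 3 0) = v - length x"
    using assms(1) by (simp_all add: g_pos_def tape_rep_def)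
  have rep: "tape_rep 3 0 4 (length (binary i) + 2) \<sigma> (number_tape i, v - length x)"
    using assms(1) by (simp add: g_pos_def)
  have lt: "move Lft (v - length x) < length (binary i) + 2"
    using rep by (auto simp: tape_rep_def simp del: upt_Suc)
  obtain \<sigma>' where \<sigma>': "exec x b (tape_move 3 0 4 Lft) \<sigma> \<sigma>'"
      "tape_rep 3 0 4 (length (binary i) + 2) \<sigma>' (number_tape i, v - length x - 1)"
      "\<forall>r. r \<notin> tape_regs 3 0 \<longrightarrow> \<sigma>' r = \<sigma> r"
    using exec_tape_move[OF rep lt b4(1) four_le b4(2) assms(2), of x] by auto
  have "exec x b g_bwd \<sigma> \<sigma>'"
    unfolding g_bwd_def
    by (intro exec_IfCell) (use Head Pos False \<sigma>' in \<open>simp add: input_cell_RightEnd exec_IfZ\<close>)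
  moreover have "\<sigma>' Head = \<sigma> Head" using \<sigma>'(3) by (simp add: tape_regs_def)
  then have "g_pos x i v \<sigma>'"
    using \<sigma>'(2) False Head by (simp add: g_pos_def)
  ultimately show ?thesis using \<sigma>'(3) by (intro exI[of _ \<sigma>']) auto
qed

end

section \<open>Extracting one output symbol\<close>

definition fetched :: "nat \<Rightarrow> bool list \<Rightarrow> nat" where
  "fetched h ds = (if h \<le> length ds then digit (ds ! (h - 1)) else 3)"

text \<open>By truncated subtraction \<open>Var 5\<close> reaches zero with the bit number
  \<open>h\<close> and stays there, so later bits no longer affect \<open>Var 6\<close>.\<close>

lemma exec_g_out:
  assumes "\<sigma> (Var 5) = h - length ds" "\<sigma> (Var 6) = fetched h ds" "0 < h" "2 \<le> b"
  shows "exec x b (g_out d) \<sigma>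
    (\<sigma>(Var 5 := h - Suc (length ds), Var 6 := fetched h (ds @ [d])))"
proof (cases "h \<le> length ds")
  case True
  then have "\<sigma>(Var 5 := h - Suc (length ds), Var 6 := fetched h (ds @ [d])) = \<sigma>"
    using assms by (auto simp: fetched_def nth_append fun_eq_iff)
  then show ?thesis
    unfolding g_out_def by (intro exec_IfZ) (use assms True in \<open>simp add: exec_Skip\<close>)
next
  case False
  let ?\<sigma>1 = "\<sigma>(Var 5 := h - Suc (length ds))"
  have e1: "exec x b (Dec (Var 5)) \<sigma> ?\<sigma>1"
    using exec_Dec[of \<sigma> "Var 5" x b] assms False by simp
  have e2: "exec x b (IfZ (Var 5) (assign (Var 6) (digit d)) Skip) ?\<sigma>1
      (?\<sigma>1(Var 6 := fetched h (ds @ [d])))"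
  proof (cases "h = Suc (length ds)")
    case True
    then have "fetched h (ds @ [d]) = digit d" by (simp add: fetched_def)
    then show ?thesis
      using exec_assign[of "Var 6" "digit d" b x ?\<sigma>1] True assms(4)
      by (intro exec_IfZ) (simp add: digit_def)
  next
    case ne: False
    then have "?\<sigma>1(Var 6 := fetched h (ds @ [d])) = ?\<sigma>1"
      using assms(2) False by (auto simp: fetched_def fun_eq_iff)
    moreover have "h - Suc (length ds) \<noteq> 0" using ne False by simp
    ultimately show ?thesis by (intro exec_IfZ) (simp add: exec_Skip)
  qed
  show ?thesis
    unfolding g_out_def by (intro exec_IfZ) (use exec_Seq[OF e1 e2] assms(1) False in simp)
qed

text \<open>The registers of the outer simulation, which must survive the recomputation of a symbol.\<close>

definition keep :: "reg \<Rightarrow> bool" where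
  "keep r \<longleftrightarrow> r \<in> {Var 0, Var 1, Var 4} \<or> own 2 r"

lemma keep_simps [simp]:
  "keep (Var k) \<longleftrightarrow> k \<in> {0, 1, 4}" "\<not> keep Head" "\<not> keep Tmp" "r \<in> tape_regs 3 0 \<Longrightarrow> \<not> keep r"
  "own 1 r \<Longrightarrow> \<not> keep r" "own (Suc 0) r \<Longrightarrow> \<not> keep r"
  by (auto simp: keep_def tape_regs_def elim: own.elims)

text \<open>Nothing is assumed about the registers of the inner machine or about the tape
  \<open>(3, 0)\<close>: they contain leftovers of the preceding fetch, which is why everything is
  loaded and reset again.\<close>

lemma exec_fetch:
  assumes M: "wf_tm M" "deterministic M" "halting_path M (encode_pair (x, i)) as"
    and s: "\<And>bs. path M (encode_pair (x, i)) bs \<Longrightarrow> head_bound s (final M (encode_pair (x, i)) bs)"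
    and bounds: "num_symbols M ^ s \<le> b" "num_symbols M \<le> b" "s \<le> b" "num_states M \<le> b"
      "4 ^ (length (binary i) + 2) \<le> b" "length (binary i) + 2 \<le> b"
    and \<sigma>: "\<sigma> Tmp = 0" "\<sigma> (Var 1) = i" "0 < i" "i \<le> b" "0 < \<sigma> (Var 4)" "\<sigma> (Var 4) \<le> b"
  shows "\<exists>\<sigma>'. exec x b (fetch M) \<sigma> \<sigma>' \<and> \<sigma>' Tmp = 0 \<and>
    \<sigma>' (Var 6) = fetched (\<sigma> (Var 4)) (output_word as) \<and> (\<forall>r. keep r \<longrightarrow> \<sigma>' r = \<sigma> r)"
proof -
  let ?w = "encode_pair (x, i)" and ?h = "\<sigma> (Var 4)"
  have b4: "4 \<le> b" using four_le[of i b] bounds by blast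
  define Inv where "Inv v zs \<tau> \<longleftrightarrow> g_pos x i v \<tau> \<and> \<tau> Tmp = 0 \<and> \<tau> (Var 5) = ?h - length zs \<and>
      \<tau> (Var 6) = fetched ?h zs \<and> (\<forall>r. keep r \<longrightarrow> \<tau> r = \<sigma> r)" for v zs \<tau>
  have Inv_change: "Inv v' zs \<tau>'"
    if "Inv v zs \<tau>" "g_pos x i v' \<tau>'" "\<forall>r. r \<noteq> Head \<and> r \<notin> tape_regs 3 0 \<longrightarrow> \<tau>' r = \<tau> r"
    for v v' zs \<tau> \<tau>'
  proof -
    have "\<tau>' r = \<tau> r" if "keep r" for r
      using \<open>\<forall>r. _\<close> that by (metis keep_simps(2,4))
    then show ?thesis
      using that by (simp add: Inv_def tape_regs_def)
  qed
  have own: "own 1 r \<Longrightarrow> r \<noteq> Head \<and> r \<notin> tape_regs 3 0" for r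
    by (auto simp: tape_regs_def)
  interpret simulation x b M 1 ?w s g_read g_fwd g_bwd g_out "output_word as" Inv
  proof
    fix v zs \<tau> \<tau>' assume Inv: "Inv v zs \<tau>" and eq: "\<And>r. \<not> own 1 r \<Longrightarrow> \<tau>' r = \<tau> r"
    have "\<tau>' r = \<tau> r" if "keep r" for r using that eq by (metis keep_simps(5))
    moreover have "g_pos x i v \<tau>'"
      by (rule g_pos_cong[of x i v \<tau>]) (use Inv eq own in \<open>auto simp: Inv_def\<close>)
    ultimately show "Inv v zs \<tau>'" using Inv eq by (simp add: Inv_def)
  next
    fix v zs \<tau> assume Inv: "Inv v zs \<tau>"
    then show "\<exists>\<tau>'. Inv v zs \<tau>' \<and> (\<forall>r. own 1 r \<longrightarrow> \<tau>' r = \<tau> r) \<and>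
        (\<forall>P Q cs N. run x b Q (P (input_cell ?w v) # cs) \<tau>' N \<longrightarrow> run x b Q (g_read P # cs) \<tau> N)"
      using run_g_read[of x i v \<tau> b] b4 by (intro exI[of _ \<tau>]) (auto simp: Inv_def)
    show "\<exists>\<tau>'. exec x b g_fwd \<tau> \<tau>' \<and> Inv (Suc v) zs \<tau>' \<and> (\<forall>r. own 1 r \<longrightarrow> \<tau>' r = \<tau> r)"
      if v: "v \<le> length ?w"
    proof -
      have "g_pos x i v \<tau>" "\<tau> Tmp = 0" using Inv by (simp_all add: Inv_def)
      from exec_g_fwd[OF bounds(5,6) this(1) v this(2)] obtain \<tau>' where \<tau>': "exec x b g_fwd \<tau> \<tau>'"
        "g_pos x i (Suc v) \<tau>'" "\<forall>r. r \<noteq> Head \<and> r \<notin> tape_regs 3 0 \<longrightarrow> \<tau>' r = \<tau> r"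
        by blast
      then show ?thesis using Inv_change[OF Inv \<tau>'(2,3)] own by blast
    qed
  next
    fix v zs \<tau> assume Inv: "Inv (Suc v) zs \<tau>"
    then have "g_pos x i (Suc v) \<tau>" "\<tau> Tmp = 0" by (simp_all add: Inv_def)
    from exec_g_bwd[OF bounds(5,6) this] obtain \<tau>' where \<tau>': "exec x b g_bwd \<tau> \<tau>'"
      "g_pos x i v \<tau>'" "\<forall>r. r \<noteq> Head \<and> r \<notin> tape_regs 3 0 \<longrightarrow> \<tau>' r = \<tau> r"
      by blast
    then show "\<exists>\<tau>'. exec x b g_bwd \<tau> \<tau>' \<and> Inv v zs \<tau>' \<and> (\<forall>r. own 1 r \<longrightarrow> \<tau>' r = \<tau> r)"
      using Inv_change[OF Inv \<tau>'(2,3)] own by blast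
  next
    fix v zs \<tau> d assume Inv: "Inv v zs \<tau>"
    let ?\<tau> = "\<tau>(Var 5 := ?h - Suc (length zs), Var 6 := fetched ?h (zs @ [d]))"
    have "exec x b (g_out d) \<tau> ?\<tau>"
      by (rule exec_g_out) (use Inv \<sigma> b4 in \<open>auto simp: Inv_def\<close>)
    moreover have "g_pos x i v ?\<tau>"
      by (rule g_pos_cong[of x i v \<tau>]) (use Inv in \<open>auto simp: Inv_def tape_regs_def\<close>)
    then have "Inv v (zs @ [d]) ?\<tau>"
      using Inv by (auto simp: Inv_def)
    ultimately show "\<exists>\<tau>'. exec x b (g_out d) \<tau> \<tau>' \<and> Inv v (zs @ [d]) \<tau>' \<and> (\<forall>r. own 1 r \<longrightarrow> \<tau>' r = \<tau> r)"
      by (intro exI[of _ ?\<tau>]) auto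
  qed (use M bounds in \<open>auto simp: Inv_def\<close>)
  let ?\<sigma>2 = "\<sigma>(Var 5 := ?h, Var 6 := 3)"
  obtain \<sigma>3 where \<sigma>3: "exec x b load ?\<sigma>2 \<sigma>3"
      "tape_rep 3 0 4 (length (binary i) + 2) \<sigma>3 (number_tape i, 0)"
      "\<forall>r. r \<noteq> Var 2 \<and> r \<notin> tape_regs 3 0 \<longrightarrow> \<sigma>3 r = ?\<sigma>2 r"
    using exec_load[of ?\<sigma>2 i b x, OF _ _ \<sigma>(3,4) bounds(5)] \<sigma>(1,2) by auto
  let ?\<sigma>4 = "\<sigma>3(Head := 0)"
  obtain \<sigma>5 where \<sigma>5: "exec x b (reset 1 (num_tapes M)) ?\<sigma>4 \<sigma>5" "\<sigma>5 (St 1) = 0" "\<sigma>5 (Go 1) = 1"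
      "\<forall>j < num_tapes M. \<forall>r \<in> tape_regs 1 j. \<sigma>5 r = 0" "\<forall>r. \<not> own 1 r \<longrightarrow> \<sigma>5 r = ?\<sigma>4 r"
    using exec_reset[of b x 1 "num_tapes M" ?\<sigma>4] b4 by auto
  have "tape_rep 3 0 4 (length (binary i) + 2) \<sigma>5 = tape_rep 3 0 4 (length (binary i) + 2) \<sigma>3"
    by (rule tape_rep_cong) (use \<sigma>5(5) in \<open>auto simp: tape_regs_def\<close>)
  then have "g_pos x i 0 \<sigma>5"
    using \<sigma>3(2) \<sigma>5(5) by (simp add: g_pos_def)
  moreover have "\<sigma>5 r = \<sigma> r" if "keep r" for r
  proof -
    have "\<not> own 1 r" "r \<noteq> Head" "r \<noteq> Var 2" "r \<noteq> Var 5" "r \<noteq> Var 6" "r \<notin> tape_regs 3 0"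
      using that by auto
    then show ?thesis using \<sigma>3(3) \<sigma>5(5) by simp
  qed
  ultimately have "Inv 0 [] \<sigma>5"
    using \<sigma>3(3) \<sigma>5(5) \<sigma> by (simp add: Inv_def fetched_def tape_regs_def)
  then have "rep (initial M) [] \<sigma>5"
    by (rule rep_initial[rotated 2]) (use \<sigma>5 s[of "[]"] in \<open>auto simp: path_def final_def\<close>)
  then have "\<exists>\<tau>. exec x b (While (Go 1) step) \<sigma>5 \<tau> \<and> (\<exists>v. Inv v ([] @ output_word as) \<tau>)"
    by (rule exec_deterministic_loop[OF M(2)])
      (use M \<sigma>5 s in \<open>auto simp: halting_path_def path_def final_def\<close>)
  then obtain \<tau> v where \<tau>: "exec x b (While (Go 1) step) \<sigma>5 \<tau>" "Inv v (output_word as) \<tau>"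
    by auto
  have "exec x b (fetch M) \<sigma> \<tau>"
    unfolding fetch_def
  proof (rule exec_Seq, rule exec_copy)
    show "exec x b (assign (Var 6) 3 ;; load ;; clear Head ;; reset 1 (num_tapes M) ;;
        While (Go 1) step) (\<sigma>(Var 5 := ?h)) \<tau>"
      by (intro exec_Seq[OF exec_assign] exec_Seq[OF \<sigma>3(1)] exec_Seq[OF exec_clear]
          exec_Seq[OF \<sigma>5(1)] \<tau>(1)) (use b4 in auto)
  qed (use \<sigma> in auto)
  then show ?thesis using \<tau>(2) by (auto simp: Inv_def)
qed

section \<open>Running the machine for \<open>f\<close> on a recomputed input\<close>

definition f_read :: "bool option tm \<Rightarrow> (bool cell \<Rightarrow> cmd) \<Rightarrow> cmd" where
  "f_read M P = IfZ (Var 4) (P LeftEnd) (fetch M ;; switch (Var 6) 4 (\<lambda>k.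
     P (if k = 3 then RightEnd else Cell (k = 2))))"

definition factor :: "bool tm \<Rightarrow> bool option tm \<Rightarrow> cmd" where
  "factor M G = clear (Var 4) ;; reset 2 (num_tapes M) ;;
     While (Go 2) (sim_step M 2 (f_read G) (Inc (Var 4)) (Dec (Var 4)) (\<lambda>_. Skip)) ;; check M 2"

lemma run_factor:
  assumes G: "wf_tm G" "deterministic G" "halting_path G (encode_pair (x, i)) as"
    and sG: "\<And>bs. path G (encode_pair (x, i)) bs \<Longrightarrow> head_bound sG (final G (encode_pair (x, i)) bs)"
    and bG: "num_symbols G ^ sG \<le> b" "num_symbols G \<le> b" "sG \<le> b" "num_states G \<le> b"
      "4 ^ (length (binary i) + 2) \<le> b" "length (binary i) + 2 \<le> b"
    and M: "wf_tm M" "no_output M" "halts_on_every_path M (output_word as)"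
    and s: "\<And>bs. path M (output_word as) bs \<Longrightarrow> head_bound s (final M (output_word as) bs)"
    and b: "num_symbols M ^ s \<le> b" "num_symbols M \<le> b" "s \<le> b" "num_states M \<le> b"
      "length (output_word as) + 1 \<le> b"
    and \<sigma>: "\<sigma> Tmp = 0" "\<sigma> (Var 1) = i" "0 < i" "i \<le> b"
    and Q: "\<And>\<sigma>'. \<sigma>' Tmp = 0 \<Longrightarrow> \<sigma>' (Var 0) = \<sigma> (Var 0) \<Longrightarrow> \<sigma>' (Var 1) = i \<Longrightarrow> run x b Q cs \<sigma>' N"
  shows "run x b Q (factor M G # cs) \<sigma> (card (accepting_paths M (output_word as)) * N)"
proof -
  let ?y = "output_word as"
  have b4: "4 \<le> b" using four_le[of i b] bG by blast
  \<comment> \<open>The bound on \<open>v\<close> keeps \<open>Var 4\<close>, the position to be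
    fetched, within the capacity.\<close>
  let ?Inv = "\<lambda>v zs \<tau>. v \<le> length ?y + 1 \<and> \<tau> Tmp = 0 \<and> \<tau> (Var 4) = v \<and> \<tau> (Var 1) = i \<and>
    \<tau> (Var 0) = \<sigma> (Var 0)"
  \<comment> \<open>The machine for \<open>f\<close> emits nothing, so the predicted output is empty
    and the requirement on \<open>out\<close> is vacuous.\<close>
  interpret simulation x b M 2 ?y s "f_read G" "Inc (Var 4)" "Dec (Var 4)" "\<lambda>_. Skip" "[]" ?Inv
  proof
    fix v zs \<tau> assume Inv: "?Inv v zs \<tau>"
    show "\<exists>\<tau>'. ?Inv v zs \<tau>' \<and> (\<forall>r. own 2 r \<longrightarrow> \<tau>' r = \<tau> r) \<and>
        (\<forall>P Q cs N. run x b Q (P (input_cell ?y v) # cs) \<tau>' N \<longrightarrow> run x b Q (f_read G P # cs) \<tau> N)"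
    proof (cases v)
      case 0
      then show ?thesis
        using Inv by (intro exI[of _ \<tau>]) (auto simp: f_read_def input_cell_def intro: run_IfZ)
    next
      case (Suc v')
      obtain \<tau>' where \<tau>': "exec x b (fetch G) \<tau> \<tau>'" "\<tau>' Tmp = 0"
          "\<tau>' (Var 6) = fetched v ?y" "\<forall>r. keep r \<longrightarrow> \<tau>' r = \<tau> r"
        using exec_fetch[OF G sG bG, of \<tau>] Inv Suc \<sigma> b(5) by auto
      have "run x b Q (f_read G P # cs) \<tau> N"
        if "run x b Q (P (input_cell ?y v) # cs) \<tau>' N" for P Q cs N
      proof -
        have "run x b Q (switch (Var 6) 4 (\<lambda>k. P (if k = 3 then RightEnd else Cell (k = 2))) # cs) \<tau>' N"
          by (rule run_switch)
            (use that \<tau>'(3) b4 Suc in \<open>auto simp: fetched_def digit_def input_cell_def split: if_splits\<close>)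
        then have "run x b Q ((fetch G ;; switch (Var 6) 4
            (\<lambda>k. P (if k = 3 then RightEnd else Cell (k = 2)))) # cs) \<tau> N"
          by (intro run_Seq exec_run[OF \<tau>'(1)])
        then show ?thesis unfolding f_read_def by (intro run_IfZ) (use Inv Suc in simp)
      qed
      then show ?thesis
        using Inv \<tau>' by (intro exI[of _ \<tau>']) (auto simp: keep_def)
    qed
    show "\<exists>\<tau>'. exec x b (Inc (Var 4)) \<tau> \<tau>' \<and> ?Inv (Suc v) zs \<tau>' \<and> (\<forall>r. own 2 r \<longrightarrow> \<tau>' r = \<tau> r)"
      if "v \<le> length ?y"
      using Inv that b(5) exec_Inc[of \<tau> "Var 4" x b]
      by (intro exI[of _ "\<tau>(Var 4 := Suc v)"]) (auto simp: capacity_def)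
  next
    fix v zs \<tau> assume Inv: "?Inv (Suc v) zs \<tau>"
    then show "\<exists>\<tau>'. exec x b (Dec (Var 4)) \<tau> \<tau>' \<and> ?Inv v zs \<tau>' \<and> (\<forall>r. own 2 r \<longrightarrow> \<tau>' r = \<tau> r)"
      using exec_Dec[of \<tau> "Var 4" x b] by (intro exI[of _ "\<tau>(Var 4 := v)"]) auto
  qed (use M b in auto)
  let ?\<sigma>1 = "\<sigma>(Var 4 := 0)"
  obtain \<sigma>2 where \<sigma>2: "exec x b (reset 2 (num_tapes M)) ?\<sigma>1 \<sigma>2" "\<sigma>2 (St 2) = 0" "\<sigma>2 (Go 2) = 1"
      "\<forall>j < num_tapes M. \<forall>r \<in> tape_regs 2 j. \<sigma>2 r = 0" "\<forall>r. \<not> own 2 r \<longrightarrow> \<sigma>2 r = ?\<sigma>1 r"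
    using exec_reset[of b x 2 "num_tapes M" ?\<sigma>1] b4 by auto
  have rep: "rep (initial M) [] \<sigma>2"
    by (rule rep_initial) (use \<sigma>2 \<sigma> s[of "[]"] in \<open>auto simp: path_def final_def\<close>)
  have "run x b Q (While (Go 2) step # check M 2 # cs) \<sigma>2 (card (accepting_paths M ?y) * N)"
    by (rule run_counting_loop[OF M(2) counts_complete[where B = "head_bound s", OF M(1,3) s] rep \<sigma>2(3)])
      (auto intro: Q)
  then show ?thesis
    unfolding factor_def
    by (intro run_Seq exec_run[OF exec_clear] exec_run[OF \<sigma>2(1)])
qed

section \<open>Polynomial bounds\<close>

text \<open>The base \<open>n + 2\<close> is at least 2 for every \<open>n\<close>, so that a single
  exponent absorbs constants and small \<open>n\<close> need no special treatment.\<close>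

definition polynomially_bounded :: "(nat \<Rightarrow> nat) \<Rightarrow> bool" where
  "polynomially_bounded \<phi> \<longleftrightarrow> (\<exists>k. \<forall>n. \<phi> n \<le> (n + 2) ^ k)"

lemma polynomially_boundedI: "(\<And>n. \<phi> n \<le> (n + 2) ^ k) \<Longrightarrow> polynomially_bounded \<phi>"
  by (auto simp: polynomially_bounded_def)

lemma polynomially_bounded_mono:
  "polynomially_bounded \<psi> \<Longrightarrow> (\<And>n. \<phi> n \<le> \<psi> n) \<Longrightarrow> polynomially_bounded \<phi>"
  unfolding polynomially_bounded_def by (meson order.trans)

lemma polynomially_bounded_const: "polynomially_bounded (\<lambda>_. c)"
proof (rule polynomially_boundedI)
  fix n
  have "c \<le> 2 ^ c" using less_exp[of c] by simp
  also have "\<dots> \<le> (n + 2) ^ c" by (rule power_mono) auto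
  finally show "c \<le> (n + 2) ^ c" .
qed

lemma polynomially_bounded_ident: "polynomially_bounded (\<lambda>n. n)"
  by (rule polynomially_boundedI[where k = 1]) simp

lemma polynomially_bounded_mult:
  assumes "polynomially_bounded \<phi>" "polynomially_bounded \<psi>"
  shows "polynomially_bounded (\<lambda>n. \<phi> n * \<psi> n)"
proof -
  obtain k l where "\<And>n. \<phi> n \<le> (n + 2) ^ k" "\<And>n. \<psi> n \<le> (n + 2) ^ l"
    using assms by (auto simp: polynomially_bounded_def)
  then have "\<phi> n * \<psi> n \<le> (n + 2) ^ (k + l)" for n
    by (simp add: power_add mult_le_mono)
  then show ?thesis by (rule polynomially_boundedI)
qed

text \<open>A sum is dominated by the product of the terms increased by one, so closure under
  products carries over once adding \<open>1\<close> is settled.\<close>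

lemma polynomially_bounded_add:
  assumes "polynomially_bounded \<phi>" "polynomially_bounded \<psi>"
  shows "polynomially_bounded (\<lambda>n. \<phi> n + \<psi> n)"
proof (rule polynomially_bounded_mono)
  show "polynomially_bounded (\<lambda>n. (\<phi> n + 1) * (\<psi> n + 1))"
  proof (rule polynomially_bounded_mult)
    have "polynomially_bounded (\<lambda>n. \<phi> n + 1)" if \<phi>: "polynomially_bounded \<phi>" for \<phi>
    proof -
      obtain k where k: "\<And>n. \<phi> n \<le> (n + 2) ^ k"
        using \<phi> by (auto simp: polynomially_bounded_def)
      have "\<phi> n + 1 \<le> (n + 2) ^ Suc k" for n
      proof -
        have "1 \<le> (n + 2) ^ k" by (rule one_le_power) simp
        moreover have "2 * (n + 2) ^ k \<le> (n + 2) * (n + 2) ^ k" by (rule mult_le_mono1) simp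
        ultimately show ?thesis using k[of n] unfolding power_Suc by linarith
      qed
      then show ?thesis by (rule polynomially_boundedI)
    qed
    then show "polynomially_bounded (\<lambda>n. \<phi> n + 1)" "polynomially_bounded (\<lambda>n. \<psi> n + 1)"
      using assms by blast+
  qed
qed (simp add: algebra_simps)

lemma polynomially_bounded_power:
  "polynomially_bounded \<phi> \<Longrightarrow> polynomially_bounded (\<lambda>n. \<phi> n ^ k)"
  by (induction k) (simp_all add: polynomially_bounded_const polynomially_bounded_mult)

lemmas polynomially_bounded_intros =
  polynomially_bounded_const polynomially_bounded_ident polynomially_bounded_mult
  polynomially_bounded_add polynomially_bounded_power

lemma polynomially_bounded_poly:
  fixes q :: "nat poly"
  shows "polynomially_bounded (poly q)"
  by (induction q) (auto intro!: polynomially_bounded_intros)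

text \<open>The reason is that \<open>c\<close> to the power \<open>C * ln n\<close> equals
  \<open>n\<close> to the power \<open>C * ln c\<close>.\<close>

lemma polynomially_bounded_power_log:
  fixes s :: "nat \<Rightarrow> nat"
  assumes "(\<lambda>n. real (s n)) \<in> O(\<lambda>n. ln (real n))"
  shows "polynomially_bounded (\<lambda>n. c ^ s n)"
proof -
  obtain C where C: "C > 0" "\<forall>\<^sub>F n in at_top. norm (real (s n)) \<le> C * norm (ln (real n))"
    using assms by (elim landau_o.bigE)
  then obtain n0 where n0: "\<And>n. n0 \<le> n \<Longrightarrow> real (s n) \<le> C * \<bar>ln (real n)\<bar>"
    by (auto simp: eventually_at_top_linorder)
  \<comment> \<open>Passing to a base of at least 1 makes its logarithm nonnegative, as the
    estimates below require, even for \<open>c = 0\<close>.\<close>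
  define d where "d = Suc c"
  define k where "k = nat \<lceil>C * ln (real d)\<rceil>"
  have d: "1 \<le> d" "c \<le> d" by (simp_all add: d_def)
  have large: "d ^ s n \<le> (n + 2) ^ k" if n: "n0 + 1 \<le> n" for n
  proof -
    have "real (s n) * ln (real d) \<le> C * ln (real n) * ln (real d)"
      using n0[of n] n d by (intro mult_right_mono) auto
    also have "\<dots> = (C * ln (real d)) * ln (real n)" by simp
    also have "\<dots> \<le> real k * ln (real n)"
      using n unfolding k_def by (intro mult_right_mono) (auto intro: real_nat_ceiling_ge)
    finally have "ln (real d ^ s n) \<le> ln (real n ^ k)"
      using d n by (simp add: ln_realpow)
    then have "real d ^ s n \<le> real n ^ k"
      using d n by (subst (asm) ln_le_cancel_iff) auto
    then have "d ^ s n \<le> n ^ k" by (metis of_nat_le_iff of_nat_power)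
    also have "\<dots> \<le> (n + 2) ^ k" by (intro power_mono) auto
    finally show ?thesis .
  qed
  \<comment> \<open>The bound on \<open>s\<close> is only asymptotic; this constant pays for the
    finitely many arguments up to the threshold.\<close>
  define K where "K = (\<Sum>n\<le>n0. d ^ s n)"
  have "c ^ s n \<le> K + (n + 2) ^ k" for n
  proof -
    have "c ^ s n \<le> d ^ s n" using d by (intro power_mono) auto
    also have "\<dots> \<le> K + (n + 2) ^ k"
    proof (cases "n \<le> n0")
      case True
      then have "d ^ s n \<le> K" unfolding K_def by (intro member_le_sum) auto
      then show ?thesis by simp
    qed (use large[of n] in auto)
    finally show ?thesis .
  qed
  then show ?thesis
    by (rule polynomially_bounded_mono[rotated]) (intro polynomially_bounded_intros)
qed

lemma log_space_binary_length:
  assumes "polynomially_bounded b"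
  shows "\<exists>L. (\<forall>n. b n < 2 ^ L n) \<and> (\<lambda>n. real (L n)) \<in> O(\<lambda>n. ln (real n))"
proof -
  obtain k where k: "\<And>n. b n \<le> (n + 2) ^ k"
    using assms by (auto simp: polynomially_bounded_def)
  define l where "l n = nat \<lceil>log 2 (real (n + 2))\<rceil>" for n :: nat
  have l: "n + 2 \<le> 2 ^ l n" for n
  proof -
    have "log 2 (real (n + 2)) \<le> real (l n)"
      unfolding l_def by (rule real_nat_ceiling_ge)
    then have "real (n + 2) \<le> 2 powr real (l n)" by (subst (asm) log_le_iff) auto
    then have "real (n + 2) \<le> real (2 ^ l n)" by (simp add: powr_realpow)
    then show ?thesis by (simp only: of_nat_le_iff)
  qed
  have b: "b n < 2 ^ (k * l n + 1)" for n
  proof -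
    have "b n \<le> (2 ^ l n) ^ k"
      using k[of n] power_mono[OF l[of n], of k] by (meson le_trans zero_le)
    also have "\<dots> = 2 ^ (k * l n)" by (simp add: power_mult[symmetric] mult.commute)
    also have "\<dots> < 2 ^ (k * l n + 1)" by simp
    finally show ?thesis .
  qed
  have "(\<lambda>n. real (k * l n + 1)) \<in> O(\<lambda>n. ln (real n))"
  \<comment> \<open>From 3 on, \<open>n + 2\<close> is at most \<open>n * n\<close>, which gives the
    factor \<open>2 / ln 2\<close>. The rounding of \<open>l n\<close> and the last bit cost one
    each, paid for by \<open>1 \<le> ln n\<close>.\<close>
  proof (rule bigoI[where c = "real k * (2 / ln 2 + 1) + 1"])
    show "\<forall>\<^sub>F n in at_top. norm (real (k * l n + 1)) \<le> (real k * (2 / ln 2 + 1) + 1) * norm (ln (real n))"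
    proof (rule eventually_at_top_linorderI[of 3])
      fix n :: nat assume n: "3 \<le> n"
      have ln1: "1 \<le> ln (real n)" using n exp_le by (subst ln_ge_iff) auto
      have "n + 2 \<le> n * n" using mult_le_mono1[of 3 n n] n by linarith
      then have "ln (real (n + 2)) \<le> ln (real (n * n))"
        by (subst ln_le_cancel_iff) (use n in \<open>auto simp del: of_nat_add of_nat_mult\<close>)
      then have "ln (real (n + 2)) \<le> 2 * ln (real n)" using n by (simp add: ln_mult)
      then have "log 2 (real (n + 2)) \<le> 2 / ln 2 * ln (real n)"
        by (simp add: log_def field_simps)
      moreover have "0 \<le> log 2 (real (n + 2))" by (subst zero_le_log_cancel_iff) auto
      then have "real (l n) \<le> log 2 (real (n + 2)) + 1"
        using of_int_ceiling_le_add_one[of "log 2 (real (n + 2))"] by (simp add: l_def)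
      ultimately have "real (l n) \<le> (2 / ln 2 + 1) * ln (real n)"
        using ln1 by (simp add: algebra_simps)
      then have "real k * real (l n) \<le> real k * ((2 / ln 2 + 1) * ln (real n))"
        by (intro mult_left_mono) auto
      then show "norm (real (k * l n + 1)) \<le> (real k * (2 / ln 2 + 1) + 1) * norm (ln (real n))"
        using ln1 by (simp add: algebra_simps)
    qed
  qed
  with b show ?thesis by (intro exI[of _ "\<lambda>n. k * l n + 1"]) blast
qed

section \<open>The length of halting deterministic computations\<close>

lemma halting_path_from_unique:
  assumes "deterministic M"
    and "path_from M x c as" "actions M x (fold (perform x) as c) = {}"
    and "path_from M x c bs" "actions M x (fold (perform x) bs c) = {}"
  shows "as = bs"
  using assms(2-)
proof (induction as arbitrary: c bs)
  case Nil
  then show ?case by (cases bs) auto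
next
  case (Cons a as)
  then obtain b' bs' where bs: "bs = b' # bs'" by (cases bs) auto
  then have "a = b'"
    using Cons.prems assms(1) by (auto simp: deterministic_def actions_def)
  then show ?case using Cons bs by auto
qed

text \<open>Tape contents are functions on all of \<open>nat\<close>. Only because the cells from
  \<open>s\<close> on are blank do the first \<open>s\<close> cells determine a tape, which makes
  configurations countable by finite data.\<close>

lemma blank_beyond:
  assumes "wf_tm M" "path M x as" "\<And>bs. path M x bs \<Longrightarrow> head_bound s (final M x bs)"
  shows "\<forall>(t, h) \<in> set (tapes (final M x as)). \<forall>i \<ge> s. t i = 0"
  using assms(2)
proof (induction as rule: rev_induct)
  case Nil
  then show ?case by (auto simp: final_def initial_def)
next
  case (snoc a as)
  then have path: "path M x as" by (simp add: path_snoc)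
  have "\<forall>i \<ge> s. t i = 0" if th: "(t, h) \<in> set (map2 update_tape (work a) (tapes (final M x as)))" for t h
  proof -
    obtain v d t' h' where *: "(t', h') \<in> set (tapes (final M x as))" "(t, h) = update_tape (v, d) (t', h')"
      using th by (auto dest: set_zip_rightD)
    moreover have "h' < s" using assms(3)[OF path] * by (auto simp: head_bound_def)
    moreover have "\<forall>i \<ge> s. t' i = 0" using snoc.IH[OF path] * by auto
    ultimately show ?thesis by auto
  qed
  then have "\<forall>(t, h) \<in> set (map2 update_tape (work a) (tapes (final M x as))). \<forall>i \<ge> s. t i = 0"
    by blast
  then show ?case by (simp add: final_snoc perform_def del: set_map)
qed

lemma input_pos_final: "input_pos (final M x as) \<le> length x + 1"
  by (induction as rule: rev_induct) (auto simp: final_def initial_def perform_def)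

lemma length_halting_path:
  assumes M: "wf_tm M" "deterministic M" "halting_path M x as"
    and s: "\<And>bs. path M x bs \<Longrightarrow> head_bound s (final M x bs)"
  shows "length as \<le> num_states M * (length x + 2) * (num_symbols M ^ s * s) ^ num_tapes M"
proof -
  \<comment> \<open>\<open>?V\<close> describes one tape by its first \<open>s\<close> cells and its
    head position; \<open>?A\<close> adds the state and one of the \<open>length x + 2\<close> input
    positions.\<close>
  let ?V = "{vs. set vs \<subseteq> {..<num_symbols M} \<and> length vs = s} \<times> {..<s}"
  let ?A = "{..<num_states M} \<times> {..length x + 1} \<times> {ts. set ts \<subseteq> ?V \<and> length ts = num_tapes M}"
  let ?f = "\<lambda>c. (state c, input_pos c, map (\<lambda>(t, h). (map t [0..<s], h)) (tapes c))"
  let ?c = "\<lambda>j. final M x (take j as)"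
  have fV: "finite ?V" by (intro finite_cartesian_product finite_lists_length_eq) auto
  have cV: "card ?V = num_symbols M ^ s * s"
    by (simp add: card_cartesian_product card_lists_length_eq)
  have cA: "card ?A = num_states M * (length x + 2) * (num_symbols M ^ s * s) ^ num_tapes M"
    by (simp only: card_cartesian_product[of _ "_ \<times> {ts. set ts \<subseteq> ?V \<and> length ts = num_tapes M}"]
        card_cartesian_product[of _ "{ts. set ts \<subseteq> ?V \<and> length ts = num_tapes M}"]
        card_lists_length_eq[OF fV] cV) (simp add: algebra_simps)
  have fA: "finite ?A"
    using finite_lists_length_eq[OF fV] by (intro finite_cartesian_product) auto
  have path: "path M x (take j as)" for j
    using M(3) path_from_append[of M x _ "take j as" "drop j as"]
    by (auto simp: halting_path_def path_def)
  have image: "?f (?c j) \<in> ?A" for j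
  proof -
    have wf: "wf_config M (?c j)" by (rule wf_config_final[OF M(1) path])
    have "(map t [0..<s], h) \<in> ?V" if "(t, h) \<in> set (tapes (?c j))" for t h
      using that wf s[OF path[of j]] by (auto simp: wf_config_def head_bound_def)
    then have "set (map (\<lambda>(t, h). (map t [0..<s], h)) (tapes (?c j))) \<subseteq> ?V"
      unfolding set_map by (intro image_subsetI) (metis (no_types, lifting) case_prod_conv surj_pair)
    then show ?thesis
      using wf input_pos_final[of M x "take j as"] by (simp add: wf_config_def)
  qed
  have inj: "inj_on (\<lambda>j. ?f (?c j)) {..length as}"
  proof (rule inj_onI)
    fix i j assume ij: "i \<in> {..length as}" "j \<in> {..length as}" and eq: "?f (?c i) = ?f (?c j)"
    have "tapes (?c i) = tapes (?c j)"
    proof (rule nth_equalityI)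
      show len: "length (tapes (?c i)) = length (tapes (?c j))"
        using eq map_eq_imp_length_eq by blast
      fix l assume l: "l < length (tapes (?c i))"
      obtain t h t' h' where th: "tapes (?c i) ! l = (t, h)" "tapes (?c j) ! l = (t', h')"
        by fastforce
      have "map (\<lambda>(t, h). (map t [0..<s], h)) (tapes (?c i)) ! l =
          map (\<lambda>(t, h). (map t [0..<s], h)) (tapes (?c j)) ! l"
        using eq by simp
      then have "map t [0..<s] = map t' [0..<s]" "h = h'"
        using l len th by auto
      moreover have "(t, h) \<in> set (tapes (?c i))" "(t', h') \<in> set (tapes (?c j))"
        using l len th nth_mem by metis+
      then have "\<forall>k \<ge> s. t k = 0" "\<forall>k \<ge> s. t' k = 0"
        using blank_beyond[OF M(1) path s] by blast+
      ultimately have "t k = t' k" for k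
        by (cases "k < s") (auto simp: map_eq_conv)
      then show "tapes (?c i) ! l = tapes (?c j) ! l" using th \<open>h = h'\<close> by auto
    qed
    then have c: "?c i = ?c j" using eq by (auto intro: config.expand)
    have rest: "path_from M x (?c k) (drop k as) \<and> actions M x (fold (perform x) (drop k as) (?c k)) = {}" for k
    proof -
      have "path_from M x (initial M) (take k as @ drop k as)"
          "actions M x (fold (perform x) (take k as @ drop k as) (initial M)) = {}"
        using M(3) by (simp_all add: halting_path_def path_def final_def del: fold_append)
      then show ?thesis
        unfolding path_from_append fold_append comp_apply final_def by blast
    qed
    \<comment> \<open>The remaining actions depend only on the configuration, so equal
      configurations leave equally many of them.\<close>
    have "drop i as = drop j as"
      using halting_path_from_unique[OF M(2)] rest[of i] rest[of j] c by metis
    then have "length as - i = length as - j" by (metis length_drop)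
    then show "i = j" using ij by auto
  qed
  have "Suc (length as) = card ((\<lambda>j. ?f (?c j)) ` {..length as})"
    using card_image[OF inj] by simp
  also have "\<dots> \<le> card ?A"
    by (rule card_mono[OF fA]) (use image in blast)
  finally show ?thesis using cA by simp
qed

lemma length_output_word: "length (output_word as) \<le> length as"
  unfolding output_word_def by (induction as) (auto simp: map_filter_simps split: option.splits)

text \<open>Squared, this makes the bound \<open>4 ^ length (binary i)\<close> for the stored digits
  quadratic in \<open>i\<close>.\<close>

lemma power2_length_binary: "0 < i \<Longrightarrow> 2 ^ length (binary i) \<le> 2 * i"
proof (induction i rule: less_induct)
  case (less i)
  show ?case
  proof (cases "i < 2")
    case True
    then show ?thesis using less.prems by (simp add: binary.simps)
  next
    case False
    then have "length (binary i) = Suc (length (binary (i div 2)))" by (subst binary.simps) simp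
    moreover have "2 ^ length (binary (i div 2)) \<le> 2 * (i div 2)"
      using less.IH[of "i div 2"] False by simp
    ultimately show ?thesis by simp
  qed
qed


section \<open>The product\<close>

text \<open>All counters start at zero, so raising the flag \<open>Go 0\<close> is the whole
  initialisation for the first machine.\<close>

definition product_program :: "bool tm \<Rightarrow> bool option tm \<Rightarrow> bool tm \<Rightarrow> cmd" where
  "product_program P G M =
     Inc (Go 0) ;; p_loop P ;; While (Var 0) (Dec (Var 0) ;; Inc (Var 1) ;; factor M G)"

text \<open>A factor multiplies the count of its continuation, and that continuation is the rest of
  the loop. The product therefore unfolds from its first remaining factor, and the empty product is
  the count 1 of the empty stack.\<close>

lemma run_product_loop:
  assumes "\<And>i \<sigma> Q cs N. \<sigma> Tmp = 0 \<Longrightarrow> \<sigma> (Var 1) = i \<Longrightarrow> 0 < i \<Longrightarrow> i \<le> k \<Longrightarrow>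
      (\<And>\<sigma>'. \<sigma>' Tmp = 0 \<Longrightarrow> \<sigma>' (Var 0) = \<sigma> (Var 0) \<Longrightarrow> \<sigma>' (Var 1) = i \<Longrightarrow> run x b Q cs \<sigma>' N) \<Longrightarrow>
      run x b Q (c # cs) \<sigma> (F i * N)"
    and "k \<le> b" "\<sigma> Tmp = 0" "\<sigma> (Var 0) = n" "\<sigma> (Var 1) = k - n" "n \<le> k"
  shows "run x b (\<lambda>_. True) [While (Var 0) (Dec (Var 0) ;; Inc (Var 1) ;; c)] \<sigma> (\<Prod>i = Suc (k - n)..k. F i)"
  using assms(3-)
proof (induction n arbitrary: \<sigma>)
  case 0
  then show ?case by (simp add: run_While0 run_Nil del: One_nat_def)
next
  case (Suc n)
  let ?L = "While (Var 0) (Dec (Var 0) ;; Inc (Var 1) ;; c)"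
  let ?i = "k - n"
  let ?\<sigma>1 = "\<sigma>(Var 0 := n)" and ?\<sigma>2 = "\<sigma>(Var 0 := n, Var 1 := ?i)"
  have i: "Suc (k - Suc n) = ?i" using Suc.prems by simp
  have e1: "exec x b (Dec (Var 0)) \<sigma> ?\<sigma>1"
    using exec_Dec[of \<sigma> "Var 0" x b] Suc.prems by simp
  have e2: "exec x b (Inc (Var 1)) ?\<sigma>1 ?\<sigma>2"
    using exec_Inc[of ?\<sigma>1 "Var 1" x b] Suc.prems assms(2) i by (simp add: capacity_def)
  have "run x b (\<lambda>_. True) (c # [?L]) ?\<sigma>2 (F ?i * (\<Prod>i = Suc (k - n)..k. F i))"
  proof (rule assms(1))
    show "run x b (\<lambda>_. True) [?L] \<sigma>' (\<Prod>i = Suc (k - n)..k. F i)"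
      if "\<sigma>' Tmp = 0" "\<sigma>' (Var 0) = ?\<sigma>2 (Var 0)" "\<sigma>' (Var 1) = ?i" for \<sigma>'
      by (rule Suc.IH) (use that Suc.prems in auto)
  qed (use Suc.prems in auto)
  moreover have "F ?i * (\<Prod>i = Suc (k - n)..k. F i) = (\<Prod>i = Suc (k - Suc n)..k. F i)"
    unfolding i by (rule prod.atLeast_Suc_atMost[symmetric]) simp
  ultimately have "run x b (\<lambda>_. True) (c # [?L]) ?\<sigma>2 (\<Prod>i = Suc (k - Suc n)..k. F i)"
    by simp
  then show ?case
    using Suc.prems(2) by (intro run_While run_Seq exec_run[OF e1] exec_run[OF e2]) auto
qed

lemma log_space_onE:
  assumes "log_space_on X M"
  obtains s where "(\<lambda>n. real (s n)) \<in> O(\<lambda>n. ln (real n))"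
    "\<And>x as. x \<in> X \<Longrightarrow> path M x as \<Longrightarrow> head_bound (s (length x)) (final M x as)"
  using assms by (auto simp: log_space_on_def head_bound_def)

lemma le_power_Suc: "n \<le> Suc c ^ n" if "0 < c"
proof -
  have "n \<le> 2 ^ n" using less_exp[of n] by simp
  also have "\<dots> \<le> Suc c ^ n" by (rule power_mono) (use that in auto)
  finally show ?thesis .
qed

theorem theorem2p5:
  fixes f :: "bool list \<Rightarrow> nat"
    and g :: "bool list \<times> nat \<Rightarrow> bool list"
    and p :: "bool list \<Rightarrow> nat"
  assumes "f \<in> sharpL"
    and "g \<in> FL encode_pair"
    and "p \<in> FL_nonneg"
    and "\<exists>q :: nat poly. \<forall>x. p x \<le> poly q (length x)"
  shows "(\<lambda>x. \<Prod>i = 1..p x. f (g (x, i))) \<in> sharpL"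
proof -
  obtain M where M: "wf_tm M" "no_output M" "log_space_on UNIV M" "\<And>x. halts_on_every_path M x"
      "\<And>x. f x = card (accepting_paths M x)"
    using assms(1) by (auto simp: sharpL_def)
  obtain G where G: "wf_tm G" "deterministic G" "log_space_on (range encode_pair) G"
      "\<And>u. \<exists>as. halting_path G (encode_pair u) as \<and> output_word as = g u"
    using assms(2) by (auto simp: FL_def)
  obtain P where P: "wf_tm P" "deterministic P" "log_space_on UNIV P"
      "\<And>x. \<exists>as. halting_path P x as \<and> output_word as = binary (p x)"
    using assms(3) by (auto simp: FL_nonneg_def FL_def)
  obtain q where q: "\<And>x. p x \<le> poly q (length x)" using assms(4) by blast
  obtain sM where sM: "(\<lambda>n. real (sM n)) \<in> O(\<lambda>n. ln (real n))"
    "\<And>x as. path M x as \<Longrightarrow> head_bound (sM (length x)) (final M x as)"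
    using log_space_onE[OF M(3)] by auto
  obtain sG where sG: "(\<lambda>n. real (sG n)) \<in> O(\<lambda>n. ln (real n))"
    "\<And>u as. path G (encode_pair u) as \<Longrightarrow>
      head_bound (sG (length (encode_pair u))) (final G (encode_pair u) as)"
    using log_space_onE[OF G(3)] by (metis rangeI)
  obtain sP where sP: "(\<lambda>n. real (sP n)) \<in> O(\<lambda>n. ln (real n))"
    "\<And>x as. path P x as \<Longrightarrow> head_bound (sP (length x)) (final P x as)"
    using log_space_onE[OF P(3)] by auto

  \<comment> \<open>The base is at least 2, so by \<open>le_power_Suc\<close> one power dominates
    both the stack sizes and the space bound itself.\<close>
  define SM where "SM n = Suc (num_symbols M) ^ sM n" for n
  define SG where "SG n = Suc (num_symbols G) ^ sG n" for n
  define SP where "SP n = Suc (num_symbols P) ^ sP n" for n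
  have pb: "polynomially_bounded SM" "polynomially_bounded SG" "polynomially_bounded SP"
    unfolding SM_def SG_def SP_def using sM(1) sG(1) sP(1)
    by (auto intro: polynomially_bounded_power_log)
  have S_le: "num_symbols M ^ sM n \<le> SM n" "sM n \<le> SM n" "num_symbols G ^ sG n \<le> SG n"
      "sG n \<le> SG n" "num_symbols P ^ sP n \<le> SP n" "sP n \<le> SP n" for n
    unfolding SM_def SG_def SP_def using M(1) G(1) P(1)
    by (auto simp: wf_tm_def intro: power_mono le_power_Suc simp del: power_Suc)

  \<comment> \<open>The space bounds need not be monotone, whereas the lengths of the virtual inputs
    are only bounded from above. The monotone functions \<open>(n + 2) ^ k\<close> allow the passage
    from a length to its bound.\<close>
  obtain kM where kM: "\<And>n. SM n \<le> (n + 2) ^ kM"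
    using pb(1) by (auto simp: polynomially_bounded_def)
  obtain kG where kG: "\<And>n. SG n \<le> (n + 2) ^ kG"
    using pb(2) by (auto simp: polynomially_bounded_def)
  \<comment> \<open>These bound the length of the encoded pair, the length of
    \<open>g (x, i)\<close>, and all counters. The summand with 16 in \<open>b\<close> comes from
    the base 4 stack of \<open>length (binary i) + 2\<close> digits.\<close>
  define w where "w n = n + 1 + 2 * poly q n" for n
  define y where "y n = num_states G * (w n + 2) * ((w n + 2) ^ kG * (w n + 2) ^ kG) ^ num_tapes G" for n
  define b where "b n = num_symbols M + num_states M + num_symbols G + num_states G + num_symbols P +
    num_states P + SP n + poly q n + 16 * (2 * poly q n) ^ 2 + (w n + 2) ^ kG + (y n + 2) ^ kM + y n + 1" for n
  have pb_w: "polynomially_bounded w"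
    unfolding w_def by (intro polynomially_bounded_intros polynomially_bounded_poly)
  have pb_y: "polynomially_bounded y"
    unfolding y_def by (intro polynomially_bounded_intros pb_w)
  have pb_b: "polynomially_bounded b"
    unfolding b_def by (intro polynomially_bounded_intros polynomially_bounded_poly pb pb_w pb_y)

  have run: "run x (b (length x)) (\<lambda>_. True) [product_program P G M] (\<lambda>_. 0) (\<Prod>i = 1..p x. f (g (x, i)))" for x
  proof -
    let ?n = "length x" and ?b = "b (length x)"
    have factor: "run x ?b Q (factor M G # cs) \<sigma> (f (g (x, i)) * N)"
      if \<sigma>: "\<sigma> Tmp = 0" "\<sigma> (Var 1) = i" "0 < i" "i \<le> p x"
        and Q: "\<And>\<sigma>'. \<sigma>' Tmp = 0 \<Longrightarrow> \<sigma>' (Var 0) = \<sigma> (Var 0) \<Longrightarrow> \<sigma>' (Var 1) = i \<Longrightarrow> run x ?b Q cs \<sigma>' N"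
      for i \<sigma> Q cs N
    proof -
      let ?w = "encode_pair (x, i)"
      obtain as where as: "halting_path G ?w as" "output_word as = g (x, i)" using G(4) by blast
      have i: "i \<le> poly q ?n" using \<sigma>(4) q[of x] by simp
      have pow: "2 ^ length (binary i) \<le> 2 * poly q ?n"
        using power2_length_binary[OF \<sigma>(3)] i by linarith
      have "length (binary i) \<le> 2 * poly q ?n"
        by (rule order.trans[OF less_imp_le[OF less_exp] pow])
      then have len_w: "length ?w \<le> w ?n" by (simp add: length_encode_pair w_def)
      have SG: "SG (length ?w) \<le> (w ?n + 2) ^ kG"
        using kG[of "length ?w"] power_mono[of "length ?w + 2" "w ?n + 2" kG] len_w by simp
      have len_y: "length (g (x, i)) \<le> y ?n"
      proof -
        have "length (g (x, i)) \<le> length as" using length_output_word[of as] as(2) by simp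
        also have "\<dots> \<le> num_states G * (length ?w + 2) *
            (num_symbols G ^ sG (length ?w) * sG (length ?w)) ^ num_tapes G"
          by (rule length_halting_path[OF G(1,2) as(1) sG(2)])
        also have "\<dots> \<le> y ?n"
          unfolding y_def using len_w SG S_le(3,4)[of "length ?w"]
          by (intro mult_le_mono power_mono) auto
        finally show ?thesis .
      qed
      have SM: "SM (length (g (x, i))) \<le> (y ?n + 2) ^ kM"
        using kM[of "length (g (x, i))"] power_mono[of "length (g (x, i)) + 2" "y ?n + 2" kM] len_y by simp
      have four: "4 ^ (length (binary i) + 2) \<le> 16 * (2 * poly q ?n) ^ 2"
      proof -
        have "(4 :: nat) ^ length (binary i) = (2 ^ length (binary i)) ^ 2"
          by (simp add: power2_eq_square flip: power_mult_distrib)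
        then have "(4 :: nat) ^ (length (binary i) + 2) = 16 * (2 ^ length (binary i)) ^ 2"
          by simp
        then show ?thesis using power_mono[OF pow, of 2] by simp
      qed
      have "length (binary i) + 2 \<le> 4 ^ (length (binary i) + 2)"
        using le_power_Suc[of 3 "length (binary i) + 2"] by simp
      then have four': "length (binary i) + 2 \<le> 16 * (2 * poly q ?n) ^ 2" using four by linarith
      show ?thesis
        unfolding M(5) as(2)[symmetric]
      proof (rule run_factor[where sG = "sG (length ?w)" and s = "sM (length (output_word as))" and i = i and \<sigma> = \<sigma>])
        show "num_symbols G ^ sG (length ?w) \<le> ?b" "sG (length ?w) \<le> ?b"
          using S_le(3,4)[of "length ?w"] SG by (simp_all add: b_def)
        show "num_symbols M ^ sM (length (output_word as)) \<le> ?b" "sM (length (output_word as)) \<le> ?b"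
          using S_le(1,2)[of "length (g (x, i))"] SM as(2) by (simp_all add: b_def)
        show "4 ^ (length (binary i) + 2) \<le> ?b" "length (binary i) + 2 \<le> ?b"
          using four four' unfolding b_def by linarith+
        show "length (output_word as) + 1 \<le> ?b" using len_y as(2) by (simp add: b_def)
        show "i \<le> ?b" using i by (simp add: b_def)
      qed (use G(1,2) as M(1,2,4) sG(2) sM(2) \<sigma> Q in \<open>simp_all add: b_def\<close>)
    qed
    have p: "p x \<le> ?b" using q[of x] by (simp add: b_def)
    obtain as where as: "halting_path P x as" "output_word as = binary (p x)" using P(4) by blast
    have "num_symbols P ^ sP ?n \<le> ?b" "num_symbols P \<le> ?b" "sP ?n \<le> ?b" "num_states P \<le> ?b"
      using S_le(5,6)[of ?n] by (simp_all add: b_def)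
    from exec_p_loop[OF P(1,2) as sP(2) this p]
    obtain \<sigma> where \<sigma>: "exec x ?b (p_loop P) ((\<lambda>_. 0)(Go 0 := 1)) \<sigma>" "\<sigma> Tmp = 0" "\<sigma> (Var 0) = p x"
      "\<sigma> (Var 1) = 0" by auto
    have e: "exec x ?b (Inc (Go 0)) (\<lambda>_. 0) ((\<lambda>_. 0)(Go 0 := 1))"
      using exec_Inc[of "\<lambda>_. 0" "Go 0" x ?b] by (simp add: capacity_def b_def)
    \<comment> \<open>No factor has been processed yet, so the lower limit
      \<open>Suc (p x - p x)\<close> is 1.\<close>
    have "run x ?b (\<lambda>_. True) [While (Var 0) (Dec (Var 0) ;; Inc (Var 1) ;; factor M G)] \<sigma>
        (\<Prod>i = Suc (p x - p x)..p x. f (g (x, i)))"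
      by (rule run_product_loop[where F = "\<lambda>i. f (g (x, i))"]) (use factor p \<sigma> in auto)
    then show ?thesis
      unfolding product_program_def
      by (intro run_Seq exec_run[OF e] exec_run[OF \<sigma>(1)]) simp
  qed
  obtain L where "\<And>n. b n < 2 ^ L n" "(\<lambda>n. real (L n)) \<in> O(\<lambda>n. ln (real n))"
    using log_space_binary_length[OF pb_b] by blast
  with run show ?thesis by (rule cmd_in_sharpL)
qed

end
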